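(* Let $k\in\mathbb N$, $f=\lambda z+\mathrm{h.o.t.}\in\mathcal L_k$ with $0<\lambda<1$, let $f_0$ be its normal form and $\varphi\in\mathcal L_k^0$ the unique parabolic transseries with $\varphi\circ f\circ\varphi^{-1}=f_0$. Let $h\in\mathfrak L^0$, say $h\in\mathcal L_m^0$, and let $r=\max\{k,m\}$. Then the generalized Koenigs sequence $\big(f_0^{\circ(-n)}\circ h\circ f^{\circ n}\big)_{n\in\mathbb N}$ converges to $\varphi$ in the weak topology of $\mathcal L_r$ if and only if $\mathrm{Lb}_z(h)=\mathrm{Lb}_z(\varphi)$.
   Context: $z$ infinitesimal; $\boldsymbol\ell_1:=-1/\ln z$, $\boldsymbol\ell_{j+1}:=\boldsymbol\ell_j\circ\boldsymbol\ell_1$. $\mathcal L_k$: formal sums $\sum a_{\alpha,n_1,\dots,n_k}z^\alpha\boldsymbol\ell_1^{n_1}\cdots\boldsymbol\ell_k^{n_k}$, real coefficients, well-ordered support in $\mathbb R_{\ge0}\times\mathbb Z^k$ (lexicographic); $\mathfrak L=\bigcup_k\mathcal L_k$; parabolic = leading term $z$; $\mathcal L_k^0$, $\mathfrak L^0$ the groups of parabolic elements under composition. Normal form: if $f=\lambda z+\sum_{\mathbf 0_k<\boldsymbol m\le\mathbf 1_k}a_{\boldsymbol m}z\boldsymbol\ell_1^{m_1}\cdots\boldsymbol\ell_k^{m_k}+\mathrm{h.o.t.}$ then $f_0:=\lambda z+\sum_{\mathbf 0_k<\boldsymbol m\le\mathbf 1_k}a_{\boldsymbol m}z\boldsymbol\ell_1^{m_1}\cdots\boldsymbol\ell_k^{m_k}$.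 $f_0^{\circ(-n)}$ is the $n$-th iterate of the compositional inverse of $f_0$. Blockwise writing: every $f\in\mathcal L_k$ is uniquely $f=\sum_{\alpha\in\mathrm{Supp}_z(f)}z^\alpha R_\alpha$ where $\mathrm{Supp}_z(f)\subseteq\mathbb R_{\ge0}$ is the set of exponents of $z$ occurring in $f$ and each $R_\alpha$ involves only $\boldsymbol\ell_1,\dots,\boldsymbol\ell_k$; the leading block $\mathrm{Lb}_z(f)$ is $z^{\alpha_0}R_{\alpha_0}$ with $\alpha_0=\min\mathrm{Supp}_z(f)$. Weak topology on $\mathcal L_r$: a sequence $(\varphi_n)$ converges to $\varphi$ iff for every $(\alpha,n_1,\dots,n_r)\in\mathbb R_{\ge0}\times\mathbb Z^r$ the coefficient of $z^\alpha\boldsymbol\ell_1^{n_1}\cdots\boldsymbol\ell_r^{n_r}$ in $\varphi_n$ tends (in $\mathbb R$) to that in $\varphi$. *)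

theory Defs
  imports "HOL-Analysis.Analysis"
begin

text \<open>Logarithmic transseries.  A monomial z^a l_1^(n 1) ... l_j^(n j) ... is encoded as
  the pair (a, n) with n :: nat => int; index 0 of n is unused (always 0 for members of L_k),
  index j >= 1 is the exponent of l_j.  A transseries is its coefficient function.\<close>

type_synonym mon = "real \<times> (nat \<Rightarrow> int)"
type_synonym lts = "mon \<Rightarrow> real"

definition zv :: "nat \<Rightarrow> int" where "zv = (\<lambda>_. 0)"

definition vless :: "(nat \<Rightarrow> int) \<Rightarrow> (nat \<Rightarrow> int) \<Rightarrow> bool" where
  "vless n m \<longleftrightarrow> (\<exists>j. (\<forall>i<j. n i = m i) \<and> n j < m j)"

definition vle :: "(nat \<Rightarrow> int) \<Rightarrow> (nat \<Rightarrow> int) \<Rightarrow> bool" where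
  "vle n m \<longleftrightarrow> n = m \<or> vless n m"

text \<open>lexicographic order on monomials (smaller = asymptotically bigger)\<close>
definition mless :: "mon \<Rightarrow> mon \<Rightarrow> bool" where
  "mless x y \<longleftrightarrow> fst x < fst y \<or> (fst x = fst y \<and> vless (snd x) (snd y))"

definition supp :: "lts \<Rightarrow> mon set" where
  "supp f = {x. f x \<noteq> 0}"

definition wo_set :: "mon set \<Rightarrow> bool" where
  "wo_set S \<longleftrightarrow> wf {(x, y). x \<in> S \<and> y \<in> S \<and> mless x y}"

definition inL :: "nat \<Rightarrow> lts \<Rightarrow> bool" where
  "inL k f \<longleftrightarrow> (\<forall>x\<in>supp f. 0 \<le> fst x \<and> (\<forall>j. (j = 0 \<or> k < j) \<longrightarrow> snd x j = 0))
      \<and> wo_set (supp f)"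

definition mon :: "mon \<Rightarrow> lts" where
  "mon x = (\<lambda>y. if y = x then 1 else 0)"

definition tone :: lts where "tone = mon (0, zv)"

definition zid :: lts where "zid = mon (1, zv)"

definition ell :: "nat \<Rightarrow> lts" where
  "ell j = mon (0, \<lambda>i. if i = j then 1 else 0)"

definition madd :: "mon \<Rightarrow> mon \<Rightarrow> mon" where
  "madd x y = (fst x + fst y, \<lambda>j. snd x j + snd y j)"

definition tadd :: "lts \<Rightarrow> lts \<Rightarrow> lts" where "tadd f g = (\<lambda>x. f x + g x)"
definition tsub :: "lts \<Rightarrow> lts \<Rightarrow> lts" where "tsub f g = (\<lambda>x. f x - g x)"
definition scal :: "real \<Rightarrow> lts \<Rightarrow> lts" where "scal c f = (\<lambda>x. c * f x)"

definition tmult :: "lts \<Rightarrow> lts \<Rightarrow> lts" where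
  "tmult f g = (\<lambda>x. \<Sum>p\<in>{(y, w). f y \<noteq> 0 \<and> g w \<noteq> 0 \<and> madd y w = x}. f (fst p) * g (snd p))"

definition tpow :: "lts \<Rightarrow> nat \<Rightarrow> lts" where
  "tpow f n = (tmult f ^^ n) tone"

definition ssum :: "'i set \<Rightarrow> ('i \<Rightarrow> lts) \<Rightarrow> lts" where
  "ssum I F = (\<lambda>x. \<Sum>i\<in>{i\<in>I. F i x \<noteq> 0}. F i x)"

definition binser :: "real \<Rightarrow> lts \<Rightarrow> lts" where
  "binser b e = ssum UNIV (\<lambda>i::nat. scal (b gchoose i) (tpow e i))"

definition log1p :: "lts \<Rightarrow> lts" where
  "log1p e = ssum {1..} (\<lambda>i::nat. scal ((-1) ^ (i + 1) / real i) (tpow e i))"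

definition geom :: "lts \<Rightarrow> lts" where
  "geom e = ssum UNIV (\<lambda>i::nat. tpow e i)"

text \<open>Composition with an inner series g = c z (1 + eps), c > 0.
  Then z o g = c z (1 + eps), and l_j o g = l_j (1 + dlt g j) with
  1 + dlt g 1 = 1/(1 - l_1 (ln c + log(1+eps))),
  1 + dlt g (j+1) = 1/(1 - l_(j+1) log(1 + dlt g j)).\<close>
definition eps :: "lts \<Rightarrow> lts" where
  "eps g = (\<lambda>x. g (fst x + 1, snd x) / g (1, zv) - tone x)"

fun dlt :: "lts \<Rightarrow> nat \<Rightarrow> lts" where
  "dlt g 0 = eps g"
| "dlt g (Suc j) = tsub (geom (tmult (ell (Suc j))
      (if j = 0 then tadd (scal (ln (g (1, zv))) tone) (log1p (eps g)) else log1p (dlt g j)))) tone"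

definition comp_mon :: "lts \<Rightarrow> mon \<Rightarrow> lts" where
  "comp_mon g x = scal (g (1, zv) powr fst x)
     (tmult (mon x) (tmult (binser (fst x) (eps g))
       (foldr (\<lambda>j acc. tmult (binser (real_of_int (snd x j)) (dlt g j)) acc)
          [1..<Suc (Max ({0} \<union> {j. snd x j \<noteq> 0}))] tone)))"

definition comp :: "lts \<Rightarrow> lts \<Rightarrow> lts" where
  "comp f g = ssum (supp f) (\<lambda>x. scal (f x) (comp_mon g x))"

definition tinv :: "lts \<Rightarrow> lts" where
  "tinv f = (THE g. (\<exists>k. inL k g) \<and> comp f g = zid \<and> comp g f = zid)"

definition titer :: "lts \<Rightarrow> nat \<Rightarrow> lts" where
  "titer f n = ((\<lambda>g. comp f g) ^^ n) zid"

definition parabolic :: "lts \<Rightarrow> bool" where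
  "parabolic f \<longleftrightarrow> f (1, zv) = 1 \<and> (\<forall>x\<in>supp f. x \<noteq> (1, zv) \<longrightarrow> mless (1, zv) x)"

definition onek :: "nat \<Rightarrow> nat \<Rightarrow> int" where
  "onek k = (\<lambda>j. if 1 \<le> j \<and> j \<le> k then 1 else 0)"

definition nf :: "nat \<Rightarrow> lts \<Rightarrow> lts" where
  "nf k f = (\<lambda>x. if fst x = 1 \<and> vle zv (snd x) \<and> vle (snd x) (onek k) then f x else 0)"

definition lb :: "lts \<Rightarrow> lts" where
  "lb f = (\<lambda>x. if fst x = (LEAST a. \<exists>n. f (a, n) \<noteq> 0) then f x else 0)"

end

theory Submission
  imports Defs
begin

text \<open>
  Right composition \<open>C\<^sub>g : u \<mapsto> u \<circ> g\<close> with a series \<open>g = c z + \<dots>\<close>, \<open>c > 0\<close>, is a strongly linear ring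
  endomorphism of the Hahn series in \<open>z, \<ell>\<^sub>1, \<dots>, \<ell>\<^sub>K\<close>, triangular on monomials with diagonal entries
  \<open>c\<^bsup>\<alpha>\<^esup>\<close> at \<open>z\<^bsup>\<alpha>\<^esup> \<ell>\<^bsup>n\<^esup>\<close>; it is therefore injective and \<open>g\<close> has a compositional inverse. With
  \<open>q = f\<^sub>0\<^bsup>-1\<^esup>\<close> the conjugacy \<open>\<phi> \<circ> f = f\<^sub>0 \<circ> \<phi>\<close> turns the error of the Koenigs sequence into the linear
  expression \<open>C\<^sub>f\<^bsup>n\<^esup> (C\<^sub>h - C\<^sub>\<phi>) C\<^sub>q\<^bsup>n\<^esup> z\<close>. If \<open>z v\<close> is the leading monomial of \<open>h - \<phi>\<close>, then
  \<open>C\<^sub>h - C\<^sub>\<phi>\<close> multiplies every monomial by something of order at least \<open>v\<close>. Coefficients of iterates of a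
  triangular operator grow at most like the largest diagonal entry involved, up to an arbitrarily small
  exponential factor. So when \<open>v\<close> contains a power \<open>z\<^bsup>\<beta>\<^esup>\<close> with \<open>\<beta> > 0\<close>, every coefficient of the error is
  \<open>O(\<lambda>\<^bsup>n \<beta> / 2\<^esup>)\<close>; when it does not, the coefficient of the error at \<open>z v\<close> is the same nonzero
  constant for all \<open>n\<close>.
\<close>

section \<open>Well-ordered subsets of linearly ordered groups\<close>

text \<open>The decay rate comes from a competition. The coefficient of \<open>C_q^n z\<close> at a
  monomial u of z-exponent a grows like lam^(-n a), with no bound on a, while \<open>C_f^n\<close>
  shrinks what starts at a monomial x of z-exponent b like lam^(n b). They combine to lam^(n beta)
  only because \<open>C_h - C_phi\<close> leads from u to x with b >= a + beta. Half of beta is then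
  given away: monomials of equal z-exponent share one diagonal entry, so iterates may carry factors
  polynomial in n, which a strictly larger rate absorbs. Limits may be taken termwise because a
  fixed coefficient of the error involves finitely many pairs (u, x), the same ones for every n: the
  shifts caused by a composition lie in a well-ordered submonoid generated by infinitesimals, and
  iteration does not leave it. That this submonoid is well-ordered, and that an element is a sum of
  only finitely many different lengths, is Neumann's lemma; it also gives power series in
  infinitesimals a meaning. Multiplicativity and associativity of composition rest on the laws of (1
  + e)^b and log(1 + e) for formal e, which are derived from natural exponents b.\<close>

definition wos :: "'a::linorder set \<Rightarrow> bool" where
  "wos A \<longleftrightarrow> (\<forall>B. B \<subseteq> A \<longrightarrow> B \<noteq> {} \<longrightarrow> (\<exists>m\<in>B. \<forall>x\<in>B. m \<le> x))"

lemma wos_subset: "wos A \<Longrightarrow> B \<subseteq> A \<Longrightarrow> wos B"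
  unfolding wos_def by (meson subset_trans)

lemma wos_min: "wos A \<Longrightarrow> A \<noteq> {} \<Longrightarrow> \<exists>m\<in>A. \<forall>x\<in>A. m \<le> x"
  unfolding wos_def by blast

lemma wos_iff_wf:
  fixes A :: "'a::linorder set"
  shows "wos A \<longleftrightarrow> wf {(x, y). x \<in> A \<and> y \<in> A \<and> x < y}"
proof
  assume w: "wos A"
  show "wf {(x, y). x \<in> A \<and> y \<in> A \<and> x < y}"
  proof (rule wfI_min)
    fix x :: 'a and Q assume "x \<in> Q"
    show "\<exists>z\<in>Q. \<forall>y. (y, z) \<in> {(x, y). x \<in> A \<and> y \<in> A \<and> x < y} \<longrightarrow> y \<notin> Q"
    proof (cases "Q \<inter> A = {}")
      case True
      then show ?thesis using \<open>x \<in> Q\<close> by blast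
    next
      case False
      then obtain m where "m \<in> Q \<inter> A" "\<forall>x\<in>Q \<inter> A. m \<le> x"
        using w[unfolded wos_def, rule_format, of "Q \<inter> A"] by blast
      then show ?thesis by (intro bexI[of _ m]) (auto simp: not_le[symmetric])
    qed
  qed
next
  assume w: "wf {(x, y). x \<in> A \<and> y \<in> A \<and> x < y}"
  show "wos A"
    unfolding wos_def
  proof (intro allI impI)
    fix B assume B: "B \<subseteq> A" "B \<noteq> {}"
    then obtain m where "m \<in> B" "\<And>y. (y, m) \<in> {(x, y). x \<in> A \<and> y \<in> A \<and> x < y} \<Longrightarrow> y \<notin> B"
      using wfE_min[OF w, of _ B] by blast
    then show "\<exists>m\<in>B. \<forall>x\<in>B. m \<le> x"
      using B by (intro bexI[of _ m]) (auto simp: not_le[symmetric])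
  qed
qed

lemma wos_no_descending:
  assumes "wos A" "\<And>n. s n \<in> A" "\<And>n. s (Suc n) < s n"
  shows False
proof -
  obtain m where "m \<in> range s" "\<forall>x\<in>range s. m \<le> x"
    using wos_min[of "range s"] wos_subset[OF assms(1), of "range s"] assms(2) by blast
  then show False
    using assms(3) by (metis (no_types) leD rangeE rangeI)
qed

lemma wosI_seq:
  assumes "\<And>s. (\<And>n. s n \<in> A) \<Longrightarrow> (\<And>n. s (Suc n) < s n) \<Longrightarrow> False"
  shows "wos A"
  unfolding wos_iff_wf wf_iff_no_infinite_down_chain
proof
  assume "\<exists>f. \<forall>i. (f (Suc i), f i) \<in> {(x, y). x \<in> A \<and> y \<in> A \<and> x < y}"
  then obtain s where "\<forall>i. (s (Suc i), s i) \<in> {(x, y). x \<in> A \<and> y \<in> A \<and> x < y}" ..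
  then show False using assms[of s] by simp
qed

text \<open>Any sequence in a linear order has a monotone subsequence; inside a well-ordered set a
  decreasing one is eventually constant, so dropping its start makes it increasing too.\<close>

lemma wos_increasing_subseq:
  fixes s :: "nat \<Rightarrow> 'a::linorder"
  assumes "wos A" "\<And>n. s n \<in> A"
  obtains r :: "nat \<Rightarrow> nat" where "strict_mono r" "\<And>i j. i \<le> j \<Longrightarrow> s (r i) \<le> s (r j)"
proof -
  obtain r :: "nat \<Rightarrow> nat" where r: "strict_mono r" "monoseq (\<lambda>n. s (r n))"
    using seq_monosub by blast
  show ?thesis
  proof (cases "\<forall>m. \<forall>n\<ge>m. s (r m) \<le> s (r n)")
    case True
    then show ?thesis using r that[of r] by simp
  next
    case False
    then have d: "\<And>m n. m \<le> n \<Longrightarrow> s (r n) \<le> s (r m)"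
      using r(2) unfolding monoseq_def by blast
    have "wos (range (\<lambda>n. s (r n)))" by (rule wos_subset[OF assms(1)]) (use assms(2) in auto)
    from wos_min[OF this] obtain m where "m \<in> range (\<lambda>n. s (r n))" and m: "\<forall>x\<in>range (\<lambda>n. s (r n)). m \<le> x"
      by auto
    then obtain N where N: "m = s (r N)" by blast
    have "s (r n) = m" if "N \<le> n" for n
      using d[OF that] m N by (simp add: antisym)
    moreover have "strict_mono (\<lambda>n. r (n + N))"
      using r(1) by (simp add: strict_mono_def)
    ultimately show ?thesis using that[of "\<lambda>n. r (n + N)"] by simp
  qed
qed

lemma wos_finite: "finite A \<Longrightarrow> wos A"
  unfolding wos_def by (meson Min_in Min_le finite_subset)

lemma wos_Un: "wos A \<Longrightarrow> wos B \<Longrightarrow> wos (A \<union> B)"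
proof (unfold wos_def, intro allI impI)
  fix C assume *: "\<forall>C. C \<subseteq> A \<longrightarrow> C \<noteq> {} \<longrightarrow> (\<exists>m\<in>C. \<forall>x\<in>C. m \<le> x)"
    "\<forall>C. C \<subseteq> B \<longrightarrow> C \<noteq> {} \<longrightarrow> (\<exists>m\<in>C. \<forall>x\<in>C. m \<le> x)" "C \<subseteq> A \<union> B" "C \<noteq> {}"
  show "\<exists>m\<in>C. \<forall>x\<in>C. m \<le> x"
  proof (cases "C \<inter> A = {} \<or> C \<inter> B = {}")
    case True
    then consider "C \<subseteq> A" | "C \<subseteq> B" using *(3) by blast
    then show ?thesis using *(1)[rule_format, of C] *(2)[rule_format, of C] *(4) by cases auto
  next
    case False
    then obtain a b where "a \<in> C \<inter> A" "\<forall>x\<in>C \<inter> A. a \<le> x" "b \<in> C \<inter> B" "\<forall>x\<in>C \<inter> B. b \<le> x"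
      using *(1)[rule_format, of "C \<inter> A"] *(2)[rule_format, of "C \<inter> B"] by blast
    moreover from this have "min a b \<le> x" if "x \<in> C" for x
      using that *(3) by (auto simp: min_le_iff_disj)
    ultimately show ?thesis by (intro bexI[of _ "min a b"]) (auto simp: min_def)
  qed
qed

lemma wos_UN_finite: "finite I \<Longrightarrow> (\<And>i. i \<in> I \<Longrightarrow> wos (A i)) \<Longrightarrow> wos (\<Union>i\<in>I. A i)"
  by (induction I rule: finite_induct) (auto intro: wos_Un wos_finite)

lemma wos_set_plus:
  fixes A B :: "'a::linordered_ab_group_add set"
  assumes "wos A" "wos B"
  shows "wos (A + B)"
proof (rule wosI_seq)
  fix s assume s: "\<And>n::nat. s n \<in> A + B" "\<And>n. s (Suc n) < s n"
  have "\<forall>n. \<exists>a b. a \<in> A \<and> b \<in> B \<and> s n = a + b"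
    using s(1) by (meson set_plus_elim)
  then obtain a b where ab: "\<And>n. a n \<in> A" "\<And>n. b n \<in> B" "\<And>n. s n = a n + b n"
    by metis
  obtain r :: "nat \<Rightarrow> nat" where r: "strict_mono r" "\<And>i j. i \<le> j \<Longrightarrow> a (r i) \<le> a (r j)"
    by (rule wos_increasing_subseq[where s = a, OF assms(1) ab(1)]) blast
  have "b (r (Suc n)) < b (r n)" for n
  proof -
    have "s (r (Suc n)) < s (r n)"
      using lift_Suc_mono_less[of "\<lambda>n. - s n" "r n" "r (Suc n)"] s(2) r(1)
      by (simp add: strict_mono_Suc_iff)
    then show ?thesis
      using add_mono[of "a (r n)" "a (r (Suc n))" "b (r n)" "b (r (Suc n))"] r(2)[of n "Suc n"] ab(3)
      by (auto simp: not_le[symmetric])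
  qed
  then show False
    using wos_no_descending[OF assms(2), of "\<lambda>n. b (r n)"] ab(2) by blast
qed

text \<open>Infinitely many first summands would contain a strictly increasing sequence, whose
  complements in \<open>y\<close> would strictly descend in \<open>B\<close>. This finiteness is
  what makes products of series well defined.\<close>

lemma finite_decompositions:
  fixes A B :: "'a::linordered_ab_group_add set"
  assumes "wos A" "wos B"
  shows "finite {a \<in> A. y - a \<in> B}"
proof (rule ccontr)
  assume "infinite {a \<in> A. y - a \<in> B}"
  then obtain s :: "nat \<Rightarrow> 'a" where s: "inj s" "range s \<subseteq> {a \<in> A. y - a \<in> B}"
    using infinite_countable_subset by blast
  then obtain r :: "nat \<Rightarrow> nat" where r: "strict_mono r" "\<And>i j. i \<le> j \<Longrightarrow> s (r i) \<le> s (r j)"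
    using wos_increasing_subseq[OF assms(1), of s] by (metis (no_types, lifting) mem_Collect_eq range_subsetD)
  have "y - s (r (Suc n)) < y - s (r n)" for n
    using r(2)[of n "Suc n"] s(1) r(1)
    by (simp add: order_less_le inj_eq strict_mono_eq)
  then show False
    using wos_no_descending[OF assms(2), of "\<lambda>n. y - s (r n)"] s(2) by blast
qed

section \<open>Sums of positive elements: Neumann's lemma\<close>

fun nfold :: "'a::comm_monoid_add set \<Rightarrow> nat \<Rightarrow> 'a set" where
  "nfold S 0 = {0}"
| "nfold S (Suc n) = S + nfold S n"

definition star :: "'a::comm_monoid_add set \<Rightarrow> 'a set" where
  "star S = (\<Union>n. nfold S n)"

lemma nfold_add: "x \<in> nfold S m \<Longrightarrow> y \<in> nfold S n \<Longrightarrow> x + y \<in> nfold S (m + n)"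
proof (induction m arbitrary: x)
  case (Suc m)
  then obtain a b where "a \<in> S" "b \<in> nfold S m" "x = a + b" by (auto elim: set_plus_elim)
  then show ?case using Suc.IH[of b] Suc.prems(2)
    by (simp add: set_plus_intro add.assoc)
qed simp

lemma star_0 [simp]: "0 \<in> star S"
  unfolding star_def by (rule UN_I[of 0]) auto

lemma star_add: "x \<in> star S \<Longrightarrow> y \<in> star S \<Longrightarrow> x + y \<in> star S"
  unfolding star_def using nfold_add by blast

lemma subset_star: "S \<subseteq> star S"
proof
  fix x assume "x \<in> S"
  then have "x + 0 \<in> nfold S 1" unfolding One_nat_def nfold.simps by (intro set_plus_intro) auto
  then show "x \<in> star S" unfolding star_def by (intro UN_I[of 1]) auto
qed

lemma nfold_subset:
  assumes "S \<subseteq> D" "0 \<in> D" "\<And>x y. x \<in> D \<Longrightarrow> y \<in> D \<Longrightarrow> x + y \<in> D"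
  shows "nfold S n \<subseteq> D"
  by (induction n) (use assms in \<open>auto elim!: set_plus_elim\<close>)

lemma star_least:
  assumes "S \<subseteq> D" "0 \<in> D" "\<And>x y. x \<in> D \<Longrightarrow> y \<in> D \<Longrightarrow> x + y \<in> D"
  shows "star S \<subseteq> D"
  unfolding star_def using nfold_subset[OF assms] by blast

lemma nfold_nonneg:
  fixes S :: "'a::linordered_ab_group_add set"
  assumes "\<forall>s\<in>S. 0 < s" "x \<in> nfold S n"
  shows "0 \<le> x \<and> (0 < n \<longrightarrow> 0 < x)"
  using assms(2)
proof (induction n arbitrary: x)
  case (Suc n)
  then obtain a b where "a \<in> S" "b \<in> nfold S n" "x = a + b" by (auto elim: set_plus_elim)
  then show ?case using Suc.IH[of b] assms(1)
    by (simp add: add_pos_nonneg less_imp_le)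
qed simp

lemma star_nonneg:
  fixes S :: "'a::linordered_ab_group_add set"
  assumes "\<forall>s\<in>S. 0 < s" "x \<in> star S"
  shows "0 \<le> x"
  using assms nfold_nonneg[of S x] unfolding star_def by blast

text \<open>Going down means a smaller sum, or the same sum written with more summands.
  Well-foundedness of this one relation yields both halves of Neumann's lemma,
  \<open>wos_star\<close> and \<open>finite_nfold_lengths\<close>.\<close>

definition sum_len_rel :: "'a::linordered_ab_group_add set \<Rightarrow> (('a \<times> nat) \<times> ('a \<times> nat)) set" where
  "sum_len_rel S = {((g, n), (g', n')). g \<in> nfold S n \<and> g' \<in> nfold S n' \<and> (g < g' \<or> g = g' \<and> n' < n)}"

text \<open>Nash-Williams' minimal bad sequence argument: in a descending chain whose lengths are chosen
  minimal one after the other, split off one summand from each member and thin out so that the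
  split-off summands increase; the remainders form a descending chain with a shorter start.\<close>

lemma wf_sum_len_rel:
  fixes S :: "'a::linordered_ab_group_add set"
  assumes S: "wos S" and pos: "\<forall>s\<in>S. 0 < s"
  shows "wf (sum_len_rel S)"
proof (rule ccontr)
  let ?R = "sum_len_rel S"
  have tr: "trans ?R" unfolding sum_len_rel_def trans_def by auto
  define bad where "bad x \<longleftrightarrow> (\<exists>s. s 0 = x \<and> (\<forall>i. (s (Suc i), s i) \<in> ?R))" for x
  have bad_step: "\<exists>y. bad y \<and> (y, x) \<in> ?R" if "bad x" for x
  proof -
    from that obtain s where s: "s 0 = x" "\<And>i. (s (Suc i), s i) \<in> ?R"
      unfolding bad_def by blast
    then have "bad (s 1)" unfolding bad_def by (intro exI[of _ "\<lambda>i. s (Suc i)"]) simp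
    then show ?thesis using s(2)[of 0] s(1) by (intro exI[of _ "s 1"]) simp
  qed
  assume "\<not> wf ?R"
  then obtain x where "bad x"
    unfolding wf_iff_no_infinite_down_chain bad_def by blast
  then obtain x0 where x0: "bad x0" "\<And>y. bad y \<Longrightarrow> snd x0 \<le> snd y"
    using ex_has_least_nat[of bad x snd] by blast
  have "\<exists>X. \<forall>n. (bad (X n) \<and> (n = 0 \<longrightarrow> X n = x0)) \<and>
      ((X (Suc n), X n) \<in> ?R \<and> (\<forall>y. bad y \<longrightarrow> (y, X n) \<in> ?R \<longrightarrow> snd (X (Suc n)) \<le> snd y))"
  proof (rule dependent_nat_choice)
    show "\<exists>x. bad x \<and> (0 = 0 \<longrightarrow> x = x0)" using x0 by blast
  next
    fix x and n :: nat assume "bad x \<and> (n = 0 \<longrightarrow> x = x0)"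
    then obtain y where "bad y \<and> (y, x) \<in> ?R" using bad_step by blast
    then obtain y where "bad y \<and> (y, x) \<in> ?R" "\<And>y'. bad y' \<and> (y', x) \<in> ?R \<Longrightarrow> snd y \<le> snd y'"
      using ex_has_least_nat[of "\<lambda>y. bad y \<and> (y, x) \<in> ?R" y snd] by blast
    then show "\<exists>y. (bad y \<and> (Suc n = 0 \<longrightarrow> y = x0)) \<and>
      ((y, x) \<in> ?R \<and> (\<forall>y'. bad y' \<longrightarrow> (y', x) \<in> ?R \<longrightarrow> snd y \<le> snd y'))" by blast
  qed
  then obtain X where X: "\<And>n. bad (X n)" "X 0 = x0" "\<And>n. (X (Suc n), X n) \<in> ?R"
      "\<And>n y. bad y \<Longrightarrow> (y, X n) \<in> ?R \<Longrightarrow> snd (X (Suc n)) \<le> snd y"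
    by blast
  have X_less: "(X j, X i) \<in> ?R" if "i < j" for i j
    using that
  proof (induction j)
    case (Suc j)
    then show ?case using X(3)[of j] tr by (metis less_Suc_eq transD)
  qed simp
  have "\<forall>i. \<exists>a v n. a \<in> S \<and> v \<in> nfold S n \<and> X i = (a + v, Suc n)"
  proof
    fix i
    obtain g n g' n' where e: "X i = (g, n)" "X (Suc i) = (g', n')" by (metis surj_pair)
    have m: "g \<in> nfold S n" "g' \<in> nfold S n'" "g' < g \<or> g' = g \<and> n < n'"
      using X(3)[of i] e unfolding sum_len_rel_def by auto
    \<comment> \<open>A sum of length 0 is 0, and nothing lies below it: a smaller sum would be
      negative, and 0 is not a sum of positive length.\<close>
    have "n \<noteq> 0"
    proof
      assume "n = 0"
      then show False using m nfold_nonneg[OF pos m(2)] by auto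
    qed
    then obtain k where "n = Suc k" by (cases n) auto
    then show "\<exists>a v n. a \<in> S \<and> v \<in> nfold S n \<and> X i = (a + v, Suc n)"
      using m(1) e by (auto elim!: set_plus_elim)
  qed
  then obtain a v l where avl: "\<And>i. a i \<in> S" "\<And>i. v i \<in> nfold S (l i)" "\<And>i. X i = (a i + v i, Suc (l i))"
    by metis
  obtain r :: "nat \<Rightarrow> nat" where r: "strict_mono r" "\<And>i j. i \<le> j \<Longrightarrow> a (r i) \<le> a (r j)"
    by (rule wos_increasing_subseq[where s = a, OF S avl(1)]) blast
  have "((v (r (Suc k)), l (r (Suc k))), (v (r k), l (r k))) \<in> ?R" for k
  proof -
    have "(X (r (Suc k)), X (r k)) \<in> ?R"
      using X_less r(1) by (simp add: strict_mono_Suc_iff)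
    then have "a (r (Suc k)) + v (r (Suc k)) < a (r k) + v (r k) \<or>
        a (r (Suc k)) + v (r (Suc k)) = a (r k) + v (r k) \<and> l (r k) < l (r (Suc k))"
      unfolding avl(3) sum_len_rel_def by auto
    moreover have "a (r k) \<le> a (r (Suc k))" using r(2) by simp
    ultimately have "v (r (Suc k)) < v (r k) \<or> v (r (Suc k)) = v (r k) \<and> l (r k) < l (r (Suc k))"
      using add_mono[of "a (r k)" "a (r (Suc k))" "v (r k)" "v (r (Suc k))"]
        add_le_less_mono[of "a (r k)" "a (r (Suc k))" "v (r k)" "v (r (Suc k))"]
      by (cases "v (r (Suc k))" "v (r k)" rule: linorder_cases) auto
    then show ?thesis using avl(2) unfolding sum_len_rel_def by auto
  qed
  then have b: "bad (v (r 0), l (r 0))"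
    unfolding bad_def by (intro exI[of _ "\<lambda>k. (v (r k), l (r k))"]) simp
  \<comment> \<open>The remainders start a bad chain that is shorter than \<open>X (r 0)\<close> and
    lies below it. For \<open>r 0 = 0\<close> this contradicts the choice of \<open>x0\<close>;
    otherwise it contradicts the choice of \<open>X (r 0)\<close> as a shortest bad element below
    \<open>X i\<close>.\<close>
  show False
  proof (cases "r 0")
    case 0
    then show False using x0(2)[OF b] X(2) avl(3)[of 0] by auto
  next
    case (Suc i)
    have "((v (r 0), l (r 0)), X (r 0)) \<in> ?R"
      unfolding avl(3) sum_len_rel_def
      using avl(1,2)[of "r 0"] pos by (auto simp: set_plus_intro)
    moreover have "(X (r 0), X i) \<in> ?R" using X_less Suc by simp
    ultimately have "((v (r 0), l (r 0)), X i) \<in> ?R" using tr by (meson transD)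
    from X(4)[OF b this] show False using avl(3)[of "Suc i"] Suc by simp
  qed
qed

lemma wos_star:
  fixes S :: "'a::linordered_ab_group_add set"
  assumes "wos S" "\<forall>s\<in>S. 0 < s"
  shows "wos (star S)"
proof (rule wosI_seq)
  fix s assume s: "\<And>n::nat. s n \<in> star S" "\<And>n. s (Suc n) < s n"
  have "\<forall>n. \<exists>l. s n \<in> nfold S l" using s(1) unfolding star_def by blast
  then obtain l where "\<And>n. s n \<in> nfold S (l n)" by metis
  then have "\<forall>i. ((s (Suc i), l (Suc i)), (s i, l i)) \<in> sum_len_rel S"
    using s(2) unfolding sum_len_rel_def by auto
  then show False
    using wf_no_infinite_down_chainE[OF wf_sum_len_rel[OF assms], of "\<lambda>i. (s i, l i)"] by blast
qed

text \<open>Ever longer representations of the same \<open>y\<close> would form a descending chain.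
  Hence only finitely many powers of an infinitesimal contribute to a given coefficient of a power
  series in it.\<close>

lemma finite_nfold_lengths:
  fixes S :: "'a::linordered_ab_group_add set"
  assumes "wos S" "\<forall>s\<in>S. 0 < s"
  shows "finite {n. y \<in> nfold S n}"
proof (rule ccontr)
  assume "infinite {n. y \<in> nfold S n}"
  then obtain l :: "nat \<Rightarrow> nat" where "strict_mono l" "\<And>n. l n \<in> {n. y \<in> nfold S n}"
    using infinite_enumerate by blast
  then have "\<forall>i. ((y, l (Suc i)), (y, l i)) \<in> sum_len_rel S"
    unfolding sum_len_rel_def by (auto simp: strict_mono_Suc_iff)
  then show False
    using wf_no_infinite_down_chainE[OF wf_sum_len_rel[OF assms], of "\<lambda>i. (y, l i)"] by blast
qed

section \<open>Hahn series\<close>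

typedef (overloaded) 'g hahn = "{f :: 'g::linordered_ab_group_add \<Rightarrow> real. wos {x. f x \<noteq> 0}}"
  morphisms hcoeff Abs_hahn
  by (rule exI[of _ "\<lambda>_. 0"]) (simp add: wos_finite)

setup_lifting type_definition_hahn

definition hsupp :: "'g::linordered_ab_group_add hahn \<Rightarrow> 'g set" where
  "hsupp F = {x. hcoeff F x \<noteq> 0}"

lemma wos_hsupp [simp]: "wos (hsupp F)"
  unfolding hsupp_def using hcoeff[of F] by simp

lemma hahn_eqI: "(\<And>x. hcoeff F x = hcoeff G x) \<Longrightarrow> F = G"
  using hcoeff_inject by blast

lemma hcoeff_Abs:
  assumes "wos W" "\<And>x. f x \<noteq> 0 \<Longrightarrow> x \<in> W"
  shows "hcoeff (Abs_hahn f) = f"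
  by (rule Abs_hahn_inverse) (use wos_subset[OF assms(1), of "{x. f x \<noteq> 0}"] assms(2) in auto)

instantiation hahn :: (linordered_ab_group_add) "{zero, one, plus, minus, uminus, times, scaleR}"
begin

lift_definition zero_hahn :: "'a hahn" is "\<lambda>_. 0" by (simp add: wos_finite)
lift_definition one_hahn :: "'a hahn" is "\<lambda>x. if x = 0 then 1 else 0"
  by (rule wos_subset[of "{0}"]) (auto simp: wos_finite)
lift_definition plus_hahn :: "'a hahn \<Rightarrow> 'a hahn \<Rightarrow> 'a hahn" is "\<lambda>f g x. f x + g x"
  by (drule (1) wos_Un, erule wos_subset) auto
lift_definition minus_hahn :: "'a hahn \<Rightarrow> 'a hahn \<Rightarrow> 'a hahn" is "\<lambda>f g x. f x - g x"
  by (drule (1) wos_Un, erule wos_subset) auto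
lift_definition uminus_hahn :: "'a hahn \<Rightarrow> 'a hahn" is "\<lambda>f x. - f x" by simp
lift_definition scaleR_hahn :: "real \<Rightarrow> 'a hahn \<Rightarrow> 'a hahn" is "\<lambda>c f x. c * f x"
  by (erule wos_subset) auto
definition times_hahn :: "'a hahn \<Rightarrow> 'a hahn \<Rightarrow> 'a hahn" where
  "F * G = Abs_hahn (\<lambda>y. \<Sum>a\<in>{a \<in> hsupp F. y - a \<in> hsupp G}. hcoeff F a * hcoeff G (y - a))"
instance ..
end

lemmas hcoeff_simps [simp] = zero_hahn.rep_eq one_hahn.rep_eq plus_hahn.rep_eq minus_hahn.rep_eq
  uminus_hahn.rep_eq scaleR_hahn.rep_eq

lemma hcoeff_mult_hsupp:
  "hcoeff (F * G) y = (\<Sum>a\<in>{a \<in> hsupp F. y - a \<in> hsupp G}. hcoeff F a * hcoeff G (y - a))"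
proof -
  have "y \<in> hsupp F + hsupp G"
    if "(\<Sum>a\<in>{a \<in> hsupp F. y - a \<in> hsupp G}. hcoeff F a * hcoeff G (y - a)) \<noteq> 0" for y
  proof -
    from that obtain a where "a \<in> hsupp F" "y - a \<in> hsupp G"
      by (metis (no_types, lifting) mem_Collect_eq sum.not_neutral_contains_not_neutral)
    then show ?thesis using set_plus_intro[of a "hsupp F" "y - a" "hsupp G"] by simp
  qed
  from hcoeff_Abs[OF wos_set_plus[OF wos_hsupp wos_hsupp] this] show ?thesis
    unfolding times_hahn_def by simp
qed

text \<open>Replacing the supports by larger well-ordered sets lets the coefficients of several
  products be written over one common index set and compared term by term.\<close>

lemma hcoeff_mult:
  assumes "hsupp F \<subseteq> A" "hsupp G \<subseteq> B" "wos A" "wos B"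
  shows "hcoeff (F * G) y = (\<Sum>a\<in>{a \<in> A. y - a \<in> B}. hcoeff F a * hcoeff G (y - a))"
  unfolding hcoeff_mult_hsupp
  by (rule sum.mono_neutral_left)
     (use assms in \<open>auto simp: finite_decompositions hsupp_def\<close>)

lemma hsupp_mult: "hsupp (F * G) \<subseteq> hsupp F + hsupp G"
proof
  fix y assume "y \<in> hsupp (F * G)"
  then have "(\<Sum>a\<in>{a \<in> hsupp F. y - a \<in> hsupp G}. hcoeff F a * hcoeff G (y - a)) \<noteq> 0"
    unfolding hcoeff_mult_hsupp[symmetric] by (simp add: hsupp_def)
  then obtain a where "a \<in> hsupp F" "y - a \<in> hsupp G"
    by (metis (no_types, lifting) mem_Collect_eq sum.not_neutral_contains_not_neutral)
  then show "y \<in> hsupp F + hsupp G" using set_plus_intro[of a "hsupp F" "y - a" "hsupp G"] by simp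
qed

lemma hsupp_0 [simp]: "hsupp 0 = {}" and hsupp_1 [simp]: "hsupp 1 = {0}"
  and hsupp_uminus [simp]: "hsupp (- F) = hsupp F"
  by (auto simp: hsupp_def)

lemma hsupp_add: "hsupp (F + G) \<subseteq> hsupp F \<union> hsupp G"
  and hsupp_diff: "hsupp (F - G) \<subseteq> hsupp F \<union> hsupp G"
  and hsupp_scaleR: "hsupp (c *\<^sub>R F) \<subseteq> hsupp F"
  by (auto simp: hsupp_def)

instance hahn :: (linordered_ab_group_add) comm_ring_1
proof
  fix F G H :: "'a hahn"
  show "F + G + H = F + (G + H)" "F + G = G + F" "0 + F = F" "- F + F = 0" "F - G = F + - G"
    by (auto intro!: hahn_eqI)
  show "(0::'a hahn) \<noteq> 1"
    by (metis hcoeff_simps(1,2) zero_neq_one)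
  show "1 * F = F"
  proof (rule hahn_eqI)
    fix y
    have "hcoeff (1 * F) y = (\<Sum>a\<in>{a \<in> {0}. y - a \<in> hsupp F}. hcoeff 1 a * hcoeff F (y - a))"
      by (rule hcoeff_mult) (auto simp: wos_finite)
    also have "\<dots> = (\<Sum>a\<in>{0}. hcoeff 1 a * hcoeff F (y - a))"
      by (rule sum.mono_neutral_left) (auto simp: hsupp_def)
    finally show "hcoeff (1 * F) y = hcoeff F y" by simp
  qed
  show "F * G = G * F"
  proof (rule hahn_eqI)
    fix y
    show "hcoeff (F * G) y = hcoeff (G * F) y"
      unfolding hcoeff_mult_hsupp
      by (rule sum.reindex_bij_witness[of _ "\<lambda>a. y - a" "\<lambda>a. y - a"]) auto
  qed
  show "(F + G) * H = F * H + G * H"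
  proof (rule hahn_eqI)
    fix y
    let ?A = "hsupp F \<union> hsupp G"
    have "hcoeff (X * H) y = (\<Sum>a\<in>{a \<in> ?A. y - a \<in> hsupp H}. hcoeff X a * hcoeff H (y - a))"
      if "hsupp X \<subseteq> ?A" for X
      by (rule hcoeff_mult) (use that in \<open>auto simp: wos_Un\<close>)
    then show "hcoeff ((F + G) * H) y = hcoeff (F * H + G * H) y"
      using hsupp_add[of F G] by (simp add: sum.distrib distrib_right)
  qed
  show "F * G * H = F * (G * H)"
  proof (rule hahn_eqI)
    fix y
    let ?A = "hsupp F" and ?B = "hsupp G" and ?C = "hsupp H"
    have "hcoeff (F * G * H) y
        = (\<Sum>d\<in>{d \<in> ?A + ?B. y - d \<in> ?C}. hcoeff (F * G) d * hcoeff H (y - d))"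
      by (rule hcoeff_mult) (auto simp: wos_set_plus hsupp_mult)
    also have "\<dots> = (\<Sum>d\<in>{d \<in> ?A + ?B. y - d \<in> ?C}. \<Sum>a\<in>{a \<in> ?A. d - a \<in> ?B}.
        hcoeff F a * hcoeff G (d - a) * hcoeff H (y - d))"
      by (simp add: hcoeff_mult_hsupp sum_distrib_right)
    also have "\<dots> = (\<Sum>(d, a)\<in>Sigma {d \<in> ?A + ?B. y - d \<in> ?C} (\<lambda>d. {a \<in> ?A. d - a \<in> ?B}).
        hcoeff F a * hcoeff G (d - a) * hcoeff H (y - d))"
      by (rule sum.Sigma) (auto simp: finite_decompositions wos_set_plus)
    also have "\<dots> = (\<Sum>(a, b)\<in>Sigma {a \<in> ?A. y - a \<in> ?B + ?C} (\<lambda>a. {b \<in> ?B. y - a - b \<in> ?C}).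
        hcoeff F a * (hcoeff G b * hcoeff H (y - a - b)))"
      by (rule sum.reindex_bij_witness[of _ "\<lambda>(a, b). (a + b, a)" "\<lambda>(d, a). (a, d - a)"])
        (auto simp: algebra_simps set_plus_intro intro: set_plus_intro[of _ ?B _ ?C, where b="_ - _", THEN back_subst[of "\<lambda>x. x \<in> _"]])
    also have "\<dots> = (\<Sum>a\<in>{a \<in> ?A. y - a \<in> ?B + ?C}. \<Sum>b\<in>{b \<in> ?B. y - a - b \<in> ?C}.
        hcoeff F a * (hcoeff G b * hcoeff H (y - a - b)))"
      by (rule sum.Sigma[symmetric]) (auto simp: finite_decompositions wos_set_plus)
    also have "\<dots> = (\<Sum>a\<in>{a \<in> ?A. y - a \<in> ?B + ?C}. hcoeff F a * hcoeff (G * H) (y - a))"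
      by (simp add: hcoeff_mult_hsupp sum_distrib_left)
    also have "\<dots> = hcoeff (F * (G * H)) y"
      by (rule hcoeff_mult[symmetric]) (auto simp: wos_set_plus hsupp_mult)
    finally show "hcoeff (F * G * H) y = hcoeff (F * (G * H)) y" .
  qed
qed

lemma scaleR_mult_hahn:
  "c *\<^sub>R F * G = c *\<^sub>R (F * (G :: 'a::linordered_ab_group_add hahn))"
proof (rule hahn_eqI)
  fix y
  have "hcoeff (X * G) y = (\<Sum>a\<in>{a \<in> hsupp F. y - a \<in> hsupp G}. hcoeff X a * hcoeff G (y - a))"
    if "hsupp X \<subseteq> hsupp F" for X
    by (rule hcoeff_mult) (use that in auto)
  from this[OF hsupp_scaleR[of c]] show "hcoeff (c *\<^sub>R F * G) y = hcoeff (c *\<^sub>R (F * G)) y"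
    by (simp add: hcoeff_mult_hsupp sum_distrib_left mult.assoc)
qed

instance hahn :: (linordered_ab_group_add) real_algebra_1
proof
  fix F G :: "'a hahn" and a b :: real
  show "a *\<^sub>R F * G = a *\<^sub>R (F * G)" by (rule scaleR_mult_hahn)
  show "F * a *\<^sub>R G = a *\<^sub>R (F * G)" by (metis scaleR_mult_hahn mult.commute)
qed (auto intro!: hahn_eqI simp: algebra_simps)

lemma hcoeff_sum: "hcoeff (sum F I) x = (\<Sum>i\<in>I. hcoeff (F i) x)"
  by (induction I rule: infinite_finite_induct) auto

definition hmon :: "'g::linordered_ab_group_add \<Rightarrow> 'g hahn" where
  "hmon x = Abs_hahn (\<lambda>y. if y = x then 1 else 0)"

lemma hcoeff_hmon [simp]: "hcoeff (hmon x) y = (if y = x then 1 else 0)"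
  unfolding hmon_def by (subst hcoeff_Abs[of "{x}"]) (auto simp: wos_finite split: if_splits)

lemma hsupp_hmon [simp]: "hsupp (hmon x) = {x}"
  by (auto simp: hsupp_def)

lemma hmon_0: "hmon 0 = 1" by (rule hahn_eqI) simp

lemma hcoeff_hmon_mult: "hcoeff (hmon x * F) y = hcoeff F (y - x)"
proof -
  have "hcoeff (hmon x * F) y = (\<Sum>a\<in>{a \<in> {x}. y - a \<in> hsupp F}. hcoeff (hmon x) a * hcoeff F (y - a))"
    by (rule hcoeff_mult) (auto simp: wos_finite)
  also have "\<dots> = (\<Sum>a\<in>{x}. hcoeff (hmon x) a * hcoeff F (y - a))"
    by (rule sum.mono_neutral_left) (auto simp: hsupp_def)
  finally show ?thesis by simp
qed

lemma hmon_add: "hmon (x + y) = hmon x * hmon y"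
  by (rule hahn_eqI) (auto simp: hcoeff_hmon_mult algebra_simps)

section \<open>Strong sums of summable families\<close>

definition summable_fam :: "'i set \<Rightarrow> ('i \<Rightarrow> 'g::linordered_ab_group_add hahn) \<Rightarrow> bool" where
  "summable_fam I F \<longleftrightarrow> wos (\<Union>i\<in>I. hsupp (F i)) \<and> (\<forall>x. finite {i \<in> I. hcoeff (F i) x \<noteq> 0})"

definition hsum :: "'i set \<Rightarrow> ('i \<Rightarrow> 'g::linordered_ab_group_add hahn) \<Rightarrow> 'g hahn" where
  "hsum I F = Abs_hahn (\<lambda>x. \<Sum>i\<in>{i \<in> I. hcoeff (F i) x \<noteq> 0}. hcoeff (F i) x)"

lemma summable_famI:
  assumes "wos W" "\<And>i. i \<in> I \<Longrightarrow> hsupp (F i) \<subseteq> W"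
    "\<And>x. finite (J x)" "\<And>x i. i \<in> I \<Longrightarrow> hcoeff (F i) x \<noteq> 0 \<Longrightarrow> i \<in> J x"
  shows "summable_fam I F"
  unfolding summable_fam_def
proof (intro conjI allI)
  show "wos (\<Union>i\<in>I. hsupp (F i))"
    by (rule wos_subset[OF assms(1)]) (use assms(2) in auto)
  show "finite {i \<in> I. hcoeff (F i) x \<noteq> 0}" for x
    by (rule finite_subset[OF _ assms(3)[of x]]) (use assms(4) in auto)
qed

lemma hcoeff_hsum_nonzero:
  assumes "summable_fam I F"
  shows "hcoeff (hsum I F) x = (\<Sum>i\<in>{i \<in> I. hcoeff (F i) x \<noteq> 0}. hcoeff (F i) x)"
proof -
  have "x \<in> (\<Union>i\<in>I. hsupp (F i))"
    if nz: "(\<Sum>i\<in>{i \<in> I. hcoeff (F i) x \<noteq> 0}. hcoeff (F i) x) \<noteq> 0" for x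
  proof -
    have "{i \<in> I. hcoeff (F i) x \<noteq> 0} \<noteq> {}"
      using nz by (metis (no_types) sum.empty)
    then show ?thesis by (auto simp: hsupp_def)
  qed
  then show ?thesis
    unfolding hsum_def using hcoeff_Abs assms unfolding summable_fam_def by (metis (no_types, lifting))
qed

lemma hcoeff_hsum:
  assumes "summable_fam I F" "finite J" "J \<subseteq> I" "\<And>i. i \<in> I \<Longrightarrow> hcoeff (F i) x \<noteq> 0 \<Longrightarrow> i \<in> J"
  shows "hcoeff (hsum I F) x = (\<Sum>i\<in>J. hcoeff (F i) x)"
  unfolding hcoeff_hsum_nonzero[OF assms(1)]
  by (rule sum.mono_neutral_left) (use assms in auto)

lemma hsupp_hsum:
  assumes "summable_fam I F"
  shows "hsupp (hsum I F) \<subseteq> (\<Union>i\<in>I. hsupp (F i))"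
proof
  fix x assume "x \<in> hsupp (hsum I F)"
  then have "(\<Sum>i\<in>{i \<in> I. hcoeff (F i) x \<noteq> 0}. hcoeff (F i) x) \<noteq> 0"
    unfolding hcoeff_hsum_nonzero[OF assms, symmetric] by (simp add: hsupp_def)
  then have "{i \<in> I. hcoeff (F i) x \<noteq> 0} \<noteq> {}" by (metis (no_types) sum.empty)
  then show "x \<in> (\<Union>i\<in>I. hsupp (F i))" by (auto simp: hsupp_def)
qed

lemma summable_fam_hmon_expansion: "summable_fam (hsupp F) (\<lambda>x. hcoeff F x *\<^sub>R hmon x)"
  by (rule summable_famI[OF wos_hsupp[of F], of _ _ "\<lambda>x. {x}"]) (auto simp: hsupp_def split: if_splits)

text \<open>This reduces statements about strongly linear maps to single monomials.\<close>

lemma hmon_expansion: "hsum (hsupp F) (\<lambda>x. hcoeff F x *\<^sub>R hmon x) = F"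
proof (rule hahn_eqI)
  fix y
  have "hcoeff (hsum (hsupp F) (\<lambda>x. hcoeff F x *\<^sub>R hmon x)) y
      = (\<Sum>x\<in>{y} \<inter> hsupp F. hcoeff (hcoeff F x *\<^sub>R hmon x) y)"
    by (rule hcoeff_hsum[OF summable_fam_hmon_expansion]) (auto split: if_splits)
  also have "\<dots> = hcoeff F y" by (cases "y \<in> hsupp F") (auto simp: hsupp_def)
  finally show "hcoeff (hsum (hsupp F) (\<lambda>x. hcoeff F x *\<^sub>R hmon x)) y = hcoeff F y" .
qed

lemma hsum_cong: "(\<And>i. i \<in> I \<Longrightarrow> F i = G i) \<Longrightarrow> hsum I F = hsum I G"
  unfolding hsum_def by (intro arg_cong[of _ _ Abs_hahn] ext sum.cong) auto

lemma
  assumes "summable_fam I F"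
  shows summable_fam_mult: "summable_fam I (\<lambda>i. C * F i)"
    and hsum_mult: "hsum I (\<lambda>i. C * F i) = C * hsum I F"
proof -
  let ?W = "\<Union>i\<in>I. hsupp (F i)"
  have W: "wos ?W" using assms unfolding summable_fam_def by blast
  let ?A = "\<lambda>y. {a \<in> hsupp C. y - a \<in> ?W}"
  \<comment> \<open>Indices that can contribute to the coefficient at \<open>y\<close>: finitely
    many splittings of \<open>y\<close>, and for each of them finitely many members of the family.
    One such set serves all the finite sums that are interchanged below.\<close>
  let ?J = "\<lambda>y. (\<Union>a\<in>?A y. {i \<in> I. hcoeff (F i) (y - a) \<noteq> 0})"
  have finA: "finite (?A y)" for y by (rule finite_decompositions[OF wos_hsupp W])
  have fin: "finite (?J y)" for y
    using finA assms unfolding summable_fam_def by blast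
  have c: "hcoeff (C * F i) y = (\<Sum>a\<in>?A y. hcoeff C a * hcoeff (F i) (y - a))" if "i \<in> I" for i y
    by (rule hcoeff_mult) (use that W in auto)
  have J: "i \<in> ?J y" if i: "i \<in> I" and nz: "hcoeff (C * F i) y \<noteq> 0" for i y
  proof -
    obtain a where "a \<in> ?A y" "hcoeff C a * hcoeff (F i) (y - a) \<noteq> 0"
      using nz unfolding c[OF i] by (metis (no_types, lifting) sum.not_neutral_contains_not_neutral)
    then show ?thesis using i by auto
  qed
  show s: "summable_fam I (\<lambda>i. C * F i)"
  proof (rule summable_famI[OF wos_set_plus[OF wos_hsupp W] _ fin J])
    show "hsupp (C * F i) \<subseteq> hsupp C + ?W" if "i \<in> I" for i
      using hsupp_mult[of C "F i"] set_plus_mono2[of "hsupp C" "hsupp C" "hsupp (F i)" ?W] that by blast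
  qed
  show "hsum I (\<lambda>i. C * F i) = C * hsum I F"
  proof (rule hahn_eqI)
    fix y
    have "hcoeff (hsum I (\<lambda>i. C * F i)) y = (\<Sum>i\<in>?J y. hcoeff (C * F i) y)"
      by (rule hcoeff_hsum[OF s fin]) (use J in auto)
    also have "\<dots> = (\<Sum>i\<in>?J y. \<Sum>a\<in>?A y. hcoeff C a * hcoeff (F i) (y - a))"
      by (rule sum.cong) (auto simp: c)
    also have "\<dots> = (\<Sum>a\<in>?A y. hcoeff C a * (\<Sum>i\<in>?J y. hcoeff (F i) (y - a)))"
      unfolding sum_distrib_left by (rule sum.swap)
    also have "\<dots> = (\<Sum>a\<in>?A y. hcoeff C a * hcoeff (hsum I F) (y - a))"
      by (intro sum.cong refl arg_cong2[of _ _ _ _ "(*)"] hcoeff_hsum[OF assms fin, symmetric]) auto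
    also have "\<dots> = hcoeff (C * hsum I F) y"
      by (rule hcoeff_mult[symmetric]) (use W hsupp_hsum[OF assms] in auto)
    finally show "hcoeff (hsum I (\<lambda>i. C * F i)) y = hcoeff (C * hsum I F) y" .
  qed
qed

section \<open>Binomial and logarithm series of infinitesimals\<close>

definition infinitesimal :: "'g::linordered_ab_group_add hahn \<Rightarrow> bool" where
  "infinitesimal e \<longleftrightarrow> (\<forall>x\<in>hsupp e. 0 < x)"

definition pser :: "(nat \<Rightarrow> real) \<Rightarrow> 'g::linordered_ab_group_add hahn \<Rightarrow> 'g hahn" where
  "pser c e = hsum UNIV (\<lambda>i. c i *\<^sub>R e ^ i)"

lemma hsupp_power: "hsupp (e ^ i) \<subseteq> nfold (hsupp e) i"
proof (induction i)
  case (Suc i)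
  show ?case
    unfolding power_Suc nfold.simps
    by (rule subset_trans[OF hsupp_mult set_plus_mono2]) (simp_all add: Suc)
qed simp

lemma wos_star_hsupp: "infinitesimal e \<Longrightarrow> wos (star (hsupp e))"
  unfolding infinitesimal_def by (rule wos_star) auto

lemma summable_fam_pser:
  assumes "infinitesimal e"
  shows "summable_fam UNIV (\<lambda>i. c i *\<^sub>R e ^ i)"
proof (rule summable_famI)
  show "wos (star (hsupp e))" using assms by (rule wos_star_hsupp)
  show "hsupp (c i *\<^sub>R e ^ i) \<subseteq> star (hsupp e)" for i
    using hsupp_power[of e i] hsupp_scaleR[of "c i" "e ^ i"] unfolding star_def by blast
  show "finite {i. x \<in> nfold (hsupp e) i}" for x
    using assms unfolding infinitesimal_def by (intro finite_nfold_lengths) auto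
  show "i \<in> {i. x \<in> nfold (hsupp e) i}" if "hcoeff (c i *\<^sub>R e ^ i) x \<noteq> 0" for i x
    using that hsupp_power[of e i] by (auto simp: hsupp_def)
qed

text \<open>The index set depends on \<open>e\<close> and \<open>y\<close> but not on
  \<open>c\<close>. When \<open>c\<close> varies with a parameter, the coefficient is therefore a
  fixed finite sum, which can be treated as a polynomial in the parameter or differentiated.\<close>

lemma hcoeff_pser:
  assumes "infinitesimal e"
  shows "hcoeff (pser c e) y = (\<Sum>i\<in>{i. y \<in> nfold (hsupp e) i}. c i * hcoeff (e ^ i) y)"
proof -
  have "hcoeff (pser c e) y = (\<Sum>i\<in>{i. y \<in> nfold (hsupp e) i}. hcoeff (c i *\<^sub>R e ^ i) y)"
    unfolding pser_def
  proof (rule hcoeff_hsum[OF summable_fam_pser[OF assms]])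
    show "finite {i. y \<in> nfold (hsupp e) i}"
      using assms unfolding infinitesimal_def by (intro finite_nfold_lengths) auto
    show "i \<in> {i. y \<in> nfold (hsupp e) i}" if "hcoeff (c i *\<^sub>R e ^ i) y \<noteq> 0" for i
      using that hsupp_power[of e i] by (auto simp: hsupp_def)
  qed auto
  then show ?thesis by simp
qed

lemma hsupp_pser:
  assumes "infinitesimal e"
  shows "hsupp (pser c e) \<subseteq> star (hsupp e)"
proof
  fix x assume "x \<in> hsupp (pser c e)"
  then obtain i where "x \<in> hsupp (c i *\<^sub>R e ^ i)"
    using hsupp_hsum[OF summable_fam_pser[OF assms, of c]] unfolding pser_def by blast
  then show "x \<in> star (hsupp e)"
    using hsupp_power[of e i] hsupp_scaleR[of "c i" "e ^ i"] unfolding star_def by blast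
qed

lemma hsupp_pser_nonneg: "infinitesimal e \<Longrightarrow> \<forall>x\<in>hsupp (pser c e). 0 \<le> x"
proof
  fix x assume e: "infinitesimal e" and "x \<in> hsupp (pser c e)"
  then have "x \<in> star (hsupp e)" using hsupp_pser[OF e] by blast
  then show "0 \<le> x" by (rule star_nonneg[rotated]) (use e in \<open>simp add: infinitesimal_def\<close>)
qed

lemma hcoeff_pser_0:
  assumes "infinitesimal e"
  shows "hcoeff (pser c e) 0 = c 0"
proof -
  have pos: "\<forall>s\<in>hsupp e. 0 < s" using assms unfolding infinitesimal_def by blast
  have "0 \<notin> nfold (hsupp e) i" if "0 < i" for i
    using nfold_nonneg[OF pos, of 0 i] that by auto
  then have "{i. 0 \<in> nfold (hsupp e) i} = {0}"
    by (auto intro: ccontr)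
  then show ?thesis using hcoeff_pser[OF assms, of c 0] by simp
qed

lemma pser_finite:
  assumes "infinitesimal e" "\<And>i. n < i \<Longrightarrow> c i = 0"
  shows "pser c e = (\<Sum>i\<le>n. c i *\<^sub>R e ^ i)"
proof (rule hahn_eqI)
  fix y
  show "hcoeff (pser c e) y = hcoeff (\<Sum>i\<le>n. c i *\<^sub>R e ^ i) y"
    unfolding pser_def hcoeff_sum
    by (rule hcoeff_hsum[OF summable_fam_pser[OF assms(1)]]) (use assms(2) in \<open>auto simp: not_le[symmetric]\<close>)
qed

definition binH :: "real \<Rightarrow> 'g::linordered_ab_group_add hahn \<Rightarrow> 'g hahn" where
  "binH b = pser (\<lambda>i. b gchoose i)"

definition logH :: "'g::linordered_ab_group_add hahn \<Rightarrow> 'g hahn" where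
  "logH = pser (\<lambda>i. if i = 0 then 0 else (-1) ^ (i + 1) / real i)"

definition geomH :: "'g::linordered_ab_group_add hahn \<Rightarrow> 'g hahn" where
  "geomH = pser (\<lambda>_. 1)"

lemma binH_of_nat:
  assumes "infinitesimal e"
  shows "binH (real n) e = (1 + e) ^ n"
proof -
  have "binH (real n) e = (\<Sum>i\<le>n. (real n gchoose i) *\<^sub>R e ^ i)"
    unfolding binH_def
    by (rule pser_finite[OF assms]) (simp add: binomial_gbinomial[symmetric])
  also have "\<dots> = (e + 1) ^ n"
    by (simp add: binomial_ring binomial_gbinomial[symmetric] scaleR_conv_of_real)
  finally show ?thesis by (simp add: add.commute)
qed

lemma binH_0 [simp]: "infinitesimal e \<Longrightarrow> binH 0 e = 1"
  using binH_of_nat[of e 0] by simp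

lemma binH_1: "infinitesimal e \<Longrightarrow> binH 1 e = 1 + e"
  using binH_of_nat[of e 1] by simp

section \<open>Laws of binomial and logarithm series by polynomial identity\<close>

definition polyfun :: "(real \<Rightarrow> real) \<Rightarrow> bool" where
  "polyfun f \<longleftrightarrow> (\<exists>p. \<forall>b. f b = poly p b)"

lemma polyfun_const: "polyfun (\<lambda>_. c)"
  unfolding polyfun_def by (rule exI[of _ "[:c:]"]) simp

lemma polyfun_mult: "polyfun f \<Longrightarrow> polyfun g \<Longrightarrow> polyfun (\<lambda>b. f b * g b)"
  unfolding polyfun_def by (metis poly_mult)

lemma polyfun_add: "polyfun f \<Longrightarrow> polyfun g \<Longrightarrow> polyfun (\<lambda>b. f b + g b)"
  unfolding polyfun_def by (metis poly_add)

lemma polyfun_sum: "(\<And>i. i \<in> I \<Longrightarrow> polyfun (f i)) \<Longrightarrow> polyfun (\<lambda>b. \<Sum>i\<in>I. f i b)"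
  by (induction I rule: infinite_finite_induct) (auto intro: polyfun_const polyfun_add)

lemma polyfun_gbinomial: "polyfun (\<lambda>b. (b + a) gchoose i)"
  unfolding polyfun_def
  by (rule exI[of _ "smult (1 / fact i) (\<Prod>j = 0..<i. [:a - real j, 1:])"])
     (auto simp: gbinomial_prod_rev poly_prod algebra_simps)

lemma polyfun_eqI:
  assumes "polyfun f" "polyfun g" "\<And>n::nat. f (real n) = g (real n)"
  shows "f b = g b"
proof -
  obtain p q where pq: "\<And>b. f b = poly p b" "\<And>b. g b = poly q b"
    using assms(1,2) unfolding polyfun_def by blast
  have "p - q = 0"
  proof (rule ccontr)
    assume "p - q \<noteq> 0"
    then have "finite {x. poly (p - q) x = 0}" by (rule poly_roots_finite)
    moreover have "range real \<subseteq> {x. poly (p - q) x = 0}"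
      using pq assms(3) by auto
    ultimately have "finite (range real)" by (rule finite_subset[rotated])
    then show False by (simp add: finite_image_iff inj_on_def)
  qed
  then show ?thesis using pq by simp
qed

lemma polyfun_hcoeff_binH:
  assumes "infinitesimal e"
  shows "polyfun (\<lambda>b. hcoeff (binH (b + a) e) y)"
  unfolding binH_def hcoeff_pser[OF assms]
  by (intro polyfun_sum polyfun_mult polyfun_gbinomial polyfun_const)

lemma polyfun_hcoeff_mult:
  assumes "\<And>y. polyfun (\<lambda>b. hcoeff (F b) y)" "\<And>y. polyfun (\<lambda>b. hcoeff (G b) y)"
    "wos A" "wos B" "\<And>b. hsupp (F b) \<subseteq> A" "\<And>b. hsupp (G b) \<subseteq> B"
  shows "polyfun (\<lambda>b. hcoeff (F b * G b) y)"
  unfolding hcoeff_mult[OF assms(5,6,3,4)]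
  by (intro polyfun_sum polyfun_mult assms(1,2))

lemma hsupp_binH: "infinitesimal e \<Longrightarrow> hsupp (binH b e) \<subseteq> star (hsupp e)"
  unfolding binH_def by (rule hsupp_pser)

text \<open>Identities between binomial series in the exponent need only be checked for natural
  exponents, since every coefficient is a polynomial in the exponent.\<close>

lemma binH_add:
  assumes e: "infinitesimal e"
  shows "binH (a + b) e = binH a e * binH b e"
proof -
  \<comment> \<open>First the second exponent is natural and the first one is varied over the reals;
    the second pass varies the other exponent and uses this one at its natural values.\<close>
  have *: "binH (b + real n) e = binH b e * (1 + e) ^ n" for b n
  proof (rule hahn_eqI, rule polyfun_eqI[of "\<lambda>b. hcoeff (binH (b + real n) e) y"
        "\<lambda>b. hcoeff (binH b e * (1 + e) ^ n) y" for y])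
    fix y
    show "polyfun (\<lambda>b. hcoeff (binH (b + real n) e) y)" by (rule polyfun_hcoeff_binH[OF e])
    show "polyfun (\<lambda>b. hcoeff (binH b e * (1 + e) ^ n) y)"
      by (rule polyfun_hcoeff_mult[OF _ _ wos_star_hsupp[OF e] wos_hsupp[of "(1 + e) ^ n"]])
         (use polyfun_hcoeff_binH[OF e, of 0] hsupp_binH[OF e] in \<open>auto intro: polyfun_const\<close>)
    fix m
    show "hcoeff (binH (real m + real n) e) y = hcoeff (binH (real m) e * (1 + e) ^ n) y"
      using binH_of_nat[OF e, of "m + n"] by (simp add: binH_of_nat[OF e] power_add)
  qed
  show ?thesis
  proof (rule hahn_eqI, rule polyfun_eqI[of "\<lambda>b. hcoeff (binH (a + b) e) y"
        "\<lambda>b. hcoeff (binH a e * binH b e) y" for y])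
    fix y
    show "polyfun (\<lambda>b. hcoeff (binH (a + b) e) y)"
      using polyfun_hcoeff_binH[OF e, of a y] by (simp add: add.commute)
    show "polyfun (\<lambda>b. hcoeff (binH a e * binH b e) y)"
      by (rule polyfun_hcoeff_mult[OF _ _ wos_hsupp[of "binH a e"] wos_star_hsupp[OF e]])
         (use polyfun_hcoeff_binH[OF e, of 0] hsupp_binH[OF e] in \<open>auto intro: polyfun_const\<close>)
    fix m
    show "hcoeff (binH (a + real m) e) y = hcoeff (binH a e * binH (real m) e) y"
      by (simp add: binH_of_nat[OF e] *)
  qed
qed

lemma infinitesimal_add: "infinitesimal a \<Longrightarrow> infinitesimal b \<Longrightarrow> infinitesimal (a + b)"
  using hsupp_add[of a b] unfolding infinitesimal_def by blast

lemma infinitesimal_uminus: "infinitesimal a \<Longrightarrow> infinitesimal (- a)"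
  unfolding infinitesimal_def by simp

lemma infinitesimal_mult:
  assumes "infinitesimal a" "\<forall>x\<in>hsupp b. 0 \<le> x"
  shows "infinitesimal (a * b)"
  unfolding infinitesimal_def
proof
  fix x assume "x \<in> hsupp (a * b)"
  then obtain y z where "x = y + z" "y \<in> hsupp a" "z \<in> hsupp b"
    using hsupp_mult[of a b] by (meson set_plus_elim subsetD)
  then show "0 < x" using assms unfolding infinitesimal_def by (simp add: add_pos_nonneg)
qed

lemma infinitesimal_nonneg: "infinitesimal a \<Longrightarrow> \<forall>x\<in>hsupp a. 0 \<le> x"
  unfolding infinitesimal_def by (simp add: less_imp_le)

text \<open>\<open>1 + (a + b + a * b)\<close> is \<open>(1 + a) * (1 + b)\<close>: this operation
  is multiplication of units of the form 1 + infinitesimal.\<close>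

lemma infinitesimal_join:
  "infinitesimal a \<Longrightarrow> infinitesimal b \<Longrightarrow> infinitesimal (a + b + a * b)"
  by (intro infinitesimal_add infinitesimal_mult infinitesimal_nonneg)

lemma binH_join:
  assumes e: "infinitesimal e" and d: "infinitesimal d"
  shows "binH b (e + d + e * d) = binH b e * binH b d"
proof (rule hahn_eqI, rule polyfun_eqI[of "\<lambda>b. hcoeff (binH b (e + d + e * d)) y"
      "\<lambda>b. hcoeff (binH b e * binH b d) y" for y])
  fix y
  have ed: "infinitesimal (e + d + e * d)" by (rule infinitesimal_join[OF e d])
  show "polyfun (\<lambda>b. hcoeff (binH b (e + d + e * d)) y)"
    using polyfun_hcoeff_binH[OF ed, of 0] by simp
  show "polyfun (\<lambda>b. hcoeff (binH b e * binH b d) y)"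
    by (rule polyfun_hcoeff_mult[OF _ _ wos_star_hsupp[OF e] wos_star_hsupp[OF d]])
       (use polyfun_hcoeff_binH[OF e, of 0] polyfun_hcoeff_binH[OF d, of 0] hsupp_binH[OF e] hsupp_binH[OF d] in auto)
  have "1 + (e + d + e * d) = (1 + e) * (1 + d)" by (simp add: algebra_simps)
  then show "hcoeff (binH (real n) (e + d + e * d)) y = hcoeff (binH (real n) e * binH (real n) d) y" for n
    unfolding binH_of_nat[OF ed] binH_of_nat[OF e] binH_of_nat[OF d] by (simp add: power_mult_distrib)
qed

text \<open>The binomial coefficient is \<open>b / i\<close> times a polynomial in \<open>b\<close>,
  so its derivative at 0 is the value of the cofactor there. The results are the coefficients of
  log(1 + e), the derivative of (1 + e)^b at b = 0.\<close>

lemma gbinomial_deriv_0: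
  "((\<lambda>b::real. b gchoose i) has_real_derivative (if i = 0 then 0 else (-1) ^ (i + 1) / real i)) (at 0)"
proof (cases i)
  case (Suc n)
  obtain p where p: "\<And>b::real. (b + (-1)) gchoose n = poly p b"
    using polyfun_gbinomial[of "-1" n] unfolding polyfun_def by blast
  have "(\<lambda>b::real. b gchoose i) = (\<lambda>b. b / real (Suc n) * poly p b)"
    by (rule ext) (use gbinomial_absorption'[of i] in \<open>simp add: Suc p[symmetric]\<close>)
  moreover have "((\<lambda>b. b / real (Suc n) * poly p b) has_real_derivative
      (poly p 0 / real (Suc n))) (at 0)"
    by (auto intro!: derivative_eq_intros)
  moreover have "poly p 0 = (-1) ^ n"
    using p[of 0] by (simp add: gbinomial_minus binomial_gbinomial[symmetric] gbinomial_pochhammer pochhammer_fact[symmetric])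
  ultimately show ?thesis using Suc by simp
qed simp

lemma hcoeff_binH_deriv_0:
  assumes "infinitesimal e"
  shows "((\<lambda>b. hcoeff (binH b e) y) has_real_derivative hcoeff (logH e) y) (at 0)"
  unfolding binH_def logH_def hcoeff_pser[OF assms]
  by (intro DERIV_sum DERIV_cmult_right gbinomial_deriv_0)

text \<open>Differentiate the product rule for binomial series at exponent 0.\<close>

lemma logH_join:
  assumes e: "infinitesimal e" and d: "infinitesimal d"
  shows "logH (e + d + e * d) = logH e + logH d"
proof (rule hahn_eqI)
  fix y
  let ?A = "star (hsupp e)" and ?B = "star (hsupp d)"
  let ?S = "{a \<in> ?A. y - a \<in> ?B}"
  have m: "hcoeff (F * G) y = (\<Sum>a\<in>?S. hcoeff F a * hcoeff G (y - a))"
    if "hsupp F \<subseteq> ?A" "hsupp G \<subseteq> ?B" for F G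
    by (rule hcoeff_mult[OF that]) (use e d wos_star_hsupp in auto)
  have l: "hsupp (logH e) \<subseteq> ?A" "hsupp (logH d) \<subseteq> ?B"
    unfolding logH_def by (rule hsupp_pser; fact)+
  have "((\<lambda>b. hcoeff (binH b (e + d + e * d)) y) has_real_derivative
      (\<Sum>a\<in>?S. hcoeff (logH e) a * hcoeff (binH 0 d) (y - a) + hcoeff (logH d) (y - a) * hcoeff (binH 0 e) a)) (at 0)"
    unfolding binH_join[OF e d] m[OF hsupp_binH[OF e] hsupp_binH[OF d]]
    by (intro DERIV_sum DERIV_mult hcoeff_binH_deriv_0 e d)
  moreover have "(\<Sum>a\<in>?S. hcoeff (logH e) a * hcoeff (binH 0 d) (y - a) + hcoeff (logH d) (y - a) * hcoeff (binH 0 e) a)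
     = hcoeff (logH e * 1) y + hcoeff (1 * logH d) y"
    using m[of "logH e" 1] m[of 1 "logH d"] l by (simp add: e d sum.distrib mult.commute)
  ultimately show "hcoeff (logH (e + d + e * d)) y = hcoeff (logH e + logH d) y"
    using DERIV_unique[OF hcoeff_binH_deriv_0[OF infinitesimal_join[OF e d], of y]] by simp
qed

lemma pser_0: "pser c 0 = c 0 *\<^sub>R 1"
proof (rule hahn_eqI)
  fix y :: 'a
  have i: "infinitesimal (0 :: 'a hahn)" unfolding infinitesimal_def by simp
  have "hcoeff (pser c 0) y = (\<Sum>i\<in>{0}. hcoeff (c i *\<^sub>R 0 ^ i) y)"
    unfolding pser_def
    by (rule hcoeff_hsum[OF summable_fam_pser[OF i]]) (auto simp: power_0_left split: if_splits)
  then show "hcoeff (pser c 0) y = hcoeff (c 0 *\<^sub>R 1) y" by simp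
qed

text \<open>The geometric series is the binomial series of exponent -1 in \<open>- e\<close>, so
  this is the exponent law for -1 + 1 = 0.\<close>

lemma geomH_inverse:
  assumes e: "infinitesimal e"
  shows "geomH e * (1 - e) = 1"
proof -
  have m: "infinitesimal (- e)" using e by (rule infinitesimal_uminus)
  have "geomH e = binH (-1) (- e)"
    unfolding geomH_def binH_def pser_def
  proof (rule hsum_cong)
    fix i :: nat
    have "(-1 gchoose i :: real) = (-1) ^ i"
      by (simp add: gbinomial_minus binomial_gbinomial[symmetric] gbinomial_pochhammer pochhammer_fact[symmetric])
    moreover have "e ^ i = (-1) ^ i *\<^sub>R (- e) ^ i"
      by (induction i) simp_all
    ultimately show "1 *\<^sub>R e ^ i = (-1 gchoose i) *\<^sub>R (- e) ^ i" by simp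
  qed
  then show ?thesis
    using binH_add[OF m, of "-1" 1] binH_1[OF m] m by simp
qed

section \<open>Strongly linear operators prescribed on monomials\<close>

definition lin_op :: "('g \<Rightarrow> 'g hahn) \<Rightarrow> 'g::linordered_ab_group_add hahn \<Rightarrow> 'g hahn" where
  "lin_op w F = hsum (hsupp F) (\<lambda>x. hcoeff F x *\<^sub>R w x)"

text \<open>A single well-ordered set \<open>T\<close> of shifts for all monomials makes the linear
  extension meaningful: images of a well-ordered \<open>A\<close> stay in \<open>A + T\<close>, and
  each coefficient receives finitely many contributions. \<open>T\<close> is a parameter because one
  operator is used with several choices of it.\<close>

locale shift_op =
  fixes D T :: "'g::linordered_ab_group_add set" and w :: "'g \<Rightarrow> 'g hahn"
  assumes wos_T: "wos T" and w_supp: "x \<in> D \<Longrightarrow> y \<in> hsupp (w x) \<Longrightarrow> y - x \<in> T"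
begin

abbreviation op :: "'g hahn \<Rightarrow> 'g hahn" where
  "op \<equiv> lin_op w"

lemma in_shift: "y - x \<in> T \<Longrightarrow> x \<in> A \<Longrightarrow> y \<in> A + T"
  using set_plus_intro[of x A "y - x" T] by simp

lemma summable_fam_op:
  assumes "wos A" "A \<subseteq> D"
  shows "summable_fam A (\<lambda>x. c x *\<^sub>R w x)"
proof (rule summable_famI)
  show "wos (A + T)" by (intro wos_set_plus assms wos_T)
  show "hsupp (c x *\<^sub>R w x) \<subseteq> A + T" if "x \<in> A" for x
    using that hsupp_scaleR[of "c x" "w x"] w_supp[of x] assms(2) in_shift by blast
  show "finite {x \<in> A. y - x \<in> T}" for y by (intro finite_decompositions assms wos_T)
  show "x \<in> {x \<in> A. y - x \<in> T}" if "x \<in> A" "hcoeff (c x *\<^sub>R w x) y \<noteq> 0" for x y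
    using that w_supp[of x y] assms(2) by (auto simp: hsupp_def)
qed

lemma hcoeff_op:
  assumes "hsupp F \<subseteq> A" "wos A" "A \<subseteq> D"
  shows "hcoeff (op F) y = (\<Sum>x\<in>{x \<in> A. y - x \<in> T}. hcoeff F x * hcoeff (w x) y)"
proof -
  let ?J = "{x \<in> hsupp F. y - x \<in> T}"
  have "hcoeff (op F) y = (\<Sum>x\<in>?J. hcoeff (hcoeff F x *\<^sub>R w x) y)"
    unfolding lin_op_def
  proof (rule hcoeff_hsum[OF summable_fam_op])
    show "finite ?J" by (rule finite_decompositions[OF wos_hsupp wos_T])
    show "x \<in> ?J" if "x \<in> hsupp F" "hcoeff (hcoeff F x *\<^sub>R w x) y \<noteq> 0" for x
      using that assms w_supp[of x y] by (auto simp: hsupp_def)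
  qed (use assms in auto)
  also have "\<dots> = (\<Sum>x\<in>{x \<in> A. y - x \<in> T}. hcoeff F x * hcoeff (w x) y)"
    unfolding scaleR_hahn.rep_eq
    by (rule sum.mono_neutral_left)
       (use assms in \<open>auto simp: finite_decompositions wos_T hsupp_def\<close>)
  finally show ?thesis .
qed

lemma hsupp_op:
  assumes "hsupp F \<subseteq> D" "y \<in> hsupp (op F)"
  shows "\<exists>x\<in>hsupp F. y - x \<in> T"
proof -
  have "(\<Sum>x\<in>{x \<in> hsupp F. y - x \<in> T}. hcoeff F x * hcoeff (w x) y) \<noteq> 0"
    using assms hcoeff_op[OF subset_refl wos_hsupp assms(1), of y] by (simp add: hsupp_def)
  then have "{x \<in> hsupp F. y - x \<in> T} \<noteq> {}" by (metis (no_types) sum.empty)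
  then show ?thesis by auto
qed

lemma hsupp_op_subset:
  assumes "hsupp F \<subseteq> D"
  shows "hsupp (op F) \<subseteq> hsupp F + T"
proof
  fix y assume "y \<in> hsupp (op F)"
  then obtain x where "x \<in> hsupp F" "y - x \<in> T" using hsupp_op[OF assms] by blast
  then show "y \<in> hsupp F + T" by (intro in_shift)
qed

lemma op_add:
  assumes "hsupp F \<subseteq> D" "hsupp G \<subseteq> D"
  shows "op (F + G) = op F + op G"
proof (rule hahn_eqI)
  fix y
  let ?A = "hsupp F \<union> hsupp G"
  have "hcoeff (op X) y = (\<Sum>x\<in>{x \<in> ?A. y - x \<in> T}. hcoeff X x * hcoeff (w x) y)"
    if "hsupp X \<subseteq> ?A" for X
    by (rule hcoeff_op) (use that assms in \<open>auto simp: wos_Un\<close>)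
  then show "hcoeff (op (F + G)) y = hcoeff (op F + op G) y"
    using hsupp_add[of F G] by (simp add: distrib_right sum.distrib)
qed

lemma op_scaleR:
  assumes "hsupp F \<subseteq> D"
  shows "op (c *\<^sub>R F) = c *\<^sub>R op F"
proof (rule hahn_eqI)
  fix y
  have "hcoeff (op X) y = (\<Sum>x\<in>{x \<in> hsupp F. y - x \<in> T}. hcoeff X x * hcoeff (w x) y)"
    if "hsupp X \<subseteq> hsupp F" for X
    by (rule hcoeff_op) (use that assms in auto)
  then show "hcoeff (op (c *\<^sub>R F)) y = hcoeff (c *\<^sub>R op F) y"
    using hsupp_scaleR[of c F] by (simp add: sum_distrib_left mult.assoc)
qed

lemma op_diff:
  assumes "hsupp F \<subseteq> D" "hsupp G \<subseteq> D"
  shows "op (F - G) = op F - op G"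
  using op_add[of F "(-1) *\<^sub>R G"] op_scaleR[of G "-1"] hsupp_scaleR[of "-1" G] assms by auto

lemma op_hmon: "x \<in> D \<Longrightarrow> op (hmon x) = w x"
proof (rule hahn_eqI)
  fix y assume "x \<in> D"
  then have "hcoeff (op (hmon x)) y = (\<Sum>a\<in>{a \<in> {x}. y - a \<in> T}. hcoeff (hmon x) a * hcoeff (w a) y)"
    by (intro hcoeff_op) (auto simp: wos_finite)
  also have "\<dots> = (\<Sum>a\<in>{x}. hcoeff (hmon x) a * hcoeff (w a) y)"
    by (rule sum.mono_neutral_left) (use \<open>x \<in> D\<close> w_supp in \<open>auto simp: hsupp_def\<close>)
  finally show "hcoeff (op (hmon x)) y = hcoeff (w x) y" by simp
qed

lemma op_hsum:
  assumes s: "summable_fam I F" and D: "\<And>i. i \<in> I \<Longrightarrow> hsupp (F i) \<subseteq> D"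
  shows "op (hsum I F) = hsum I (\<lambda>i. op (F i))"
proof -
  let ?W = "\<Union>i\<in>I. hsupp (F i)"
  have W: "wos ?W" and WD: "?W \<subseteq> D" using s D unfolding summable_fam_def by blast+
  let ?X = "\<lambda>y. {x \<in> ?W. y - x \<in> T}"
  let ?J = "\<lambda>y. (\<Union>x\<in>?X y. {i \<in> I. hcoeff (F i) x \<noteq> 0})"
  have finX: "finite (?X y)" for y by (rule finite_decompositions[OF W wos_T])
  have fin: "finite (?J y)" for y using finX s unfolding summable_fam_def by blast
  have c: "hcoeff (op (F i)) y = (\<Sum>x\<in>?X y. hcoeff (F i) x * hcoeff (w x) y)" if "i \<in> I" for i y
    by (rule hcoeff_op) (use that W WD in auto)
  have J: "i \<in> ?J y" if i: "i \<in> I" and nz: "hcoeff (op (F i)) y \<noteq> 0" for i y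
  proof -
    obtain a where "a \<in> ?X y" "hcoeff (F i) a * hcoeff (w a) y \<noteq> 0"
      using nz unfolding c[OF i] by (metis (no_types, lifting) sum.not_neutral_contains_not_neutral)
    then show ?thesis using i by auto
  qed
  have sm: "summable_fam I (\<lambda>i. op (F i))"
  proof (rule summable_famI[OF wos_set_plus[OF W wos_T] _ fin J])
    show "hsupp (op (F i)) \<subseteq> ?W + T" if "i \<in> I" for i
      using hsupp_op_subset[OF D[OF that]] set_plus_mono2[of "hsupp (F i)" ?W T T] that by blast
  qed
  show "op (hsum I F) = hsum I (\<lambda>i. op (F i))"
  proof (rule hahn_eqI)
    fix y
    have "hcoeff (hsum I (\<lambda>i. op (F i))) y = (\<Sum>i\<in>?J y. hcoeff (op (F i)) y)"
      by (rule hcoeff_hsum[OF sm fin]) (use J in auto)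
    also have "\<dots> = (\<Sum>i\<in>?J y. \<Sum>x\<in>?X y. hcoeff (F i) x * hcoeff (w x) y)"
      by (rule sum.cong) (auto simp: c)
    also have "\<dots> = (\<Sum>x\<in>?X y. (\<Sum>i\<in>?J y. hcoeff (F i) x) * hcoeff (w x) y)"
      unfolding sum_distrib_right by (rule sum.swap)
    also have "\<dots> = (\<Sum>x\<in>?X y. hcoeff (hsum I F) x * hcoeff (w x) y)"
      by (intro sum.cong refl arg_cong2[of _ _ _ _ "(*)"] hcoeff_hsum[OF s fin, symmetric]) auto
    also have "\<dots> = hcoeff (op (hsum I F)) y"
      by (rule hcoeff_op[symmetric]) (use W WD hsupp_hsum[OF s] in auto)
    finally show "hcoeff (op (hsum I F)) y = hcoeff (hsum I (\<lambda>i. op (F i))) y" by simp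
  qed
qed

end

locale mult_shift_op = shift_op +
  assumes D_0: "0 \<in> D" and D_add: "x \<in> D \<Longrightarrow> y \<in> D \<Longrightarrow> x + y \<in> D"
    and w_0: "w 0 = 1" and w_add: "x \<in> D \<Longrightarrow> y \<in> D \<Longrightarrow> w (x + y) = w x * w y"
begin

lemma hsupp_mult_D:
  assumes "hsupp F \<subseteq> D" "hsupp G \<subseteq> D"
  shows "hsupp (F * G) \<subseteq> D"
proof
  fix x assume "x \<in> hsupp (F * G)"
  then have "x \<in> hsupp F + hsupp G" using hsupp_mult by blast
  then show "x \<in> D" using assms D_add by (auto elim!: set_plus_elim)
qed

lemma op_1: "op 1 = 1"
  using op_hmon[OF D_0] w_0 by (simp add: hmon_0)

lemma op_mult_hmon:
  assumes "x \<in> D" "hsupp G \<subseteq> D"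
  shows "op (hmon x * G) = w x * op G"
proof -
  have sm: "summable_fam (hsupp G) (\<lambda>y. hmon x * (hcoeff G y *\<^sub>R hmon y))"
    by (rule summable_fam_mult[OF summable_fam_hmon_expansion])
  have "op (hmon x * G) = op (hsum (hsupp G) (\<lambda>y. hmon x * (hcoeff G y *\<^sub>R hmon y)))"
    by (simp only: hsum_mult[OF summable_fam_hmon_expansion] hmon_expansion)
  also have "\<dots> = hsum (hsupp G) (\<lambda>y. op (hmon x * (hcoeff G y *\<^sub>R hmon y)))"
  proof (rule op_hsum[OF sm])
    fix y assume "y \<in> hsupp G"
    then show "hsupp (hmon x * (hcoeff G y *\<^sub>R hmon y)) \<subseteq> D"
      using assms hsupp_scaleR[of "hcoeff G y" "hmon y"] by (intro hsupp_mult_D) auto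
  qed
  also have "\<dots> = hsum (hsupp G) (\<lambda>y. w x * (hcoeff G y *\<^sub>R w y))"
  proof (rule hsum_cong)
    fix y assume "y \<in> hsupp G"
    then have y: "y \<in> D" using assms by blast
    have "op (hmon x * (hcoeff G y *\<^sub>R hmon y)) = op (hcoeff G y *\<^sub>R hmon (x + y))"
      by (simp add: hmon_add)
    also have "\<dots> = hcoeff G y *\<^sub>R w (x + y)"
      using y assms D_add by (subst op_scaleR) (auto simp: op_hmon)
    finally show "op (hmon x * (hcoeff G y *\<^sub>R hmon y)) = w x * (hcoeff G y *\<^sub>R w y)"
      using y assms by (simp add: w_add)
  qed
  also have "\<dots> = w x * op G"
    unfolding lin_op_def by (rule hsum_mult[OF summable_fam_op]) (use assms in auto)
  finally show ?thesis .
qed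

lemma op_mult:
  assumes "hsupp F \<subseteq> D" "hsupp G \<subseteq> D"
  shows "op (F * G) = op F * op G"
proof -
  have sm: "summable_fam (hsupp F) (\<lambda>x. G * (hcoeff F x *\<^sub>R hmon x))"
    by (rule summable_fam_mult[OF summable_fam_hmon_expansion])
  have "op (F * G) = op (hsum (hsupp F) (\<lambda>x. G * (hcoeff F x *\<^sub>R hmon x)))"
    by (simp only: hsum_mult[OF summable_fam_hmon_expansion] hmon_expansion mult.commute[of F])
  also have "\<dots> = hsum (hsupp F) (\<lambda>x. op (G * (hcoeff F x *\<^sub>R hmon x)))"
  proof (rule op_hsum[OF sm])
    fix x assume "x \<in> hsupp F"
    then show "hsupp (G * (hcoeff F x *\<^sub>R hmon x)) \<subseteq> D"
      using assms hsupp_scaleR[of "hcoeff F x" "hmon x"] by (intro hsupp_mult_D) auto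
  qed
  also have "\<dots> = hsum (hsupp F) (\<lambda>x. op G * (hcoeff F x *\<^sub>R w x))"
  proof (rule hsum_cong)
    fix x assume "x \<in> hsupp F"
    then have x: "x \<in> D" using assms by blast
    have "op (G * (hcoeff F x *\<^sub>R hmon x)) = op (hcoeff F x *\<^sub>R (hmon x * G))"
      by (simp add: mult.commute)
    also have "\<dots> = hcoeff F x *\<^sub>R (w x * op G)"
      using x assms by (subst op_scaleR) (simp_all add: op_mult_hmon hsupp_mult_D)
    finally show "op (G * (hcoeff F x *\<^sub>R hmon x)) = op G * (hcoeff F x *\<^sub>R w x)"
      by (simp add: mult.commute)
  qed
  also have "\<dots> = op G * op F"
    unfolding lin_op_def[of _ F] by (rule hsum_mult[OF summable_fam_op]) (use assms in auto)
  finally show ?thesis by (simp add: mult.commute)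
qed

lemma hsupp_power_D: "hsupp F \<subseteq> D \<Longrightarrow> hsupp (F ^ i) \<subseteq> D"
  by (induction i) (simp_all add: D_0 hsupp_mult_D)

lemma op_power: "hsupp F \<subseteq> D \<Longrightarrow> op (F ^ i) = op F ^ i"
  by (induction i) (simp_all add: op_1 op_mult hsupp_power_D)

lemma op_pser:
  assumes "infinitesimal e" "hsupp e \<subseteq> D"
  shows "op (pser c e) = pser c (op e)"
proof -
  have "op (pser c e) = hsum UNIV (\<lambda>i. op (c i *\<^sub>R e ^ i))"
    unfolding pser_def
    by (rule op_hsum[OF summable_fam_pser[OF assms(1)]])
       (use hsupp_scaleR hsupp_power_D[OF assms(2)] in blast)
  also have "\<dots> = pser c (op e)"
    unfolding pser_def using assms(2) by (simp add: op_scaleR hsupp_power_D op_power)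
  finally show ?thesis .
qed

lemma op_prod:
  "(\<And>i. i \<in> I \<Longrightarrow> hsupp (F i) \<subseteq> D) \<Longrightarrow> hsupp (prod F I) \<subseteq> D \<and> op (prod F I) = (\<Prod>i\<in>I. op (F i))"
  by (induction I rule: infinite_finite_induct) (simp_all add: op_1 D_0 hsupp_mult_D op_mult)

end

section \<open>Composition of logarithmic transseries\<close>

datatype lmon = Mono (zexp: real) (lexp: "nat \<Rightarrow> int")

lemma vless_irrefl: "\<not> vless n n"
  unfolding vless_def by auto

lemma vless_trans:
  assumes "vless a b" "vless b c"
  shows "vless a c"
proof -
  obtain i j where "\<forall>l<i. a l = b l" "a i < b i" "\<forall>l<j. b l = c l" "b j < c j"
    using assms unfolding vless_def by blast
  then show ?thesis
    unfolding vless_def by (intro exI[of _ "min i j"]) (auto simp: min_def not_le le_less split: if_splits)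
qed

lemma vless_total: "n = m \<or> vless n m \<or> vless m n"
proof (cases "n = m")
  case False
  then have ex: "\<exists>j. n j \<noteq> m j" by auto
  define j where "j = (LEAST j. n j \<noteq> m j)"
  have "n j \<noteq> m j" "\<forall>i<j. n i = m i"
    using LeastI_ex[OF ex] not_less_Least[of _ "\<lambda>j. n j \<noteq> m j"] unfolding j_def by blast+
  then show ?thesis unfolding vless_def by (metis linorder_neqE)
qed simp

instantiation lmon :: linordered_ab_group_add
begin

definition zero_lmon :: lmon where "0 = Mono 0 zv"
definition plus_lmon :: "lmon \<Rightarrow> lmon \<Rightarrow> lmon" where
  "x + y = Mono (zexp x + zexp y) (\<lambda>j. lexp x j + lexp y j)"
definition minus_lmon :: "lmon \<Rightarrow> lmon \<Rightarrow> lmon" where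
  "x - y = Mono (zexp x - zexp y) (\<lambda>j. lexp x j - lexp y j)"
definition uminus_lmon :: "lmon \<Rightarrow> lmon" where
  "- x = Mono (- zexp x) (\<lambda>j. - lexp x j)"
definition less_lmon :: "lmon \<Rightarrow> lmon \<Rightarrow> bool" where
  "x < y \<longleftrightarrow> zexp x < zexp y \<or> (zexp x = zexp y \<and> vless (lexp x) (lexp y))"
definition less_eq_lmon :: "lmon \<Rightarrow> lmon \<Rightarrow> bool" where
  "x \<le> y \<longleftrightarrow> x = y \<or> x < (y :: lmon)"

instance
proof
  fix x y z :: lmon
  show "(x < y) = (x \<le> y \<and> \<not> y \<le> x)"
    unfolding less_eq_lmon_def less_lmon_def
    using vless_irrefl vless_trans[of "lexp x" "lexp y" "lexp x"] by auto
  show "x \<le> x" unfolding less_eq_lmon_def by simp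
  show "x \<le> z" if "x \<le> y" "y \<le> z"
    using that unfolding less_eq_lmon_def less_lmon_def
    using vless_trans[of "lexp x" "lexp y" "lexp z"] by auto
  show "x = y" if "x \<le> y" "y \<le> x"
    using that unfolding less_eq_lmon_def less_lmon_def
    using vless_irrefl vless_trans[of "lexp x" "lexp y" "lexp x"] by auto
  show "x \<le> y \<or> y \<le> x"
    unfolding less_eq_lmon_def less_lmon_def using vless_total[of "lexp x" "lexp y"] lmon.expand[of x y]
    by (cases "zexp x" "zexp y" rule: linorder_cases) auto
  show "x + y + z = x + (y + z)" "x + y = y + x" "0 + x = x" "- x + x = 0" "x - y = x + - y"
    by (simp_all add: plus_lmon_def zero_lmon_def uminus_lmon_def minus_lmon_def zv_def algebra_simps)
  show "z + x \<le> z + y" if "x \<le> y"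
    using that unfolding less_eq_lmon_def less_lmon_def plus_lmon_def vless_def by auto
qed

end

lemma lmon_sel [simp]:
  "zexp 0 = 0" "lexp 0 j = 0" "zexp (x + y) = zexp x + zexp y" "lexp (x + y) j = lexp x j + lexp y j"
  "zexp (x - y) = zexp x - zexp y" "lexp (x - y) j = lexp x j - lexp y j"
  "zexp (- x) = - zexp x" "lexp (- x) j = - lexp x j"
  by (simp_all add: zero_lmon_def plus_lmon_def minus_lmon_def uminus_lmon_def zv_def)

lemma zexp_mono: "x \<le> y \<Longrightarrow> zexp x \<le> zexp y"
  unfolding less_eq_lmon_def less_lmon_def by auto

definition Zm :: lmon where "Zm = Mono 1 zv"
definition Em :: "nat \<Rightarrow> lmon" where "Em j = Mono 0 (\<lambda>i. if i = j then 1 else 0)"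

lemma Zm_sel [simp]: "zexp Zm = 1" "lexp Zm j = 0"
  and Em_sel [simp]: "zexp (Em j) = 0" "lexp (Em j) i = (if i = j then 1 else 0)"
  by (simp_all add: Zm_def Em_def zv_def)

lemma Em_pos: "0 < Em j"
  unfolding less_lmon_def vless_def by (auto intro!: exI[of _ j])

text \<open>The logarithmic part of membership in L_K. There is no sign condition on the z-exponent,
  since \<open>- Zm\<close> must belong to it.\<close>

definition dom_lmon :: "nat \<Rightarrow> lmon set" where
  "dom_lmon K = {x. \<forall>j. j = 0 \<or> K < j \<longrightarrow> lexp x j = 0}"

definition submonoid :: "'a::monoid_add set \<Rightarrow> bool" where
  "submonoid A \<longleftrightarrow> 0 \<in> A \<and> (\<forall>x\<in>A. \<forall>y\<in>A. x + y \<in> A)"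

lemma submonoid_dom: "submonoid (dom_lmon K)"
  unfolding submonoid_def dom_lmon_def by auto

lemma dom_lmon_simps:
  "Zm \<in> dom_lmon K" "- Zm \<in> dom_lmon K" "1 \<le> j \<Longrightarrow> j \<le> K \<Longrightarrow> Em j \<in> dom_lmon K"
  "x \<in> dom_lmon K \<Longrightarrow> y \<in> dom_lmon K \<Longrightarrow> x + y \<in> dom_lmon K"
  unfolding dom_lmon_def by auto

lemma submonoid_star: "submonoid (star A)"
  unfolding submonoid_def by (simp add: star_add)

lemma submonoid_nonneg: "submonoid {x::'a::linordered_ab_group_add. 0 \<le> x}"
  unfolding submonoid_def by simp

lemma hsupp_mult_submonoid:
  assumes "submonoid A" "hsupp F \<subseteq> A" "hsupp G \<subseteq> A"
  shows "hsupp (F * G) \<subseteq> A"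
proof
  fix x assume "x \<in> hsupp (F * G)"
  then have "x \<in> hsupp F + hsupp G" using hsupp_mult by blast
  then show "x \<in> A" using assms unfolding submonoid_def by (auto elim!: set_plus_elim)
qed

lemma hsupp_add_subset: "hsupp F \<subseteq> A \<Longrightarrow> hsupp G \<subseteq> A \<Longrightarrow> hsupp (F + G) \<subseteq> A"
  by (rule subset_trans[OF hsupp_add]) blast

lemma hsupp_scaleR_subset: "hsupp F \<subseteq> A \<Longrightarrow> hsupp (c *\<^sub>R F) \<subseteq> A"
  by (rule subset_trans[OF hsupp_scaleR])

lemma hsupp_prod_submonoid:
  "submonoid A \<Longrightarrow> (\<And>i. i \<in> I \<Longrightarrow> hsupp (F i) \<subseteq> A) \<Longrightarrow> hsupp (prod F I) \<subseteq> A"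
  by (induction I rule: infinite_finite_induct) (simp_all add: hsupp_mult_submonoid, simp_all add: submonoid_def)

lemma hsupp_pser_submonoid:
  "submonoid A \<Longrightarrow> infinitesimal e \<Longrightarrow> hsupp e \<subseteq> A \<Longrightarrow> hsupp (pser c e) \<subseteq> A"
  using hsupp_pser[of e c] star_least[of "hsupp e" A] unfolding submonoid_def by blast

section \<open>Composition operators with a fixed inner series\<close>

definition leadc :: "lmon hahn \<Rightarrow> real" where "leadc G = hcoeff G Zm"

definition epsH :: "lmon hahn \<Rightarrow> lmon hahn" where
  "epsH G = (1 / leadc G) *\<^sub>R (hmon (- Zm) * G) - 1"

fun delta :: "lmon hahn \<Rightarrow> nat \<Rightarrow> lmon hahn" where
  "delta G 0 = epsH G"
| "delta G (Suc j) = geomH (hmon (Em (Suc j)) *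
      (if j = 0 then ln (leadc G) *\<^sub>R 1 + logH (epsH G) else logH (delta G j))) - 1"

definition mon_comp :: "nat \<Rightarrow> lmon hahn \<Rightarrow> lmon \<Rightarrow> lmon hahn" where
  "mon_comp K G x = (leadc G powr zexp x) *\<^sub>R (hmon x * (binH (zexp x) (epsH G) *
     (\<Prod>j = 1..K. binH (real_of_int (lexp x j)) (delta G j))))"

text \<open>The inner series \<open>G\<close> comes before the outer one because the operator acts
  on the outer series; iterated operators thus stand in the reverse order of the composition. The
  identity series is \<open>hmon Zm\<close>.\<close>

abbreviation compH :: "nat \<Rightarrow> lmon hahn \<Rightarrow> lmon hahn \<Rightarrow> lmon hahn" where
  "compH K G \<equiv> lin_op (mon_comp K G)"

definition admissible :: "nat \<Rightarrow> lmon hahn \<Rightarrow> bool" where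
  "admissible K G \<longleftrightarrow> 0 < leadc G \<and> (\<forall>x\<in>hsupp G. Zm \<le> x) \<and> hsupp G \<subseteq> dom_lmon K"

lemma hcoeff_epsH: "hcoeff (epsH G) x = hcoeff G (x + Zm) / leadc G - (if x = 0 then 1 else 0)"
  unfolding epsH_def by (simp add: hcoeff_hmon_mult)

lemma hsupp_epsH: "admissible K G \<Longrightarrow> x \<in> hsupp (epsH G) \<Longrightarrow> x + Zm \<in> hsupp G \<and> 0 < x"
proof -
  assume g: "admissible K G" and x: "x \<in> hsupp (epsH G)"
  have "x \<noteq> 0" using x g unfolding hsupp_def admissible_def by (auto simp: hcoeff_epsH leadc_def)
  then have "x + Zm \<in> hsupp G" using x unfolding hsupp_def by (auto simp: hcoeff_epsH)
  moreover have "0 \<le> x" using calculation g unfolding admissible_def by fastforce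
  ultimately show ?thesis using \<open>x \<noteq> 0\<close> by auto
qed

lemma infinitesimal_epsH: "admissible K G \<Longrightarrow> infinitesimal (epsH G)"
  unfolding infinitesimal_def using hsupp_epsH by blast

lemma dom_minus_Zm: "x + Zm \<in> dom_lmon K \<Longrightarrow> x \<in> dom_lmon K"
  unfolding dom_lmon_def by simp

lemma hsupp_epsH_dom: "admissible K G \<Longrightarrow> hsupp (epsH G) \<subseteq> dom_lmon K"
  using hsupp_epsH[of K G] dom_minus_Zm unfolding admissible_def by blast

lemma admissible_factor: "admissible K G \<Longrightarrow> G = leadc G *\<^sub>R (hmon Zm * (1 + epsH G))"
  unfolding admissible_def by (intro hahn_eqI) (simp add: hcoeff_hmon_mult hcoeff_epsH)

lemma
  assumes "infinitesimal e" "c \<noteq> 0" "G = c *\<^sub>R (hmon Zm * (1 + e))"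
  shows leadc_factor: "leadc G = c" and epsH_factor: "epsH G = e"
proof -
  have "hcoeff e 0 = 0" using assms(1) unfolding infinitesimal_def hsupp_def by auto
  then show l: "leadc G = c" unfolding leadc_def assms(3) by (simp add: hcoeff_hmon_mult)
  show "epsH G = e"
    by (rule hahn_eqI) (use assms(2) in \<open>simp add: hcoeff_epsH l, simp add: assms(3) hcoeff_hmon_mult\<close>)
qed

lemma admissible_of_factor:
  assumes "infinitesimal e" "0 < c" "G = c *\<^sub>R (hmon Zm * (1 + e))" "hsupp e \<subseteq> dom_lmon K"
  shows "admissible K G"
proof -
  have "leadc G = c" using leadc_factor[OF assms(1) _ assms(3)] assms(2) by simp
  moreover have "x - Zm \<in> hsupp e \<or> x = Zm" if "x \<in> hsupp G" for x
    using that unfolding hsupp_def assms(3) by (auto simp: hcoeff_hmon_mult split: if_splits)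
  moreover have "Zm \<le> x \<and> x \<in> dom_lmon K" if "x - Zm \<in> hsupp e" for x
    using that assms(1,4) dom_lmon_simps(4)[of "x - Zm" K Zm] dom_lmon_simps(1)
    unfolding infinitesimal_def by (auto dest: less_imp_le)
  ultimately show ?thesis using assms(2) dom_lmon_simps(1)[of K] unfolding admissible_def by blast
qed

text \<open>With l_0 = z, this is the logarithm of (l_j o G) / l_j. Since l_(j+1) = -1 / ln l_j,
  composition with \<open>G\<close> gives l_(j+1) / (1 - l_(j+1) * log_delta G j), which is the
  recursion for \<open>delta\<close>.\<close>

definition log_delta :: "lmon hahn \<Rightarrow> nat \<Rightarrow> lmon hahn" where
  "log_delta G j = (if j = 0 then ln (leadc G) *\<^sub>R 1 + logH (epsH G) else logH (delta G j))"

lemma delta_Suc: "delta G (Suc j) = geomH (hmon (Em (Suc j)) * log_delta G j) - 1"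
  unfolding log_delta_def by simp

declare delta.simps(2) [simp del]

lemma hsupp_subset_diff_1: "submonoid A \<Longrightarrow> hsupp F \<subseteq> A \<Longrightarrow> hsupp (F - 1) \<subseteq> A"
  using hsupp_diff[of F 1] unfolding submonoid_def by auto

lemma infinitesimal_pser_diff: "infinitesimal e \<Longrightarrow> c 0 = 1 \<Longrightarrow> infinitesimal (pser c e - 1)"
proof -
  assume e: "infinitesimal e" "c 0 = 1"
  have "hcoeff (pser c e - 1) 0 = 0" using hcoeff_pser_0[OF e(1), of c] e(2) by simp
  moreover have "hsupp (pser c e - 1) \<subseteq> {x. 0 \<le> x}"
    by (rule hsupp_subset_diff_1[OF submonoid_nonneg]) (use hsupp_pser_nonneg[OF e(1)] in auto)
  ultimately show ?thesis unfolding infinitesimal_def hsupp_def by (force simp: le_less)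
qed

lemma hmon_mult_infinitesimal:
  "0 < x \<Longrightarrow> hsupp F \<subseteq> {x. 0 \<le> x} \<Longrightarrow> infinitesimal (hmon x * F)"
  by (rule infinitesimal_mult) (auto simp: infinitesimal_def)

lemma log_delta_nonneg:
  assumes "infinitesimal (delta G j)"
  shows "hsupp (log_delta G j) \<subseteq> {x. 0 \<le> x}"
proof -
  have "hsupp (logH (delta G j)) \<subseteq> {x. 0 \<le> x}"
    unfolding logH_def using hsupp_pser_nonneg[OF assms] by auto
  then show ?thesis
    unfolding log_delta_def by (cases j) (auto intro!: hsupp_add_subset hsupp_scaleR_subset del: subsetI)
qed

lemma infinitesimal_delta: "admissible K G \<Longrightarrow> infinitesimal (delta G j)"
proof (induction j)
  case 0
  then show ?case by (simp add: infinitesimal_epsH)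
next
  case (Suc j)
  then show ?case
    unfolding delta_Suc geomH_def
    by (intro infinitesimal_pser_diff hmon_mult_infinitesimal Em_pos log_delta_nonneg) auto
qed

lemma infinitesimal_Em_log_delta: "admissible K G \<Longrightarrow> infinitesimal (hmon (Em (Suc j)) * log_delta G j)"
  by (intro hmon_mult_infinitesimal Em_pos log_delta_nonneg infinitesimal_delta)

lemma
  assumes "admissible K G"
  shows hsupp_delta: "j \<le> K \<Longrightarrow> hsupp (delta G j) \<subseteq> dom_lmon K"
    and hsupp_log_delta: "j \<le> K \<Longrightarrow> hsupp (log_delta G j) \<subseteq> dom_lmon K"
proof -
  have l: "hsupp (log_delta G j) \<subseteq> dom_lmon K" if "hsupp (delta G j) \<subseteq> dom_lmon K" for j
  proof -
    have "hsupp (logH (delta G j)) \<subseteq> dom_lmon K"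
      unfolding logH_def by (rule hsupp_pser_submonoid[OF submonoid_dom infinitesimal_delta[OF assms] that])
    then show ?thesis
      using submonoid_dom[of K] unfolding log_delta_def submonoid_def
      by (cases j) (auto intro!: hsupp_add_subset hsupp_scaleR_subset del: subsetI)
  qed
  have d: "hsupp (delta G j) \<subseteq> dom_lmon K" if "j \<le> K" for j
    using that
  proof (induction j)
    case 0
    then show ?case using hsupp_epsH_dom[OF assms] by simp
  next
    case (Suc j)
    have "hsupp (hmon (Em (Suc j)) * log_delta G j) \<subseteq> dom_lmon K"
      using Suc l[of j] by (intro hsupp_mult_submonoid submonoid_dom) (auto simp: dom_lmon_simps(3))
    then show ?case
      unfolding delta_Suc geomH_def
      by (intro hsupp_subset_diff_1 submonoid_dom hsupp_pser_submonoid infinitesimal_Em_log_delta[OF assms])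
  qed
  then show "j \<le> K \<Longrightarrow> hsupp (delta G j) \<subseteq> dom_lmon K" "j \<le> K \<Longrightarrow> hsupp (log_delta G j) \<subseteq> dom_lmon K"
    using l by blast+
qed

text \<open>Apart from the monomial itself, every factor of \<open>mon_comp K G x\<close> is a power
  series in some \<open>delta G j\<close>, \<open>delta G 0\<close> being \<open>epsH G\<close>. The
  generated submonoid therefore contains the shifts of all monomials at once, whatever their
  exponents.\<close>

definition shift_set :: "nat \<Rightarrow> lmon hahn \<Rightarrow> lmon set" where
  "shift_set K G = star (\<Union>j\<le>K. hsupp (delta G j))"

lemma
  assumes "admissible K G"
  shows wos_shift_set: "wos (shift_set K G)" and shift_set_nonneg: "x \<in> shift_set K G \<Longrightarrow> 0 \<le> x"
    and shift_set_dom: "shift_set K G \<subseteq> dom_lmon K"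
proof -
  have p: "\<forall>s\<in>(\<Union>j\<le>K. hsupp (delta G j)). 0 < s"
    using infinitesimal_delta[OF assms] unfolding infinitesimal_def by blast
  show "wos (shift_set K G)" unfolding shift_set_def by (intro wos_star wos_UN_finite p) auto
  show "x \<in> shift_set K G \<Longrightarrow> 0 \<le> x" unfolding shift_set_def using star_nonneg[OF p] by blast
  show "shift_set K G \<subseteq> dom_lmon K"
    unfolding shift_set_def
    by (rule star_least) (use hsupp_delta[OF assms] submonoid_dom[of K] in \<open>auto simp: submonoid_def\<close>)
qed

lemma submonoid_shift_set: "submonoid (shift_set K G)"
  unfolding shift_set_def by (rule submonoid_star)

lemma hsupp_binH_delta:
  assumes "admissible K G" "j \<le> K"
  shows "hsupp (binH b (delta G j)) \<subseteq> shift_set K G"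
proof -
  have "hsupp (delta G j) \<subseteq> shift_set K G"
    using subset_star[of "\<Union>j\<le>K. hsupp (delta G j)"] assms(2) unfolding shift_set_def by blast
  then show ?thesis
    unfolding binH_def by (intro hsupp_pser_submonoid submonoid_shift_set infinitesimal_delta[OF assms(1)])
qed

definition mon_factor :: "nat \<Rightarrow> lmon hahn \<Rightarrow> lmon \<Rightarrow> lmon hahn" where
  "mon_factor K G x = binH (zexp x) (epsH G) * (\<Prod>j = 1..K. binH (real_of_int (lexp x j)) (delta G j))"

lemma mon_comp_mon_factor: "mon_comp K G x = (leadc G powr zexp x) *\<^sub>R (hmon x * mon_factor K G x)"
  unfolding mon_comp_def mon_factor_def ..

lemma hsupp_mon_factor: "admissible K G \<Longrightarrow> hsupp (mon_factor K G x) \<subseteq> shift_set K G"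
  unfolding mon_factor_def
  using hsupp_binH_delta[of K G 0]
  by (intro hsupp_mult_submonoid hsupp_prod_submonoid submonoid_shift_set) (auto dest: hsupp_binH_delta[THEN subsetD])

lemma hcoeff_mult_0:
  assumes "hsupp F \<subseteq> {x. 0 \<le> x}" "hsupp G \<subseteq> {x. 0 \<le> x}"
  shows "hcoeff (F * G) 0 = hcoeff F 0 * hcoeff G 0"
proof -
  have "hcoeff (F * G) 0 = (\<Sum>a\<in>{0}. hcoeff F a * hcoeff G (0 - a))"
    unfolding hcoeff_mult_hsupp
  proof (rule sum.mono_neutral_left)
    show "{a \<in> hsupp F. 0 - a \<in> hsupp G} \<subseteq> {0}"
    proof
      fix a assume "a \<in> {a \<in> hsupp F. 0 - a \<in> hsupp G}"
      then have "0 \<le> a" "0 \<le> 0 - a" using assms by blast+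
      then show "a \<in> {0}" by simp
    qed
  qed (auto simp: hsupp_def)
  then show ?thesis by simp
qed

lemma hcoeff_binH_delta_0: "admissible K G \<Longrightarrow> hcoeff (binH b (delta G j)) 0 = 1"
  unfolding binH_def by (subst hcoeff_pser_0[OF infinitesimal_delta]) auto

text \<open>Each factor has constant term 1 and no negative exponents, so constant terms multiply.
  Hence the diagonal entry of composition is the power of \<open>leadc G\<close> alone.\<close>

lemma hcoeff_mon_factor_0:
  assumes "admissible K G"
  shows "hcoeff (mon_factor K G x) 0 = 1"
proof -
  have n: "hsupp (binH b (delta G j)) \<subseteq> {x. 0 \<le> x}" for b j
    unfolding binH_def using hsupp_pser_nonneg[OF infinitesimal_delta[OF assms]] by auto
  have p: "hsupp (\<Prod>j\<in>I. binH (b j) (delta G j)) \<subseteq> {x. 0 \<le> x}" for b I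
    by (rule hsupp_prod_submonoid[OF submonoid_nonneg n])
  have "hcoeff (\<Prod>j\<in>I. binH (b j) (delta G j)) 0 = 1" for b I
    by (induction I rule: infinite_finite_induct)
       (simp_all add: hcoeff_mult_0 n p hcoeff_binH_delta_0[OF assms])
  then show ?thesis
    unfolding mon_factor_def using n[of _ 0] hcoeff_binH_delta_0[OF assms, of _ 0] by (simp add: hcoeff_mult_0 p)
qed

lemma hcoeff_mon_comp: "hcoeff (mon_comp K G x) y = leadc G powr zexp x * hcoeff (mon_factor K G x) (y - x)"
  unfolding mon_comp_mon_factor by (simp add: hcoeff_hmon_mult)

lemma hcoeff_mon_comp_diag: "admissible K G \<Longrightarrow> hcoeff (mon_comp K G x) x = leadc G powr zexp x"
  by (simp add: hcoeff_mon_comp hcoeff_mon_factor_0)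

lemma hsupp_mon_comp: "admissible K G \<Longrightarrow> y \<in> hsupp (mon_comp K G x) \<Longrightarrow> y - x \<in> shift_set K G"
  using hsupp_mon_factor[of K G x] unfolding hsupp_def by (auto simp: hcoeff_mon_comp)

text \<open>Multiplicativity on monomials is the exponent law \<open>binH_add\<close>, applied to
  the exponent of z and to that of each logarithm.\<close>

lemma mult_shift_op_compH:
  assumes "admissible K G"
  shows "mult_shift_op (dom_lmon K) (shift_set K G) (mon_comp K G)"
proof
  show "wos (shift_set K G)" by (rule wos_shift_set[OF assms])
  show "y - x \<in> shift_set K G" if "y \<in> hsupp (mon_comp K G x)" for x y
    by (rule hsupp_mon_comp[OF assms that])
  show "0 \<in> dom_lmon K" using submonoid_dom unfolding submonoid_def by blast
  show "x + y \<in> dom_lmon K" if "x \<in> dom_lmon K" "y \<in> dom_lmon K" for x y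
    using that by (rule dom_lmon_simps(4))
  note i = infinitesimal_delta[OF assms]
  have i0: "infinitesimal (epsH G)" by (rule infinitesimal_epsH[OF assms])
  have "leadc G \<noteq> 0" using assms unfolding admissible_def by simp
  then show "mon_comp K G 0 = 1"
    unfolding mon_comp_def by (simp add: i i0 hmon_0)
  show "mon_comp K G (x + y) = mon_comp K G x * mon_comp K G y" for x y
    unfolding mon_comp_def by (simp add: powr_add hmon_add binH_add[OF i] binH_add[OF i0] prod.distrib mult_ac)
qed

lemma mon_comp_Zm: "admissible K G \<Longrightarrow> mon_comp K G Zm = G"
proof -
  assume g: "admissible K G"
  have "0 < leadc G" using g unfolding admissible_def by simp
  then have "mon_comp K G Zm = leadc G *\<^sub>R (hmon Zm * (1 + epsH G))"
    unfolding mon_comp_def by (simp add: infinitesimal_delta[OF g] infinitesimal_epsH[OF g] binH_1)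
  then show ?thesis using admissible_factor[OF g] by simp
qed

lemma compH_Zm: "admissible K G \<Longrightarrow> compH K G (hmon Zm) = G"
proof -
  assume g: "admissible K G"
  interpret C: mult_shift_op "dom_lmon K" "shift_set K G" "mon_comp K G" by (rule mult_shift_op_compH[OF g])
  show ?thesis using C.op_hmon[OF dom_lmon_simps(1)] mon_comp_Zm[OF g] by simp
qed

lemma infinitesimal_0: "infinitesimal 0" unfolding infinitesimal_def by simp

lemma admissible_Zm: "admissible K (hmon Zm)"
  unfolding admissible_def leadc_def by (simp add: dom_lmon_simps)

lemma delta_Zm: "delta (hmon Zm) j = 0"
proof -
  have l: "leadc (hmon Zm) = 1" and e: "epsH (hmon Zm) = 0"
    using leadc_factor[OF infinitesimal_0, of 1 "hmon Zm"] epsH_factor[OF infinitesimal_0, of 1 "hmon Zm"] by simp_all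
  show ?thesis
    by (induction j) (simp_all add: e l delta_Suc log_delta_def logH_def geomH_def pser_0)
qed

lemma compH_id: "compH K (hmon Zm) F = F"
proof -
  have l: "leadc (hmon Zm) = 1" and e: "epsH (hmon Zm) = 0"
    using leadc_factor[OF infinitesimal_0, of 1 "hmon Zm"] epsH_factor[OF infinitesimal_0, of 1 "hmon Zm"] by simp_all
  have "mon_comp K (hmon Zm) x = hmon x" for x
    unfolding mon_comp_def l e delta_Zm by (simp add: binH_def pser_0)
  then show ?thesis unfolding lin_op_def by (simp add: hmon_expansion)
qed

lemma
  assumes g: "admissible K G" and F: "hsupp F \<subseteq> dom_lmon K"
  shows hsupp_compH: "y \<in> hsupp (compH K G F) \<Longrightarrow> \<exists>x\<in>hsupp F. y - x \<in> shift_set K G \<and> x \<le> y"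
    and hsupp_compH_dom: "hsupp (compH K G F) \<subseteq> dom_lmon K"
    and hcoeff_compH_leading: "(\<forall>x\<in>hsupp F. x0 \<le> x) \<Longrightarrow>
      hcoeff (compH K G F) x0 = hcoeff F x0 * leadc G powr zexp x0"
    and hsupp_compH_ge: "(\<forall>x\<in>hsupp F. x0 \<le> x) \<Longrightarrow> \<forall>x\<in>hsupp (compH K G F). x0 \<le> x"
proof -
  interpret C: mult_shift_op "dom_lmon K" "shift_set K G" "mon_comp K G" by (rule mult_shift_op_compH[OF g])
  show s: "\<exists>x\<in>hsupp F. y - x \<in> shift_set K G \<and> x \<le> y" if "y \<in> hsupp (compH K G F)" for y
    using C.hsupp_op[OF F that] shift_set_nonneg[OF g] by fastforce
  show "hsupp (compH K G F) \<subseteq> dom_lmon K"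
  proof
    fix y assume "y \<in> hsupp (compH K G F)"
    then obtain x where "x \<in> hsupp F" "y - x \<in> shift_set K G" using s by blast
    then have "x + (y - x) \<in> dom_lmon K" using F shift_set_dom[OF g] by (intro dom_lmon_simps(4)) auto
    then show "y \<in> dom_lmon K" by simp
  qed
  show "\<forall>x\<in>hsupp (compH K G F). x0 \<le> x" if "\<forall>x\<in>hsupp F. x0 \<le> x"
    using s that by (meson order_trans)
  assume ge: "\<forall>x\<in>hsupp F. x0 \<le> x"
  have fin: "finite {x \<in> hsupp F. x0 - x \<in> shift_set K G}" by (intro finite_decompositions wos_hsupp wos_shift_set[OF g])
  have "hcoeff (compH K G F) x0 = (\<Sum>x\<in>{x \<in> hsupp F. x0 - x \<in> shift_set K G}. hcoeff F x * hcoeff (mon_comp K G x) x0)"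
    by (rule C.hcoeff_op) (use F in auto)
  also have "\<dots> = (\<Sum>x\<in>{x0}. hcoeff F x * hcoeff (mon_comp K G x) x0)"
  proof (rule sum.mono_neutral_left)
    show "{x \<in> hsupp F. x0 - x \<in> shift_set K G} \<subseteq> {x0}"
      using ge shift_set_nonneg[OF g] by (fastforce intro: antisym)
    show "\<forall>i\<in>{x0} - {x \<in> hsupp F. x0 - x \<in> shift_set K G}. hcoeff F i * hcoeff (mon_comp K G i) x0 = 0"
      using submonoid_shift_set[of K G] unfolding submonoid_def hsupp_def by auto
  qed simp
  finally show "hcoeff (compH K G F) x0 = hcoeff F x0 * leadc G powr zexp x0"
    by (simp add: hcoeff_mon_comp_diag[OF g])
qed

lemma compH_inj:
  assumes g: "admissible K G" and F: "hsupp F \<subseteq> dom_lmon K" "hsupp F' \<subseteq> dom_lmon K"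
    and eq: "compH K G F = compH K G F'"
  shows "F = F'"
proof (rule ccontr)
  interpret C: mult_shift_op "dom_lmon K" "shift_set K G" "mon_comp K G" by (rule mult_shift_op_compH[OF g])
  assume "F \<noteq> F'"
  then have "hsupp (F - F') \<noteq> {}"
    unfolding hsupp_def by (auto intro: hahn_eqI)
  then obtain x0 where x0: "x0 \<in> hsupp (F - F')" "\<forall>x\<in>hsupp (F - F'). x0 \<le> x"
    using wos_min[OF wos_hsupp] by blast
  have "hsupp (F - F') \<subseteq> dom_lmon K" using hsupp_diff[of F F'] F by blast
  from hcoeff_compH_leading[OF g this x0(2)]
  have "hcoeff (compH K G (F - F')) x0 = hcoeff (F - F') x0 * leadc G powr zexp x0" .
  moreover have "compH K G (F - F') = 0" using C.op_diff[OF F] eq by simp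
  moreover have "0 < leadc G powr zexp x0" using g unfolding admissible_def by simp
  ultimately show False using x0(1) unfolding hsupp_def by simp
qed

lemma infinitesimal_compH:
  assumes "admissible K G" "hsupp e \<subseteq> dom_lmon K" "infinitesimal e"
  shows "infinitesimal (compH K G e)"
  unfolding infinitesimal_def
proof
  fix y assume "y \<in> hsupp (compH K G e)"
  then obtain x where "x \<in> hsupp e" "x \<le> y" using hsupp_compH[OF assms(1,2)] by blast
  then show "0 < y" using assms(3) unfolding infinitesimal_def by (meson less_le_trans)
qed

section \<open>Associativity of composition\<close>

context
  fixes K :: nat and G H :: "lmon hahn"
  assumes G: "admissible K G" and H: "admissible K H"
begin

interpretation C: mult_shift_op "dom_lmon K" "shift_set K H" "mon_comp K H"
  by (rule mult_shift_op_compH[OF H])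

private abbreviation "Ch \<equiv> compH K H"

lemma compH_factor:
  "Ch G = (leadc G * leadc H) *\<^sub>R (hmon Zm * (1 + (epsH H + Ch (epsH G) + epsH H * Ch (epsH G))))"
proof -
  have d: "hsupp (epsH G) \<subseteq> dom_lmon K" "hsupp (1 + epsH G) \<subseteq> dom_lmon K"
    "hsupp (hmon Zm * (1 + epsH G)) \<subseteq> dom_lmon K"
  proof -
    show 1: "hsupp (epsH G) \<subseteq> dom_lmon K" by (rule hsupp_epsH_dom[OF G])
    then show 2: "hsupp (1 + epsH G) \<subseteq> dom_lmon K" using hsupp_add[of 1 "epsH G"] C.D_0 by auto
    show "hsupp (hmon Zm * (1 + epsH G)) \<subseteq> dom_lmon K"
      by (rule C.hsupp_mult_D[OF _ 2]) (simp add: dom_lmon_simps)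
  qed
  have "Ch G = Ch (leadc G *\<^sub>R (hmon Zm * (1 + epsH G)))" using admissible_factor[OF G] by simp
  also have "\<dots> = leadc G *\<^sub>R (Ch (hmon Zm) * (1 + Ch (epsH G)))"
    using d C.D_0 by (simp add: C.op_scaleR C.op_mult C.op_add C.op_1 dom_lmon_simps)
  also have "Ch (hmon Zm) = leadc H *\<^sub>R (hmon Zm * (1 + epsH H))"
    using compH_Zm[OF H] admissible_factor[OF H] by simp
  finally show ?thesis by (simp add: algebra_simps)
qed

lemma
  shows admissible_compH: "admissible K (Ch G)" and leadc_compH: "leadc (Ch G) = leadc G * leadc H"
    and epsH_compH: "epsH (Ch G) = epsH H + Ch (epsH G) + epsH H * Ch (epsH G)"
proof -
  have i: "infinitesimal (epsH H + Ch (epsH G) + epsH H * Ch (epsH G))"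
    by (intro infinitesimal_join infinitesimal_compH[OF H] infinitesimal_epsH[OF H] infinitesimal_epsH[OF G] hsupp_epsH_dom[OF G])
  have p: "0 < leadc G * leadc H" using G H unfolding admissible_def by simp
  have e: "hsupp (Ch (epsH G)) \<subseteq> dom_lmon K" by (rule hsupp_compH_dom[OF H hsupp_epsH_dom[OF G]])
  have d: "hsupp (epsH H + Ch (epsH G) + epsH H * Ch (epsH G)) \<subseteq> dom_lmon K"
    using hsupp_add[of "epsH H + Ch (epsH G)" "epsH H * Ch (epsH G)"] hsupp_add[of "epsH H" "Ch (epsH G)"]
      C.hsupp_mult_D[OF hsupp_epsH_dom[OF H] e] hsupp_epsH_dom[OF H] e by blast
  show "admissible K (Ch G)" by (rule admissible_of_factor[OF i p compH_factor d])
  show "leadc (Ch G) = leadc G * leadc H" by (rule leadc_factor[OF i _ compH_factor]) (use p in auto)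
  show "epsH (Ch G) = epsH H + Ch (epsH G) + epsH H * Ch (epsH G)"
    by (rule epsH_factor[OF i _ compH_factor]) (use p in auto)
qed

lemma infinitesimal_Ch_delta: "j \<le> K \<Longrightarrow> infinitesimal (Ch (delta G j))"
  by (intro infinitesimal_compH[OF H] hsupp_delta[OF G] infinitesimal_delta[OF G])

lemma log_delta_compH:
  assumes "j \<le> K" "delta (Ch G) j = delta H j + Ch (delta G j) + delta H j * Ch (delta G j)"
  shows "log_delta (Ch G) j = log_delta H j + Ch (log_delta G j)"
proof -
  have l: "logH (delta (Ch G) j) = logH (delta H j) + logH (Ch (delta G j))"
    unfolding assms(2) by (rule logH_join[OF infinitesimal_delta[OF H] infinitesimal_Ch_delta[OF assms(1)]])
  have c: "Ch (logH (delta G j)) = logH (Ch (delta G j))"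
    unfolding logH_def by (rule C.op_pser[OF infinitesimal_delta[OF G] hsupp_delta[OF G assms(1)]])
  show ?thesis
  proof (cases "j = 0")
    case True
    have "hsupp (logH (epsH G)) \<subseteq> dom_lmon K"
      unfolding logH_def by (intro hsupp_pser_submonoid submonoid_dom infinitesimal_epsH[OF G] hsupp_epsH_dom[OF G])
    moreover have "hsupp (ln (leadc G) *\<^sub>R 1) \<subseteq> dom_lmon K"
      using hsupp_scaleR[of "ln (leadc G)" 1] C.D_0 by auto
    ultimately have "Ch (ln (leadc G) *\<^sub>R 1 + logH (epsH G)) = ln (leadc G) *\<^sub>R 1 + Ch (logH (epsH G))"
      by (simp add: C.op_add C.op_scaleR C.op_1 C.D_0)
    moreover have "ln (leadc (Ch G)) = ln (leadc G) + ln (leadc H)"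
      using G H unfolding leadc_compH admissible_def by (simp add: ln_mult)
    ultimately show ?thesis
      using l c True unfolding log_delta_def by (simp add: scaleR_add_left)
  next
    case False
    then show ?thesis using l c unfolding log_delta_def by simp
  qed
qed

text \<open>Cocycle law for the units: (l_j o G o H) / l_j is the product of (l_j o H) / l_j and
  ((l_j o G) / l_j) o H. Taking logarithms makes the law at \<open>j\<close> additive, and the
  recursion for \<open>delta\<close> turns it into the law at \<open>Suc j\<close>.\<close>

lemma delta_compH: "j \<le> K \<Longrightarrow> delta (Ch G) j = delta H j + Ch (delta G j) + delta H j * Ch (delta G j)"
proof (induction j)
  case 0
  then show ?case by (simp add: epsH_compH)
next
  case (Suc j)
  let ?E = "hmon (Em (Suc j))"
  have Ed: "hsupp ?E \<subseteq> dom_lmon K" using Suc.prems by (simp add: dom_lmon_simps)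
  have Ld: "hsupp (log_delta G j) \<subseteq> dom_lmon K" using Suc.prems by (intro hsupp_log_delta[OF G]) simp
  have ELd: "hsupp (?E * log_delta G j) \<subseteq> dom_lmon K" by (rule C.hsupp_mult_D[OF Ed Ld])
  define a where "a = 1 + delta H (Suc j)"
  define b where "b = 1 + delta G (Suc j)"
  have a: "a = geomH (?E * log_delta H j)" and b: "b = geomH (?E * log_delta G j)"
    unfolding a_def b_def delta_Suc by simp_all
  have a1: "a * (1 - ?E * log_delta H j) = 1"
    unfolding a by (rule geomH_inverse[OF infinitesimal_Em_log_delta[OF H]])
  \<comment> \<open>l_(j+1) has a single nonzero exponent, so only the factor with index
    \<open>Suc j\<close> survives in the product.\<close>
  have CE: "Ch ?E = ?E * a"
  proof -
    have "(\<Prod>i = 1..K. binH (real_of_int (lexp (Em (Suc j)) i)) (delta H i))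
        = (\<Prod>i = 1..K. if i = Suc j then binH 1 (delta H (Suc j)) else 1)"
      by (rule prod.cong) (auto simp: infinitesimal_delta[OF H])
    also have "\<dots> = a"
      using Suc.prems by (simp add: prod.delta binH_1[OF infinitesimal_delta[OF H]] a_def)
    finally have "mon_comp K H (Em (Suc j)) = ?E * a"
      using H unfolding mon_comp_def admissible_def by (simp add: infinitesimal_epsH[OF H])
    then show ?thesis using C.op_hmon[of "Em (Suc j)"] Ed by simp
  qed
  have CL: "Ch (?E * log_delta G j) = ?E * a * Ch (log_delta G j)"
    using C.op_mult[OF Ed Ld] CE by simp
  have "Ch b = geomH (Ch (?E * log_delta G j))"
    unfolding b geomH_def by (rule C.op_pser[OF infinitesimal_Em_log_delta[OF G] ELd])
  then have b1: "Ch b * (1 - ?E * a * Ch (log_delta G j)) = 1"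
    using geomH_inverse[OF infinitesimal_compH[OF H ELd infinitesimal_Em_log_delta[OF G]]] CL by simp
  have log_delta: "log_delta (Ch G) j = log_delta H j + Ch (log_delta G j)"
    using Suc by (intro log_delta_compH) simp_all
  have s1: "geomH (?E * log_delta (Ch G) j) * (1 - ?E * log_delta (Ch G) j) = 1"
    by (rule geomH_inverse[OF infinitesimal_Em_log_delta[OF admissible_compH]])
  \<comment> \<open>Both \<open>geomH (?E * log_delta (Ch G) j)\<close> and \<open>Ch b * a\<close>
    turn out to invert \<open>1 - ?E * log_delta (Ch G) j\<close>; inverses being unique, they
    coincide.\<close>
  have "a * (1 - ?E * log_delta (Ch G) j) = a * (1 - ?E * log_delta H j) - ?E * a * Ch (log_delta G j)"
    unfolding log_delta by (simp add: algebra_simps)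
  then have "Ch b * a * (1 - ?E * log_delta (Ch G) j) = 1"
    using a1 b1 by (simp add: mult.assoc)
  moreover have "g * (Ch b * a * t) = g * t * (Ch b * a)" for g t :: "lmon hahn"
    by (simp only: mult_ac)
  ultimately have "geomH (?E * log_delta (Ch G) j) = Ch b * a"
    using s1 by (metis (no_types) mult_1 mult_1_right)
  moreover have "Ch b = 1 + Ch (delta G (Suc j))"
    unfolding b_def using hsupp_delta[OF G Suc.prems] C.D_0 by (simp add: C.op_add C.op_1)
  ultimately show ?case
    unfolding delta_Suc[of "Ch G"] a_def by (simp add: algebra_simps)
qed

lemma mon_comp_compH: "x \<in> dom_lmon K \<Longrightarrow> mon_comp K (Ch G) x = Ch (mon_comp K G x)"
proof -
  assume x: "x \<in> dom_lmon K"
  have d: "hsupp (binH b (delta G j)) \<subseteq> dom_lmon K" if "j \<le> K" for b j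
    using hsupp_binH_delta[OF G that] shift_set_dom[OF G] by blast
  have c: "Ch (binH b (delta G j)) = binH b (Ch (delta G j))" if "j \<le> K" for b j
    unfolding binH_def by (rule C.op_pser[OF infinitesimal_delta[OF G] hsupp_delta[OF G that]])
  have bb: "binH b (delta (Ch G) j) = binH b (delta H j) * Ch (binH b (delta G j))" if "j \<le> K" for b j
    unfolding delta_compH[OF that] c[OF that]
    by (rule binH_join[OF infinitesimal_delta[OF H] infinitesimal_Ch_delta[OF that]])
  let ?P = "\<Prod>j = 1..K. binH (real_of_int (lexp x j)) (delta G j)"
  have P: "hsupp ?P \<subseteq> dom_lmon K" "Ch ?P = (\<Prod>j = 1..K. Ch (binH (real_of_int (lexp x j)) (delta G j)))"
    using C.op_prod[of "{1..K}" "\<lambda>j. binH (real_of_int (lexp x j)) (delta G j)"] d by auto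
  have d0: "hsupp (binH (zexp x) (epsH G)) \<subseteq> dom_lmon K" using d[of 0] by simp
  have "Ch (mon_comp K G x) = (leadc G powr zexp x) *\<^sub>R (Ch (hmon x) * (Ch (binH (zexp x) (epsH G)) * Ch ?P))"
    unfolding mon_comp_def[of K G] using x P(1) d0 by (simp add: C.op_scaleR C.op_mult C.hsupp_mult_D)
  also have "\<dots> = (leadc G powr zexp x) *\<^sub>R (mon_comp K H x * (Ch (binH (zexp x) (epsH G)) * (\<Prod>j = 1..K. Ch (binH (real_of_int (lexp x j)) (delta G j)))))"
    unfolding P(2) C.op_hmon[OF x] ..
  also have "\<dots> = mon_comp K (Ch G) x"
  proof -
    have "(\<Prod>j = 1..K. binH (real_of_int (lexp x j)) (delta (Ch G) j)) =
      (\<Prod>j = 1..K. binH (real_of_int (lexp x j)) (delta H j)) * (\<Prod>j = 1..K. Ch (binH (real_of_int (lexp x j)) (delta G j)))"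
      unfolding prod.distrib[symmetric] by (rule prod.cong) (auto simp: bb)
    moreover have "binH (zexp x) (epsH (Ch G)) = binH (zexp x) (epsH H) * Ch (binH (zexp x) (epsH G))"
      using bb[of 0] by simp
    moreover have "leadc (Ch G) powr zexp x = leadc G powr zexp x * leadc H powr zexp x"
      using G H unfolding leadc_compH admissible_def by (simp add: powr_mult)
    ultimately show ?thesis unfolding mon_comp_def by (simp add: mult_ac)
  qed
  finally show ?thesis by simp
qed

text \<open>Strong linearity reduces the claim to monomials, where it is
  \<open>mon_comp_compH\<close>, a consequence of the cocycle law for the units.\<close>

theorem compH_assoc:
  assumes F: "hsupp F \<subseteq> dom_lmon K"
  shows "compH K (Ch G) F = Ch (compH K G F)"
proof -
  interpret CG: mult_shift_op "dom_lmon K" "shift_set K G" "mon_comp K G" by (rule mult_shift_op_compH[OF G])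
  have w: "hsupp (mon_comp K G x) \<subseteq> dom_lmon K" if "x \<in> dom_lmon K" for x
    using hsupp_compH_dom[OF G, of "hmon x"] CG.op_hmon[OF that] that by simp
  have "Ch (compH K G F) = hsum (hsupp F) (\<lambda>x. Ch (hcoeff F x *\<^sub>R mon_comp K G x))"
    unfolding lin_op_def[of "mon_comp K G"]
    by (rule C.op_hsum[OF CG.summable_fam_op[OF wos_hsupp F]])
       (use w F hsupp_scaleR in blast)
  also have "\<dots> = hsum (hsupp F) (\<lambda>x. hcoeff F x *\<^sub>R mon_comp K (Ch G) x)"
    by (rule hsum_cong) (use F w in \<open>auto simp: C.op_scaleR mon_comp_compH subset_iff\<close>)
  finally show ?thesis unfolding lin_op_def[of "mon_comp K (Ch G)"] by simp
qed

end

text \<open>A left inverse is found coefficient by coefficient along the well-ordered set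
  \<open>Zm + shift_set K G\<close>, on which composition with \<open>G\<close> is triangular with nonzero diagonal.\<close>

lemma left_inverse_exists:
  assumes g: "admissible K G"
  shows "\<exists>Q. admissible K Q \<and> leadc Q = 1 / leadc G \<and> compH K G Q = hmon Zm"
proof -
  interpret C: mult_shift_op "dom_lmon K" "shift_set K G" "mon_comp K G" by (rule mult_shift_op_compH[OF g])
  let ?T = "shift_set K G"
  define W where "W = {Zm} + ?T"
  have W: "wos W" unfolding W_def by (intro wos_set_plus wos_shift_set[OF g] wos_finite) simp
  have T0: "0 \<in> ?T" and Tadd: "\<And>x y. x \<in> ?T \<Longrightarrow> y \<in> ?T \<Longrightarrow> x + y \<in> ?T"
    using submonoid_shift_set[of K G] unfolding submonoid_def by blast+
  have Wiff: "x \<in> W \<longleftrightarrow> x - Zm \<in> ?T" for x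
    unfolding W_def set_plus_def by (auto simp: algebra_simps) (metis add_diff_cancel_left' diff_add_cancel add.commute)
  have Wd: "W \<subseteq> dom_lmon K"
    using shift_set_dom[OF g] dom_minus_Zm Wiff dom_lmon_simps(4)[of _ K Zm] dom_lmon_simps(1)
    by (metis diff_add_cancel subset_iff)
  have Wge: "Zm \<le> x" if "x \<in> W" for x
    using that shift_set_nonneg[OF g] unfolding Wiff by fastforce
  have WT: "y \<in> W" if "x \<in> W" "y - x \<in> ?T" for x y
    using Tadd[of "x - Zm" "y - x"] that unfolding Wiff by simp
  let ?X = "\<lambda>y. {x \<in> W. y - x \<in> ?T}"
  have finX: "finite (?X y)" for y by (rule finite_decompositions[OF W wos_shift_set[OF g]])
  \<comment> \<open>The coefficient equation at \<open>y\<close>, solved for \<open>q y\<close>: the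
    diagonal term is isolated and the remaining ones involve only smaller monomials. Outside
    \<open>W\<close> the coefficient is set to 0, which keeps the support well-ordered.\<close>
  let ?P = "\<lambda>q y r. r = (if y \<in> W then ((if y = Zm then 1 else 0) -
      (\<Sum>x\<in>?X y - {y}. q x * hcoeff (mon_comp K G x) y)) / leadc G powr zexp y else 0)"
  let ?R = "{(x, y). x \<in> W \<and> y \<in> W \<and> x < y}"
  have "\<exists>q. \<forall>y. ?P q y (q y)"
  proof (rule dependent_wf_choice[of ?R])
    show "wf ?R" using W unfolding wos_iff_wf .
    fix q p :: "lmon \<Rightarrow> real" and y r assume eq: "\<And>z. (z, y) \<in> ?R \<Longrightarrow> q z = p z"
    show "?P q y r = ?P p y r"
    proof (cases "y \<in> W")
      case True
      have "(\<Sum>x\<in>?X y - {y}. q x * hcoeff (mon_comp K G x) y) = (\<Sum>x\<in>?X y - {y}. p x * hcoeff (mon_comp K G x) y)"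
      proof (rule sum.cong[OF refl])
        fix x assume x: "x \<in> ?X y - {y}"
        then have "x < y" using shift_set_nonneg[OF g, of "y - x"] by (simp add: order_less_le)
        then have "q x = p x" using eq[of x] x True by simp
        then show "q x * hcoeff (mon_comp K G x) y = p x * hcoeff (mon_comp K G x) y" by simp
      qed
      then show ?thesis by simp
    qed simp
  qed blast
  then obtain q where q: "\<And>y. q y = (if y \<in> W then ((if y = Zm then 1 else 0) -
      (\<Sum>x\<in>?X y - {y}. q x * hcoeff (mon_comp K G x) y)) / leadc G powr zexp y else 0)" by blast
  define Q where "Q = Abs_hahn q"
  have Qq: "hcoeff Q = q" unfolding Q_def by (rule hcoeff_Abs[OF W]) (use q in \<open>metis\<close>)
  have Qs: "hsupp Q \<subseteq> W" unfolding hsupp_def Qq using q by (metis (mono_tags, lifting) mem_Collect_eq subsetI)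
  have Qd: "hsupp Q \<subseteq> dom_lmon K" using Qs Wd by blast
  have lcp: "0 < leadc G" using g unfolding admissible_def by simp
  have inv: "compH K G Q = hmon Zm"
  proof (rule hahn_eqI)
    fix y
    have c: "hcoeff (compH K G Q) y = (\<Sum>x\<in>?X y. q x * hcoeff (mon_comp K G x) y)"
      using C.hcoeff_op[OF Qs W Wd, of y] Qq by simp
    show "hcoeff (compH K G Q) y = hcoeff (hmon Zm) y"
    proof (cases "y \<in> W")
      case True
      then have y: "y \<in> ?X y" using T0 by simp
      have "q y * hcoeff (mon_comp K G y) y = (if y = Zm then 1 else 0) - (\<Sum>x\<in>?X y - {y}. q x * hcoeff (mon_comp K G x) y)"
        unfolding hcoeff_mon_comp_diag[OF g] using q[of y] True lcp by simp
      then show ?thesis unfolding c using sum.remove[OF finX y, of "\<lambda>x. q x * hcoeff (mon_comp K G x) y"] by simp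
    next
      case False
      then have "?X y = {}" using WT by blast
      moreover have "y \<noteq> Zm" using False T0 Wiff by auto
      ultimately show ?thesis unfolding c by (simp only: sum.empty hcoeff_hmon if_False)
    qed
  qed
  have ge: "\<forall>x\<in>hsupp Q. Zm \<le> x" using Qs Wge by blast
  have "leadc Q * leadc G = 1"
    using hcoeff_compH_leading[OF g Qd ge] inv lcp unfolding leadc_def by simp
  then have "leadc Q = 1 / leadc G" using lcp by (simp add: field_simps)
  then show ?thesis using inv ge Qd lcp unfolding admissible_def by (intro exI[of _ Q]) simp
qed

text \<open>The left inverse is two-sided: (G o Q) o G = G o (Q o G) = G = z o G, and composition
  with \<open>G\<close> on the right is injective.\<close>

lemma inverse_exists:
  assumes g: "admissible K G"
  obtains Q where "admissible K Q" "leadc Q = 1 / leadc G" "compH K G Q = hmon Zm" "compH K Q G = hmon Zm"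
proof -
  obtain Q where Q: "admissible K Q" "leadc Q = 1 / leadc G" "compH K G Q = hmon Zm"
    using left_inverse_exists[OF g] by blast
  have d: "hsupp G \<subseteq> dom_lmon K" using g unfolding admissible_def by blast
  have "compH K G (compH K Q G) = compH K (compH K G Q) G"
    using compH_assoc[OF Q(1) g d] by simp
  also have "\<dots> = compH K G (hmon Zm)"
    unfolding Q(3) compH_id compH_Zm[OF g] ..
  finally have "compH K Q G = hmon Zm"
    using compH_inj[OF g hsupp_compH_dom[OF Q(1) d]] by (simp add: dom_lmon_simps)
  with Q that show ?thesis by blast
qed

section \<open>Growth of iterates\<close>

definition agree :: "'g::linordered_ab_group_add \<Rightarrow> 'g hahn \<Rightarrow> 'g hahn \<Rightarrow> bool" where
  "agree v A B \<longleftrightarrow> (\<forall>x<v. hcoeff A x = hcoeff B x)"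

lemma agree_refl [simp]: "agree v A A"
  unfolding agree_def by simp

text \<open>Without negative exponents, a product coefficient at \<open>x\<close> uses only
  coefficients of the factors at monomials up to \<open>x\<close>.\<close>

lemma agree_mult:
  assumes n: "hsupp A \<subseteq> {x. 0 \<le> x}" "hsupp B \<subseteq> {x. 0 \<le> x}" "hsupp C \<subseteq> {x. 0 \<le> x}" "hsupp D \<subseteq> {x. 0 \<le> x}"
    and a: "agree v A B" "agree v C D"
  shows "agree v (A * C) (B * D)"
  unfolding agree_def
proof (intro allI impI)
  fix x assume x: "x < v"
  let ?P = "hsupp A \<union> hsupp B" and ?Q = "hsupp C \<union> hsupp D"
  have "hcoeff (A * C) x = (\<Sum>a\<in>{a \<in> ?P. x - a \<in> ?Q}. hcoeff A a * hcoeff C (x - a))"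
    by (rule hcoeff_mult) (auto simp: wos_Un)
  also have "\<dots> = (\<Sum>a\<in>{a \<in> ?P. x - a \<in> ?Q}. hcoeff B a * hcoeff D (x - a))"
  proof (rule sum.cong[OF refl])
    fix t assume "t \<in> {a \<in> ?P. x - a \<in> ?Q}"
    then have "0 \<le> t" "0 \<le> x - t" using n by auto
    then have "t \<le> x" "x - t \<le> x" by simp_all
    then have "t < v" "x - t < v" using x by (blast intro: le_less_trans)+
    then show "hcoeff A t * hcoeff C (x - t) = hcoeff B t * hcoeff D (x - t)"
      using a unfolding agree_def by simp
  qed
  also have "\<dots> = hcoeff (B * D) x"
    by (rule hcoeff_mult[symmetric]) (auto simp: wos_Un)
  finally show "hcoeff (A * C) x = hcoeff (B * D) x" .
qed

lemma hsupp_power_nonneg: "hsupp A \<subseteq> {x. 0 \<le> x} \<Longrightarrow> hsupp (A ^ i) \<subseteq> {x. 0 \<le> x}"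
  by (induction i) (simp_all add: hsupp_mult_submonoid[OF submonoid_nonneg])

lemma agree_power:
  "hsupp A \<subseteq> {x. 0 \<le> x} \<Longrightarrow> hsupp B \<subseteq> {x. 0 \<le> x} \<Longrightarrow> agree v A B \<Longrightarrow> agree v (A ^ i) (B ^ i)"
  by (induction i) (simp_all add: agree_mult hsupp_power_nonneg)

lemma agree_pser:
  assumes a: "infinitesimal a" and b: "infinitesimal b" and ab: "agree v a b"
  shows "agree v (pser c a) (pser c b)"
  unfolding agree_def
proof (intro allI impI)
  fix x assume x: "x < v"
  let ?J = "{i. x \<in> nfold (hsupp a) i} \<union> {i. x \<in> nfold (hsupp b) i}"
  have fin: "finite ?J"
    using a b unfolding infinitesimal_def by (auto intro: finite_nfold_lengths)
  have J: "i \<in> ?J" if "e = a \<or> e = b" "hcoeff (c i *\<^sub>R e ^ i) x \<noteq> 0" for e i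
    using that hsupp_power[of e i] by (auto simp: hsupp_def)
  have "hcoeff (pser c a) x = (\<Sum>i\<in>?J. hcoeff (c i *\<^sub>R a ^ i) x)"
    unfolding pser_def by (rule hcoeff_hsum[OF summable_fam_pser[OF a] fin]) (use J in auto)
  also have "\<dots> = (\<Sum>i\<in>?J. hcoeff (c i *\<^sub>R b ^ i) x)"
  proof (rule sum.cong[OF refl])
    fix i
    have "agree v (a ^ i) (b ^ i)"
      by (rule agree_power) (use infinitesimal_nonneg a b ab in auto)
    then show "hcoeff (c i *\<^sub>R a ^ i) x = hcoeff (c i *\<^sub>R b ^ i) x"
      using x unfolding agree_def by simp
  qed
  also have "\<dots> = hcoeff (pser c b) x"
    unfolding pser_def by (rule hcoeff_hsum[OF summable_fam_pser[OF b] fin, symmetric]) (use J in auto)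
  finally show "hcoeff (pser c a) x = hcoeff (pser c b) x" .
qed

context
  fixes K :: nat and G H :: "lmon hahn" and v :: lmon
  assumes G: "admissible K G" and H: "admissible K H" and leadc_eq: "leadc G = leadc H"
    and eps: "agree v (epsH G) (epsH H)"
begin

lemma agree_log_delta: "agree v (delta G j) (delta H j) \<Longrightarrow> agree v (log_delta G j) (log_delta H j)"
proof -
  assume "agree v (delta G j) (delta H j)"
  then have "agree v (logH (delta G j)) (logH (delta H j))"
    unfolding logH_def by (rule agree_pser[OF infinitesimal_delta[OF G] infinitesimal_delta[OF H]])
  then show ?thesis
    unfolding log_delta_def leadc_eq by (cases j) (auto simp: agree_def)
qed

lemma agree_delta: "agree v (delta G j) (delta H j)"
proof (induction j)
  case 0
  then show ?case using eps by simp
next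
  case (Suc j)
  have "agree v (hmon (Em (Suc j)) * log_delta G j) (hmon (Em (Suc j)) * log_delta H j)"
    by (intro agree_mult agree_refl agree_log_delta Suc log_delta_nonneg infinitesimal_delta[OF G] infinitesimal_delta[OF H])
       (auto simp: Em_pos less_imp_le)
  then have "agree v (geomH (hmon (Em (Suc j)) * log_delta G j)) (geomH (hmon (Em (Suc j)) * log_delta H j))"
    unfolding geomH_def by (intro agree_pser infinitesimal_Em_log_delta[OF G] infinitesimal_Em_log_delta[OF H])
  then show ?case unfolding delta_Suc agree_def by simp
qed

lemma hsupp_binH_delta_nonneg: "admissible K F \<Longrightarrow> hsupp (binH b (delta F j)) \<subseteq> {x. 0 \<le> x}"
  unfolding binH_def using hsupp_pser_nonneg[OF infinitesimal_delta] by blast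

lemma agree_mon_factor: "agree v (mon_factor K G x) (mon_factor K H x)"
proof -
  have b: "agree v (binH b (delta G j)) (binH b (delta H j))" for b j
    unfolding binH_def by (intro agree_pser agree_delta infinitesimal_delta[OF G] infinitesimal_delta[OF H])
  note n = hsupp_binH_delta_nonneg[OF G] hsupp_binH_delta_nonneg[OF H]
  have p: "hsupp (\<Prod>j\<in>I. binH (b j) (delta F j)) \<subseteq> {x. 0 \<le> x}" if "admissible K F" for b I F
    by (rule hsupp_prod_submonoid[OF submonoid_nonneg hsupp_binH_delta_nonneg[OF that]])
  have "agree v (\<Prod>j\<in>I. binH (b j) (delta G j)) (\<Prod>j\<in>I. binH (b j) (delta H j))" for b I
    by (induction I rule: infinite_finite_induct) (simp_all add: agree_mult n b p G H)
  then show ?thesis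
    unfolding mon_factor_def using agree_mult[OF n(1)[of _ 0] n(2)[of _ 0] p[OF G] p[OF H] b[of _ 0]] by simp
qed

text \<open>Agreement below \<open>v\<close> passes from \<open>epsH\<close> through every series in
  the construction. Consequently the difference of the two composition operators raises each
  monomial by at least \<open>v\<close>.\<close>

lemma hcoeff_mon_comp_agree: "y < u + v \<Longrightarrow> hcoeff (mon_comp K G u) y = hcoeff (mon_comp K H u) y"
  using agree_mon_factor[of u] unfolding agree_def hcoeff_mon_comp leadc_eq by (simp add: algebra_simps)

end

text \<open>The constant C = |a 0| + E / (\<mu> - b) is chosen so that b C + E <= \<mu> C, which is
  the induction step. The strict gap b < \<mu> matters: with equality the forcing term could add a
  factor linear in n.\<close>

lemma linear_recurrence_bound:
  fixes a e :: "nat \<Rightarrow> real"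
  assumes "\<And>n. a (Suc n) = b * a n + e n" "\<And>n. \<bar>e n\<bar> \<le> E * \<mu> ^ n" "0 \<le> b" "b < \<mu>" "0 \<le> E"
  shows "\<bar>a n\<bar> \<le> (\<bar>a 0\<bar> + E / (\<mu> - b)) * \<mu> ^ n"
proof (induction n)
  case 0
  then show ?case using assms by simp
next
  case (Suc n)
  define C where "C = \<bar>a 0\<bar> + E / (\<mu> - b)"
  have "E \<le> C * (\<mu> - b)" unfolding C_def using assms(4) by (simp add: distrib_right)
  then have *: "b * C + E \<le> C * \<mu>" by (simp add: algebra_simps)
  have "\<bar>a (Suc n)\<bar> \<le> \<bar>b * a n\<bar> + \<bar>e n\<bar>" unfolding assms(1) by (rule abs_triangle_ineq)
  also have "\<dots> \<le> b * (C * \<mu> ^ n) + E * \<mu> ^ n"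
    using Suc[folded C_def] assms(2)[of n] assms(3) by (intro add_mono) (auto simp: abs_mult intro: mult_left_mono)
  also have "\<dots> = (b * C + E) * \<mu> ^ n" by (simp add: algebra_simps)
  also have "\<dots> \<le> C * \<mu> * \<mu> ^ n" using * assms(3,4) by (intro mult_right_mono) auto
  finally show ?case unfolding C_def by simp
qed

text \<open>The shifts of \<open>G\<close> form a submonoid, so repeating the composition any number
  of times leads out of the same set for no n.\<close>

lemma
  assumes g: "admissible K G" and x0: "x0 \<in> dom_lmon K"
  shows hsupp_iter: "y \<in> hsupp ((compH K G ^^ n) (hmon x0)) \<Longrightarrow> y - x0 \<in> shift_set K G"
    and hsupp_iter_dom: "hsupp ((compH K G ^^ n) (hmon x0)) \<subseteq> dom_lmon K"
proof -
  have T: "0 \<in> shift_set K G" "\<And>x y. x \<in> shift_set K G \<Longrightarrow> y \<in> shift_set K G \<Longrightarrow> x + y \<in> shift_set K G"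
    using submonoid_shift_set[of K G] unfolding submonoid_def by blast+
  show d: "hsupp ((compH K G ^^ n) (hmon x0)) \<subseteq> dom_lmon K" for n
    by (induction n) (use x0 hsupp_compH_dom[OF g] in simp_all)
  show "y - x0 \<in> shift_set K G" if "y \<in> hsupp ((compH K G ^^ n) (hmon x0))" for y
    using that
  proof (induction n arbitrary: y)
    case 0
    then show ?case using T by simp
  next
    case (Suc n)
    then obtain x where "x \<in> hsupp ((compH K G ^^ n) (hmon x0))" "y - x \<in> shift_set K G"
      using hsupp_compH[OF g d[of n], of y] by auto
    then show ?case using Suc.IH[of x] T(2)[of "x - x0" "y - x"] by simp
  qed
qed

text \<open>The coefficient at \<open>y\<close> obeys a first-order linear recurrence whose factor
  is the diagonal entry at \<open>y\<close> and whose forcing is a finite combination of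
  coefficients at smaller monomials. Well-founded induction bounds these at rate
  \<open>\<mu>\<close>; the strict inequality assumed for \<open>\<mu>\<close> leaves room for equal
  diagonal entries.\<close>

lemma iter_growth:
  assumes g: "admissible K G" and x0: "x0 \<in> dom_lmon K"
    and mu: "\<And>x. x0 \<le> x \<Longrightarrow> x \<le> y \<Longrightarrow> leadc G powr zexp x < \<mu>"
  shows "\<exists>C\<ge>0. \<forall>n. \<bar>hcoeff ((compH K G ^^ n) (hmon x0)) y\<bar> \<le> C * \<mu> ^ n"
proof -
  interpret C: mult_shift_op "dom_lmon K" "shift_set K G" "mon_comp K G" by (rule mult_shift_op_compH[OF g])
  let ?a = "\<lambda>y n. hcoeff ((compH K G ^^ n) (hmon x0)) y"
  define W where "W = {x. x - x0 \<in> shift_set K G}"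
  have We: "W = {x0} + shift_set K G"
    unfolding W_def using C.in_shift[of _ x0 "{x0}"] by (auto elim!: set_plus_elim)
  have W: "wos W" unfolding We by (intro wos_set_plus wos_shift_set[OF g] wos_finite) simp
  have T: "0 \<in> shift_set K G" "\<And>x y. x \<in> shift_set K G \<Longrightarrow> y \<in> shift_set K G \<Longrightarrow> x + y \<in> shift_set K G"
    using submonoid_shift_set[of K G] unfolding submonoid_def by blast+
  have Wd: "W \<subseteq> dom_lmon K"
  proof
    fix x assume "x \<in> W"
    then have "x0 + (x - x0) \<in> dom_lmon K"
      unfolding W_def using shift_set_dom[OF g] x0 by (intro dom_lmon_simps(4)) auto
    then show "x \<in> dom_lmon K" by simp
  qed
  have aW: "?a x n = 0" if "x \<notin> W" for x n
    using hsupp_iter[OF g x0, of x n] that unfolding W_def hsupp_def by auto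
  have sW: "hsupp ((compH K G ^^ n) (hmon x0)) \<subseteq> W" for n
    using hsupp_iter[OF g x0] unfolding W_def by blast
  have wfW: "wf {(x, y). x \<in> W \<and> y \<in> W \<and> x < y}" using W unfolding wos_iff_wf .
  \<comment> \<open>The condition on \<open>\<mu>\<close> goes into the induced statement because
    its interval ends at \<open>y\<close>; passing to a smaller monomial only shortens the
    interval.\<close>
  have "(\<forall>x. x0 \<le> x \<longrightarrow> x \<le> y \<longrightarrow> leadc G powr zexp x < \<mu>) \<longrightarrow>
      (\<exists>C\<ge>0. \<forall>n. \<bar>?a y n\<bar> \<le> C * \<mu> ^ n)" for y
    using wfW
  proof (induction y rule: wf_induct_rule)
    case (less y)
    show ?case
    proof (cases "y \<in> W")
      case False
      then show ?thesis using aW by (intro impI exI[of _ 0]) simp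
    next
      case yW: True
      show ?thesis
      proof
        assume mu: "\<forall>x. x0 \<le> x \<longrightarrow> x \<le> y \<longrightarrow> leadc G powr zexp x < \<mu>"
        have "0 \<le> y - x0" using yW shift_set_nonneg[OF g] unfolding W_def by blast
        then have x0y: "x0 \<le> y" by simp
        let ?X = "{x \<in> W. y - x \<in> shift_set K G}"
        have fin: "finite ?X" by (rule finite_decompositions[OF W wos_shift_set[OF g]])
        have yX: "y \<in> ?X" using yW T by simp
        have "\<forall>x\<in>?X - {y}. \<exists>C\<ge>0. \<forall>n. \<bar>?a x n\<bar> \<le> C * \<mu> ^ n"
        proof
          fix x assume x: "x \<in> ?X - {y}"
          then have xy: "x < y" using shift_set_nonneg[OF g, of "y - x"] by (simp add: order_less_le)
          then have "\<forall>t. x0 \<le> t \<longrightarrow> t \<le> x \<longrightarrow> leadc G powr zexp t < \<mu>" using mu by (meson less_imp_le order_trans)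
          then show "\<exists>C\<ge>0. \<forall>n. \<bar>?a x n\<bar> \<le> C * \<mu> ^ n"
            using less[of x] x yW xy by blast
        qed
        from bchoice[OF this] obtain Cx where "\<forall>x\<in>?X - {y}. 0 \<le> Cx x \<and> (\<forall>n. \<bar>?a x n\<bar> \<le> Cx x * \<mu> ^ n)" ..
        then have Cx: "\<And>x. x \<in> ?X - {y} \<Longrightarrow> 0 \<le> Cx x"
            "\<And>x n. x \<in> ?X - {y} \<Longrightarrow> \<bar>?a x n\<bar> \<le> Cx x * \<mu> ^ n"
          by blast+
        define E where "E = (\<Sum>x\<in>?X - {y}. Cx x * \<bar>hcoeff (mon_comp K G x) y\<bar>)"
        define e where "e n = (\<Sum>x\<in>?X - {y}. ?a x n * hcoeff (mon_comp K G x) y)" for n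
        have E0: "0 \<le> E" unfolding E_def by (intro sum_nonneg mult_nonneg_nonneg Cx) auto
        have e: "\<bar>e n\<bar> \<le> E * \<mu> ^ n" for n
        proof -
          have "\<bar>e n\<bar> \<le> (\<Sum>x\<in>?X - {y}. \<bar>?a x n * hcoeff (mon_comp K G x) y\<bar>)"
            unfolding e_def by (rule sum_abs)
          also have "\<dots> \<le> (\<Sum>x\<in>?X - {y}. Cx x * \<mu> ^ n * \<bar>hcoeff (mon_comp K G x) y\<bar>)"
            unfolding abs_mult by (intro sum_mono mult_right_mono Cx) auto
          also have "\<dots> = E * \<mu> ^ n" unfolding E_def sum_distrib_right by (simp add: mult_ac)
          finally show ?thesis .
        qed
        have rec: "?a y (Suc n) = leadc G powr zexp y * ?a y n + e n" for n
        proof -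
          have "?a y (Suc n) = (\<Sum>x\<in>?X. ?a x n * hcoeff (mon_comp K G x) y)"
            using C.hcoeff_op[OF sW[of n] W Wd, of y] by simp
          also have "\<dots> = ?a y n * hcoeff (mon_comp K G y) y + e n"
            unfolding e_def by (rule sum.remove[OF fin yX])
          finally show ?thesis by (simp add: hcoeff_mon_comp_diag[OF g])
        qed
        have b: "leadc G powr zexp y < \<mu>" using mu x0y by blast
        have "\<bar>?a y n\<bar> \<le> (\<bar>?a y 0\<bar> + E / (\<mu> - leadc G powr zexp y)) * \<mu> ^ n" for n
          by (rule linear_recurrence_bound[of "?a y" _ e, OF rec e _ b E0]) simp
        moreover have "0 \<le> \<bar>?a y 0\<bar> + E / (\<mu> - leadc G powr zexp y)" using b E0 by simp
        ultimately show "\<exists>C\<ge>0. \<forall>n. \<bar>?a y n\<bar> \<le> C * \<mu> ^ n" by blast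
      qed
    qed
  qed
  then show ?thesis using mu by blast
qed

text \<open>A power of a composition operator is again a composition operator, with the iterate as
  inner series. Linearity and coefficient formulas for powers are inherited in this way.\<close>

lemma compH_funpow:
  assumes g: "admissible K G"
  shows "admissible K ((compH K G ^^ n) (hmon Zm)) \<and>
    (\<forall>F. hsupp F \<subseteq> dom_lmon K \<longrightarrow> compH K ((compH K G ^^ n) (hmon Zm)) F = (compH K G ^^ n) F)"
proof (induction n)
  case 0
  then show ?case by (simp add: admissible_Zm compH_id)
next
  case (Suc n)
  then show ?case
    using admissible_compH[OF _ g, of "(compH K G ^^ n) (hmon Zm)"]
      compH_assoc[OF _ g, of "(compH K G ^^ n) (hmon Zm)"] by simp
qed

text \<open>The finite index set does not depend on n, so bounds and limits in n can be taken term
  by term.\<close>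

lemma hcoeff_iter:
  assumes g: "admissible K G" and F: "hsupp F \<subseteq> A" "wos A" "A \<subseteq> dom_lmon K"
  shows "hcoeff ((compH K G ^^ n) F) y
    = (\<Sum>x\<in>{x \<in> A. y - x \<in> shift_set K G}. hcoeff F x * hcoeff ((compH K G ^^ n) (hmon x)) y)"
proof -
  define Gn where "Gn = (compH K G ^^ n) (hmon Zm)"
  have Gn: "admissible K Gn" "\<And>F. hsupp F \<subseteq> dom_lmon K \<Longrightarrow> compH K Gn F = (compH K G ^^ n) F"
    using compH_funpow[OF g, of n] unfolding Gn_def by blast+
  interpret C: mult_shift_op "dom_lmon K" "shift_set K Gn" "mon_comp K Gn" by (rule mult_shift_op_compH[OF Gn(1)])
  have w: "mon_comp K Gn x = (compH K G ^^ n) (hmon x)" if "x \<in> dom_lmon K" for x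
    using C.op_hmon[OF that] Gn(2)[of "hmon x"] that by simp
  \<comment> \<open>The iterate \<open>Gn\<close> has a shift set of its own; it is replaced by that
    of \<open>G\<close>, which is valid because shifts accumulate inside
    \<open>shift_set K G\<close>.\<close>
  interpret S: shift_op "dom_lmon K" "shift_set K G" "mon_comp K Gn"
    by standard (use wos_shift_set[OF g] hsupp_iter[OF g] w in auto)
  have "hcoeff ((compH K G ^^ n) F) y = hcoeff (compH K Gn F) y"
    using Gn(2)[of F] F by auto
  also have "\<dots> = (\<Sum>x\<in>{x \<in> A. y - x \<in> shift_set K G}. hcoeff F x * hcoeff (mon_comp K Gn x) y)"
    by (rule S.hcoeff_op[OF F])
  also have "\<dots> = (\<Sum>x\<in>{x \<in> A. y - x \<in> shift_set K G}. hcoeff F x * hcoeff ((compH K G ^^ n) (hmon x)) y)"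
    by (rule sum.cong[OF refl]) (use F(3) in \<open>auto simp: w\<close>)
  finally show ?thesis .
qed

lemma iter_leading:
  assumes g: "admissible K G" and F: "hsupp F \<subseteq> dom_lmon K" "\<forall>x\<in>hsupp F. x0 \<le> x"
  shows "hcoeff ((compH K G ^^ n) F) x0 = hcoeff F x0 * (leadc G powr zexp x0) ^ n \<and>
    hsupp ((compH K G ^^ n) F) \<subseteq> dom_lmon K \<and> (\<forall>x\<in>hsupp ((compH K G ^^ n) F). x0 \<le> x)"
proof (induction n)
  case (Suc n)
  let ?F = "(compH K G ^^ n) F"
  from Suc have i: "hcoeff ?F x0 = hcoeff F x0 * (leadc G powr zexp x0) ^ n" "hsupp ?F \<subseteq> dom_lmon K"
    "\<forall>x\<in>hsupp ?F. x0 \<le> x" by blast+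
  show ?case
    using hcoeff_compH_leading[OF g i(2,3)] hsupp_compH_dom[OF g i(2)] hsupp_compH_ge[OF g i(2,3)] i(1)
    by (simp add: mult_ac)
qed (use F in simp)

lemma iter_compH_diff:
  assumes g: "admissible K G" and "hsupp A \<subseteq> dom_lmon K" "hsupp B \<subseteq> dom_lmon K"
  shows "(compH K G ^^ n) (A - B) = (compH K G ^^ n) A - (compH K G ^^ n) B"
proof -
  define Gn where "Gn = (compH K G ^^ n) (hmon Zm)"
  have Gn: "admissible K Gn" "\<And>F. hsupp F \<subseteq> dom_lmon K \<Longrightarrow> compH K Gn F = (compH K G ^^ n) F"
    using compH_funpow[OF g, of n] unfolding Gn_def by blast+
  interpret C: mult_shift_op "dom_lmon K" "shift_set K Gn" "mon_comp K Gn" by (rule mult_shift_op_compH[OF Gn(1)])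
  have "hsupp (A - B) \<subseteq> dom_lmon K" using hsupp_diff[of A B] assms by blast
  then show ?thesis using C.op_diff[of A B] assms Gn(2) by simp
qed

section \<open>The error of the Koenigs sequence\<close>

locale koenigs =
  fixes K :: nat and f q h p :: "lmon hahn" and lam :: real and M :: lmon
  assumes f: "admissible K f" "leadc f = lam" and lam: "0 < lam" "lam < 1"
    and q: "admissible K q" "leadc q = 1 / lam"
    and h: "admissible K h" "leadc h = 1" and p: "admissible K p" "leadc p = 1"
    and M: "hcoeff h M \<noteq> hcoeff p M" "\<And>x. x < M \<Longrightarrow> hcoeff h x = hcoeff p x"
begin

text \<open>One set of shifts for both operators, so that their difference has a coefficient formula
  over a common index set.\<close>

definition T2 :: "lmon set" where "T2 = shift_set K h \<union> shift_set K p"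

lemma wos_T2: "wos T2" unfolding T2_def by (intro wos_Un wos_shift_set h p)

definition qn :: "nat \<Rightarrow> lmon hahn" where "qn n = (compH K q ^^ n) (hmon Zm)"

text \<open>The error before \<open>C_f^n\<close> is applied; \<open>dn n\<close> below is the error
  itself once the conjugacy is available. The numbers \<open>dw u x\<close> are the matrix entries
  of \<open>C_h - C_p\<close>.\<close>

definition Nq :: "nat \<Rightarrow> lmon hahn" where "Nq n = compH K h (qn n) - compH K p (qn n)"

definition A1 :: "lmon set" where "A1 = {x. x - Zm \<in> shift_set K q}"

definition dw :: "lmon \<Rightarrow> lmon \<Rightarrow> real" where
  "dw u x = hcoeff (mon_comp K h u) x - hcoeff (mon_comp K p u) x"

lemma A1_eq: "A1 = {Zm} + shift_set K q"
proof -
  have "x \<in> {Zm} + shift_set K q" if "x - Zm \<in> shift_set K q" for x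
    using set_plus_intro[of Zm "{Zm}" "x - Zm" "shift_set K q"] that by simp
  then show ?thesis unfolding A1_def by (auto elim!: set_plus_elim)
qed

lemma wos_A1: "wos A1" unfolding A1_eq by (intro wos_set_plus wos_shift_set q wos_finite) simp

lemma A1_dom: "A1 \<subseteq> dom_lmon K"
proof
  fix x assume "x \<in> A1"
  then have "Zm + (x - Zm) \<in> dom_lmon K"
    unfolding A1_def using shift_set_dom[OF q(1)] by (intro dom_lmon_simps) auto
  then show "x \<in> dom_lmon K" by simp
qed

lemma A1_ge: "x \<in> A1 \<Longrightarrow> Zm \<le> x"
  unfolding A1_def using shift_set_nonneg[OF q(1), of "x - Zm"] by simp

lemma hsupp_qn: "hsupp (qn n) \<subseteq> A1"
  unfolding qn_def A1_def using hsupp_iter[OF q(1) dom_lmon_simps(1)] by blast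

lemma T2_dom: "T2 \<subseteq> dom_lmon K"
  unfolding T2_def using shift_set_dom h(1) p(1) by blast

lemma
  shows hcoeff_Nq: "hcoeff (Nq n) x = (\<Sum>u\<in>{u \<in> A1. x - u \<in> T2}. hcoeff (qn n) u * dw u x)"
    and hsupp_Nq: "hsupp (Nq n) \<subseteq> A1 + T2"
proof -
  interpret H: mult_shift_op "dom_lmon K" "shift_set K h" "mon_comp K h" by (rule mult_shift_op_compH[OF h(1)])
  interpret P: mult_shift_op "dom_lmon K" "shift_set K p" "mon_comp K p" by (rule mult_shift_op_compH[OF p(1)])
  interpret H2: shift_op "dom_lmon K" T2 "mon_comp K h"
    by standard (use wos_T2 H.w_supp in \<open>auto simp: T2_def\<close>)
  interpret P2: shift_op "dom_lmon K" T2 "mon_comp K p"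
    by standard (use wos_T2 P.w_supp in \<open>auto simp: T2_def\<close>)
  show "hcoeff (Nq n) x = (\<Sum>u\<in>{u \<in> A1. x - u \<in> T2}. hcoeff (qn n) u * dw u x)"
    unfolding Nq_def minus_hahn.rep_eq H2.hcoeff_op[OF hsupp_qn wos_A1 A1_dom]
      P2.hcoeff_op[OF hsupp_qn wos_A1 A1_dom] dw_def
    by (simp add: sum_subtractf right_diff_distrib)
  have d: "hsupp (qn n) \<subseteq> dom_lmon K" using hsupp_qn A1_dom by blast
  have m: "hsupp (qn n) + T2 \<subseteq> A1 + T2" by (rule set_plus_mono2[OF hsupp_qn subset_refl])
  show "hsupp (Nq n) \<subseteq> A1 + T2"
    unfolding Nq_def using hsupp_diff[of "compH K h (qn n)" "compH K p (qn n)"]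
      H2.hsupp_op_subset[OF d] P2.hsupp_op_subset[OF d] m by blast
qed

lemma A2: "wos (A1 + T2)" "A1 + T2 \<subseteq> dom_lmon K"
proof -
  show "wos (A1 + T2)" by (intro wos_set_plus wos_A1 wos_T2)
  show "A1 + T2 \<subseteq> dom_lmon K"
  proof
    fix x assume "x \<in> A1 + T2"
    then obtain a b where "a \<in> A1" "b \<in> T2" "x = a + b" by (rule set_plus_elim)
    then show "x \<in> dom_lmon K" using A1_dom T2_dom dom_lmon_simps(4) by blast
  qed
qed

lemma M_ge: "Zm \<le> M"
proof -
  have "M \<in> hsupp h \<or> M \<in> hsupp p" using M(1) unfolding hsupp_def by auto
  then show ?thesis using h(1) p(1) unfolding admissible_def by blast
qed

text \<open>The two values of \<open>epsH\<close> agree below \<open>M - Zm\<close>, the order of (h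
  - p) / z, and this gain is passed on to every monomial.\<close>

lemma dw_nonzero:
  assumes "dw u x \<noteq> 0"
  shows "u + (M - Zm) \<le> x"
proof (rule ccontr)
  assume "\<not> u + (M - Zm) \<le> x"
  moreover have "agree (M - Zm) (epsH h) (epsH p)"
    unfolding agree_def hcoeff_epsH using M(2) h(2) p(2) by (simp add: less_diff_eq)
  ultimately have "dw u x = 0"
    unfolding dw_def using hcoeff_mon_comp_agree[OF h(1) p(1) _ _, of "M - Zm" x u] h(2) p(2) by simp
  then show False using assms by simp
qed

definition dn :: "nat \<Rightarrow> lmon hahn" where "dn n = (compH K f ^^ n) (Nq n)"

text \<open>Three leading terms multiply: \<open>C_q^n\<close> gives lam^(-n) at z, the operator
  difference sends z to h - p with leading monomial \<open>M\<close>, and \<open>C_f^n\<close>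
  contributes lam^n because \<open>M\<close> has z-exponent 1. The powers cancel.\<close>

lemma dn_constant:
  assumes "zexp M = 1"
  shows "hcoeff (dn n) M = hcoeff h M - hcoeff p M"
proof -
  have ql: "hcoeff (qn n) Zm = (1 / lam) ^ n"
    unfolding qn_def using iter_leading[OF q(1), of "hmon Zm" Zm n] q(2) lam by (simp add: dom_lmon_simps)
  \<comment> \<open>The chain u + (M - Zm) <= x <= M <= u + (M - Zm) forces equality everywhere. So
    nothing appears below \<open>M\<close>, and at \<open>M\<close> only \<open>u = Zm\<close>
    contributes.\<close>
  have z: "u = Zm \<and> x = M" if "u \<in> A1" "x \<le> M" "dw u x \<noteq> 0" for u x
  proof -
    have a: "M \<le> u + (M - Zm)" using add_right_mono[OF A1_ge[OF that(1)], of "M - Zm"] by simp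
    have b: "u + (M - Zm) \<le> x" by (rule dw_nonzero[OF that(3)])
    have "x = M" by (rule antisym[OF that(2) order_trans[OF a b]])
    moreover have u: "u + (M - Zm) = M" by (rule antisym[OF order_trans[OF b that(2)] a])
    moreover have "u = Zm" using u by (simp add: add_diff_eq diff_eq_eq)
    ultimately show ?thesis by blast
  qed
  have ge: "\<forall>x\<in>hsupp (Nq n). M \<le> x"
  proof (rule ballI, rule ccontr)
    fix x assume x: "x \<in> hsupp (Nq n)" "\<not> M \<le> x"
    then have "hcoeff (Nq n) x = 0"
      unfolding hcoeff_Nq using z by (intro sum.neutral) (auto simp: not_le dest: less_imp_le)
    then show False using x(1) unfolding hsupp_def by simp
  qed
  have "hcoeff (Nq n) M = (1 / lam) ^ n * (hcoeff h M - hcoeff p M)"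
  proof -
    have fin: "finite {u \<in> A1. M - u \<in> T2}" by (rule finite_decompositions[OF wos_A1 wos_T2])
    have "hcoeff (Nq n) M = (\<Sum>u\<in>{Zm}. hcoeff (qn n) u * dw u M)"
      unfolding hcoeff_Nq
    proof (rule sum.mono_neutral_cong[OF _ fin])
      fix u assume "u \<in> {Zm} - {u \<in> A1. M - u \<in> T2}"
      then have u: "u = Zm" "Zm \<notin> A1 \<or> M - Zm \<notin> T2" by auto
      have "Zm \<in> A1" unfolding A1_def using submonoid_shift_set unfolding submonoid_def by simp
      then have "M - Zm \<notin> T2" using u by blast
      then have "hcoeff (mon_comp K h Zm) M = 0" "hcoeff (mon_comp K p Zm) M = 0"
        using hsupp_mon_comp[OF h(1), of M Zm] hsupp_mon_comp[OF p(1), of M Zm] unfolding T2_def hsupp_def by auto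
      then show "hcoeff (qn n) u * dw u M = 0" using u unfolding dw_def by simp
    next
      fix u assume "u \<in> {u \<in> A1. M - u \<in> T2} - {Zm}"
      then show "hcoeff (qn n) u * dw u M = 0" using z[of u M] by auto
    qed auto
    then show ?thesis using ql by (simp add: dw_def mon_comp_Zm[OF h(1)] mon_comp_Zm[OF p(1)])
  qed
  moreover have "hsupp (Nq n) \<subseteq> dom_lmon K" using hsupp_Nq A2(2) by blast
  ultimately show ?thesis
    unfolding dn_def using iter_leading[OF f(1) _ ge, of n] f(2) assms lam
    by (simp add: power_divide)
qed

lemma dn_tendsto_0:
  assumes "1 < zexp M"
  shows "(\<lambda>n. hcoeff (dn n) y) \<longlonglongrightarrow> 0"
proof -
  define \<beta> where "\<beta> = zexp M - 1"
  have \<beta>: "0 < \<beta>" using assms unfolding \<beta>_def by simp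
  let ?X = "{x \<in> A1 + T2. y - x \<in> shift_set K f}"
  have c: "hcoeff (dn n) y = (\<Sum>x\<in>?X. hcoeff (Nq n) x * hcoeff ((compH K f ^^ n) (hmon x)) y)" for n
    unfolding dn_def by (rule hcoeff_iter[OF f(1) hsupp_Nq A2])
  have "(\<lambda>n. hcoeff (Nq n) x * hcoeff ((compH K f ^^ n) (hmon x)) y) \<longlonglongrightarrow> 0" if x: "x \<in> ?X" for x
  proof -
    have xd: "x \<in> dom_lmon K" using x A2(2) by blast
    \<comment> \<open>The slack needed for strictness in \<open>iter_growth\<close>. It is spent
      twice, once in each rate, so the quarter of \<open>\<beta>\<close> leaves
      \<open>lam powr (\<beta> / 2)\<close> as the product of \<open>\<mu>1\<close> and
      \<open>\<mu>2\<close>.\<close>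
    define \<kappa> where "\<kappa> = lam powr (- \<beta> / 4)"
    have \<kappa>: "1 < \<kappa>" unfolding \<kappa>_def using powr_less_mono'[of lam "- \<beta> / 4" 0] lam \<beta> by simp
    define \<mu>1 where "\<mu>1 = (1 / lam) powr (zexp x - \<beta>) * \<kappa>"
    define \<mu>2 where "\<mu>2 = lam powr zexp x * \<kappa>"
    have mu: "0 < \<mu>1" "0 < \<mu>2" unfolding \<mu>1_def \<mu>2_def using lam \<kappa> by simp_all
    have "\<exists>C\<ge>0. \<forall>n. \<bar>hcoeff (Nq n) x\<bar> \<le> C * \<mu>1 ^ n"
    proof -
      let ?U = "{u \<in> A1. x - u \<in> T2}"
      have "\<forall>u\<in>?U. \<exists>C\<ge>0. \<forall>n. \<bar>hcoeff (qn n) u * dw u x\<bar> \<le> C * \<mu>1 ^ n"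
      proof
        fix u assume "u \<in> ?U"
        show "\<exists>C\<ge>0. \<forall>n. \<bar>hcoeff (qn n) u * dw u x\<bar> \<le> C * \<mu>1 ^ n"
        proof (cases "dw u x = 0")
          case True
          then show ?thesis by (intro exI[of _ 0]) simp
        next
          case False
          have ux: "zexp u \<le> zexp x - \<beta>"
            using zexp_mono[OF dw_nonzero[OF False]] unfolding \<beta>_def by simp
          \<comment> \<open>As \<open>1 / lam > 1\<close>, diagonal entries of \<open>C_q\<close>
            increase with the z-exponent, so the top end \<open>u\<close> decides. For
            \<open>C_f\<close>, where \<open>lam < 1\<close>, the bottom end \<open>x\<close>
            decides.\<close>
          have "leadc q powr zexp t < \<mu>1" if "t \<le> u" for t
          proof -
            have "zexp t \<le> zexp x - \<beta>" using zexp_mono[OF that] ux by simp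
            then have "leadc q powr zexp t \<le> (1 / lam) powr (zexp x - \<beta>)"
              unfolding q(2) using lam by (intro powr_mono) auto
            also have "\<dots> < \<mu>1" unfolding \<mu>1_def using \<kappa> lam by simp
            finally show ?thesis .
          qed
          then obtain C where "0 \<le> C" "\<And>n. \<bar>hcoeff (qn n) u\<bar> \<le> C * \<mu>1 ^ n"
            using iter_growth[OF q(1) dom_lmon_simps(1), of u \<mu>1] unfolding qn_def by blast
          then have "\<bar>hcoeff (qn n) u * dw u x\<bar> \<le> (C * \<bar>dw u x\<bar>) * \<mu>1 ^ n" for n
            unfolding abs_mult using mult_right_mono[of "\<bar>hcoeff (qn n) u\<bar>" "C * \<mu>1 ^ n" "\<bar>dw u x\<bar>"]
            by (simp add: mult_ac)
          then show ?thesis using \<open>0 \<le> C\<close> by (intro exI[of _ "C * \<bar>dw u x\<bar>"]) simp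
        qed
      qed
      from bchoice[OF this] obtain C where
        "\<forall>u\<in>?U. 0 \<le> C u \<and> (\<forall>n. \<bar>hcoeff (qn n) u * dw u x\<bar> \<le> C u * \<mu>1 ^ n)" ..
      then have C: "\<And>u. u \<in> ?U \<Longrightarrow> 0 \<le> C u"
          "\<And>u n. u \<in> ?U \<Longrightarrow> \<bar>hcoeff (qn n) u * dw u x\<bar> \<le> C u * \<mu>1 ^ n" by blast+
      have "\<bar>hcoeff (Nq n) x\<bar> \<le> (\<Sum>u\<in>?U. C u) * \<mu>1 ^ n" for n
        unfolding hcoeff_Nq sum_distrib_right
        by (rule order_trans[OF sum_abs]) (intro sum_mono C)
      moreover have "0 \<le> (\<Sum>u\<in>?U. C u)" by (intro sum_nonneg C)
      ultimately show ?thesis by blast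
    qed
    then obtain C1 where C1: "0 \<le> C1" "\<And>n. \<bar>hcoeff (Nq n) x\<bar> \<le> C1 * \<mu>1 ^ n" by blast
    have "leadc f powr zexp t < \<mu>2" if "x \<le> t" for t
    proof -
      have "leadc f powr zexp t \<le> lam powr zexp x"
        unfolding f(2) using lam zexp_mono[OF that] by (intro powr_mono') auto
      also have "\<dots> < \<mu>2" unfolding \<mu>2_def using \<kappa> lam by simp
      finally show ?thesis .
    qed
    then obtain C2 where C2: "0 \<le> C2" "\<And>n. \<bar>hcoeff ((compH K f ^^ n) (hmon x)) y\<bar> \<le> C2 * \<mu>2 ^ n"
      using iter_growth[OF f(1) xd, of y \<mu>2] by blast
    have "\<mu>1 * \<mu>2 = lam powr (\<beta> / 2)"
    proof -
      have "(1 / lam) powr t = lam powr (- t)" for t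
        using lam by (simp add: powr_minus powr_divide inverse_eq_divide)
      then have "\<mu>1 * \<mu>2 = lam powr (- (zexp x - \<beta>)) * lam powr (- \<beta> / 4) * (lam powr zexp x * lam powr (- \<beta> / 4))"
        unfolding \<mu>1_def \<mu>2_def \<kappa>_def by simp
      also have "\<dots> = lam powr (- (zexp x - \<beta>) + (- \<beta> / 4) + (zexp x + (- \<beta> / 4)))"
        unfolding powr_add ..
      also have "- (zexp x - \<beta>) + (- \<beta> / 4) + (zexp x + (- \<beta> / 4)) = \<beta> / 2" by (simp add: field_simps)
      finally show ?thesis .
    qed
    moreover have "lam powr (\<beta> / 2) < 1" using powr_less_mono'[of lam 0 "\<beta> / 2"] lam \<beta> by simp
    ultimately have r: "0 \<le> \<mu>1 * \<mu>2" "\<mu>1 * \<mu>2 < 1" using mu by simp_all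
    have "(\<lambda>n. C1 * C2 * (\<mu>1 * \<mu>2) ^ n) \<longlonglongrightarrow> C1 * C2 * 0"
      by (intro tendsto_intros LIMSEQ_realpow_zero r)
    then have "(\<lambda>n. C1 * C2 * (\<mu>1 * \<mu>2) ^ n) \<longlonglongrightarrow> 0" by simp
    then show ?thesis
    proof (rule Lim_null_comparison[rotated])
      have "\<bar>hcoeff (Nq n) x * hcoeff ((compH K f ^^ n) (hmon x)) y\<bar> \<le> C1 * C2 * (\<mu>1 * \<mu>2) ^ n" for n
      proof -
        have "\<bar>hcoeff (Nq n) x\<bar> * \<bar>hcoeff ((compH K f ^^ n) (hmon x)) y\<bar> \<le> (C1 * \<mu>1 ^ n) * (C2 * \<mu>2 ^ n)"
          using C1 C2 mu by (intro mult_mono) auto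
        then show ?thesis by (simp add: abs_mult power_mult_distrib mult_ac)
      qed
      then show "\<forall>\<^sub>F n in sequentially. norm (hcoeff (Nq n) x * hcoeff ((compH K f ^^ n) (hmon x)) y) \<le> C1 * C2 * (\<mu>1 * \<mu>2) ^ n"
        by simp
    qed
  qed
  then have "(\<lambda>n. \<Sum>x\<in>?X. hcoeff (Nq n) x * hcoeff ((compH K f ^^ n) (hmon x)) y) \<longlonglongrightarrow> (\<Sum>x\<in>?X. 0)"
    by (intro tendsto_sum) auto
  then show ?thesis unfolding c by simp
qed

end

section \<open>Transfer to coefficient functions\<close>

definition to_lts :: "lmon hahn \<Rightarrow> lts" where
  "to_lts F = (\<lambda>x. hcoeff F (Mono (fst x) (snd x)))"

lemma to_lts_apply [simp]: "to_lts F (a, n) = hcoeff F (Mono a n)"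
  unfolding to_lts_def by simp

lemma to_lts_inject: "to_lts F = to_lts G \<longleftrightarrow> F = G"
proof
  assume eq: "to_lts F = to_lts G"
  show "F = G"
  proof (rule hahn_eqI)
    fix x show "hcoeff F x = hcoeff G x" using fun_cong[OF eq, of "(zexp x, lexp x)"] by simp
  qed
qed simp

lemma mless_iff: "mless x y \<longleftrightarrow> Mono (fst x) (snd x) < Mono (fst y) (snd y)"
  unfolding mless_def less_lmon_def by simp

lemma supp_to_lts: "x \<in> supp (to_lts F) \<longleftrightarrow> Mono (fst x) (snd x) \<in> hsupp F"
  unfolding supp_def hsupp_def to_lts_def by simp

lemma inL_to_ltsE:
  assumes "inL k f"
  obtains F where "f = to_lts F" "hsupp F \<subseteq> dom_lmon k"
proof -
  let ?g = "\<lambda>x. f (zexp x, lexp x)"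
  have "wf {(x, y). x \<in> supp f \<and> y \<in> supp f \<and> mless x y}"
    using assms unfolding inL_def wo_set_def by blast
  from wf_inv_image[OF this, of "\<lambda>x. (zexp x, lexp x)"]
  have "wos {x. ?g x \<noteq> 0}"
    unfolding wos_iff_wf inv_image_def supp_def by (simp add: mless_iff)
  then have c: "hcoeff (Abs_hahn ?g) = ?g" by (intro Abs_hahn_inverse) simp
  have "f = to_lts (Abs_hahn ?g)" unfolding to_lts_def c by simp
  moreover have "hsupp (Abs_hahn ?g) \<subseteq> dom_lmon k"
    unfolding hsupp_def c dom_lmon_def using assms unfolding inL_def supp_def by fastforce
  ultimately show ?thesis using that by blast
qed

lemma inL_to_lts:
  assumes "hsupp F \<subseteq> dom_lmon k" "\<forall>x\<in>hsupp F. 0 \<le> zexp x"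
  shows "inL k (to_lts F)"
proof -
  have "wf {(x, y). x \<in> hsupp F \<and> y \<in> hsupp F \<and> x < y}"
    using wos_hsupp[of F] unfolding wos_iff_wf .
  from wf_inv_image[OF this, of "\<lambda>x. Mono (fst x) (snd x)"]
  have "wo_set (supp (to_lts F))"
    unfolding wo_set_def inv_image_def supp_to_lts mless_iff by simp
  moreover have "0 \<le> fst x" "j = 0 \<or> k < j \<Longrightarrow> snd x j = 0" if "x \<in> supp (to_lts F)" for x j
    using that assms unfolding supp_to_lts dom_lmon_def by fastforce+
  ultimately show ?thesis unfolding inL_def by blast
qed

lemma to_lts_hmon: "mon x = to_lts (hmon (Mono (fst x) (snd x)))"
  unfolding mon_def to_lts_def by (auto simp: prod_eq_iff)

lemma to_lts_one: "tone = to_lts 1" and to_lts_Zm: "zid = to_lts (hmon Zm)" and to_lts_Em: "ell j = to_lts (hmon (Em j))"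
  unfolding tone_def zid_def ell_def to_lts_hmon by (simp_all add: hmon_0[symmetric] zero_lmon_def Zm_def Em_def)

lemma to_lts_add: "tadd (to_lts F) (to_lts G) = to_lts (F + G)" and to_lts_diff: "tsub (to_lts F) (to_lts G) = to_lts (F - G)"
  and to_lts_scaleR: "scal c (to_lts F) = to_lts (c *\<^sub>R F)"
  unfolding tadd_def tsub_def scal_def to_lts_def by simp_all

lemma to_lts_mult: "tmult (to_lts F) (to_lts G) = to_lts (F * G)"
proof
  fix x :: mon
  let ?x = "Mono (fst x) (snd x)"
  have "to_lts (F * G) x = (\<Sum>a\<in>{a \<in> hsupp F. ?x - a \<in> hsupp G}. hcoeff F a * hcoeff G (?x - a))"
    unfolding to_lts_def hcoeff_mult_hsupp ..
  also have "\<dots> = (\<Sum>p\<in>{(y, w). to_lts F y \<noteq> 0 \<and> to_lts G w \<noteq> 0 \<and> madd y w = x}. to_lts F (fst p) * to_lts G (snd p))"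
    by (rule sum.reindex_bij_witness[of _ "\<lambda>p. Mono (fst (fst p)) (snd (fst p))"
        "\<lambda>a. ((zexp a, lexp a), (zexp (?x - a), lexp (?x - a)))"])
       (auto simp: hsupp_def madd_def to_lts_def minus_lmon_def)
  finally show "tmult (to_lts F) (to_lts G) x = to_lts (F * G) x" unfolding tmult_def by simp
qed

lemma to_lts_power: "tpow (to_lts F) i = to_lts (F ^ i)"
  unfolding tpow_def by (induction i) (simp_all add: to_lts_one to_lts_mult)

lemma to_lts_hsum: "summable_fam I F \<Longrightarrow> ssum I (\<lambda>i. to_lts (F i)) = to_lts (hsum I F)"
  unfolding ssum_def by (rule ext) (simp add: to_lts_def hcoeff_hsum_nonzero)

lemma to_lts_binH: "infinitesimal e \<Longrightarrow> binser b (to_lts e) = to_lts (binH b e)"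
  unfolding binser_def binH_def pser_def to_lts_power to_lts_scaleR by (rule to_lts_hsum[OF summable_fam_pser])

lemma to_lts_geomH: "infinitesimal e \<Longrightarrow> geom (to_lts e) = to_lts (geomH e)"
  using to_lts_hsum[OF summable_fam_pser[of e "\<lambda>_. 1"]] unfolding geom_def geomH_def pser_def to_lts_power by simp

lemma to_lts_logH:
  assumes "infinitesimal e"
  shows "log1p (to_lts e) = to_lts (logH e)"
proof -
  let ?c = "\<lambda>i::nat. if i = 0 then 0 else (-1) ^ (i + 1) / real i"
  \<comment> \<open>The series in \<open>log1p\<close> starts at index 1; the index 0 added here has
    coefficient 0 and drops out of the sums over nonzero terms.\<close>
  have "log1p (to_lts e) = ssum UNIV (\<lambda>i. to_lts (?c i *\<^sub>R e ^ i))"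
    unfolding log1p_def ssum_def to_lts_power to_lts_scaleR
    by (intro ext sum.cong) (auto simp: to_lts_def)
  also have "\<dots> = to_lts (logH e)"
    unfolding logH_def pser_def by (rule to_lts_hsum[OF summable_fam_pser[OF assms]])
  finally show ?thesis .
qed

lemma to_lts_leadc: "to_lts G (1, zv) = leadc G"
  unfolding leadc_def Zm_def by simp

lemma to_lts_epsH: "eps (to_lts G) = to_lts (epsH G)"
proof
  fix x :: mon
  have "Mono (fst x) (snd x) + Zm = Mono (fst x + 1) (snd x)"
    unfolding plus_lmon_def Zm_def zv_def by simp
  moreover have "tone x = (if Mono (fst x) (snd x) = 0 then 1 else 0)"
    unfolding to_lts_one by (simp add: to_lts_def)
  ultimately show "eps (to_lts G) x = to_lts (epsH G) x"
    unfolding eps_def to_lts_leadc by (simp add: to_lts_def hcoeff_epsH)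
qed

lemma to_lts_delta: "admissible K G \<Longrightarrow> dlt (to_lts G) j = to_lts (delta G j)"
proof (induction j)
  case 0
  then show ?case by (simp add: to_lts_epsH)
next
  case (Suc j)
  have "(if j = 0 then tadd (scal (ln (to_lts G (1, zv))) tone) (log1p (eps (to_lts G))) else log1p (dlt (to_lts G) j))
      = to_lts (log_delta G j)"
    using Suc unfolding log_delta_def to_lts_leadc
    by (simp add: to_lts_one to_lts_scaleR to_lts_epsH to_lts_logH infinitesimal_epsH infinitesimal_delta to_lts_add)
  then have "dlt (to_lts G) (Suc j) = tsub (geom (tmult (ell (Suc j)) (to_lts (log_delta G j)))) tone"
    by simp
  also have "\<dots> = to_lts (delta G (Suc j))"
    unfolding delta_Suc to_lts_Em to_lts_mult to_lts_geomH[OF infinitesimal_Em_log_delta[OF Suc.prems]] to_lts_one to_lts_diff ..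
  finally show ?case .
qed

lemma to_lts_foldr:
  assumes "\<And>j. A j = to_lts (B j)" "distinct js"
  shows "foldr (\<lambda>j acc. tmult (A j) acc) js tone = to_lts (\<Prod>j\<in>set js. B j)"
  using assms(2) by (induction js) (simp_all add: to_lts_one to_lts_mult assms(1))

text \<open>\<open>comp_mon\<close> multiplies only up to the last logarithm occurring in the
  monomial, \<open>mon_comp\<close> always up to \<open>K\<close>. The extra factors have exponent 0
  and equal 1.\<close>

lemma to_lts_mon_comp:
  assumes g: "admissible K G" and x: "Mono (fst x) (snd x) \<in> dom_lmon K"
  shows "comp_mon (to_lts G) x = to_lts (mon_comp K G (Mono (fst x) (snd x)))"
proof -
  let ?S = "{0} \<union> {j. snd x j \<noteq> 0}" and ?b = "\<lambda>j. binH (real_of_int (snd x j)) (delta G j)"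
  have S: "?S \<subseteq> {..K}" using x unfolding dom_lmon_def by (auto intro: ccontr simp: not_le)
  then have fin: "finite ?S" using finite_subset by blast
  have M: "Max ?S \<le> K" using S fin by (subst Max_le_iff) auto
  have "foldr (\<lambda>j acc. tmult (binser (real_of_int (snd x j)) (dlt (to_lts G) j)) acc) [1..<Suc (Max ?S)] tone
      = to_lts (\<Prod>j\<in>set [1..<Suc (Max ?S)]. ?b j)"
    by (rule to_lts_foldr) (simp_all add: to_lts_delta[OF g] to_lts_binH infinitesimal_delta[OF g])
  also have "(\<Prod>j\<in>set [1..<Suc (Max ?S)]. ?b j) = (\<Prod>j = 1..K. ?b j)"
  proof (rule prod.mono_neutral_left)
    show "\<forall>j\<in>{1..K} - set [1..<Suc (Max ?S)]. ?b j = 1"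
    proof
      fix j assume j: "j \<in> {1..K} - set [1..<Suc (Max ?S)]"
      have "snd x j = 0"
      proof (rule ccontr)
        assume "snd x j \<noteq> 0"
        then have "j \<le> Max ?S" by (intro Max_ge fin) simp
        then show False using j by auto
      qed
      then show "?b j = 1" by (simp add: infinitesimal_delta[OF g])
    qed
  qed (use M in auto)
  finally show ?thesis
    unfolding comp_mon_def mon_comp_def to_lts_leadc to_lts_epsH to_lts_hmon
    by (simp only: to_lts_binH[OF infinitesimal_epsH[OF g]] to_lts_mult to_lts_scaleR lmon.sel)
qed

lemma to_lts_comp:
  assumes g: "admissible K G" and F: "hsupp F \<subseteq> dom_lmon K"
  shows "comp (to_lts F) (to_lts G) = to_lts (compH K G F)"
proof
  fix y
  interpret C: mult_shift_op "dom_lmon K" "shift_set K G" "mon_comp K G" by (rule mult_shift_op_compH[OF g])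
  let ?t = "\<lambda>x. hcoeff F x *\<^sub>R mon_comp K G x"
  have m: "scal (hcoeff F (Mono a b)) (comp_mon (to_lts G) (a, b)) = to_lts (?t (Mono a b))"
    if "Mono a b \<in> hsupp F" for a b
    using that F to_lts_mon_comp[OF g, of "(a, b)"] by (auto simp: to_lts_scaleR)
  have m': "scal (hcoeff F x) (comp_mon (to_lts G) (zexp x, lexp x)) = to_lts (?t x)" if "x \<in> hsupp F" for x
    using m[of "zexp x" "lexp x"] that by simp
  have "to_lts (compH K G F) y = ssum (hsupp F) (\<lambda>x. to_lts (?t x)) y"
    unfolding lin_op_def by (subst to_lts_hsum[OF C.summable_fam_op[OF wos_hsupp F]]) simp
  also have "\<dots> = comp (to_lts F) (to_lts G) y"
    unfolding ssum_def comp_def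
    by (rule sum.reindex_bij_witness[of _ "\<lambda>x. Mono (fst x) (snd x)" "\<lambda>x. (zexp x, lexp x)"])
       (auto simp: m m' supp_to_lts)
  finally show "comp (to_lts F) (to_lts G) y = to_lts (compH K G F) y" by simp
qed

text \<open>\<open>titer\<close> adds the new copy of the series on the outside, powers of
  \<open>compH K G\<close> add it on the inside. Associativity makes the two agree.\<close>

lemma to_lts_titer: "admissible K G \<Longrightarrow> titer (to_lts G) n = to_lts ((compH K G ^^ n) (hmon Zm))"
proof (induction n)
  case 0
  then show ?case unfolding titer_def by (simp add: to_lts_Zm)
next
  case (Suc n)
  have d: "hsupp G \<subseteq> dom_lmon K" using Suc.prems unfolding admissible_def by blast
  have "titer (to_lts G) (Suc n) = comp (to_lts G) (to_lts ((compH K G ^^ n) (hmon Zm)))"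
    using Suc unfolding titer_def by simp
  also have "\<dots> = to_lts (compH K ((compH K G ^^ n) (hmon Zm)) G)"
    using compH_funpow[OF Suc.prems] d by (intro to_lts_comp) auto
  also have "compH K ((compH K G ^^ n) (hmon Zm)) G = (compH K G ^^ n) (compH K G (hmon Zm))"
    using compH_funpow[OF Suc.prems, of n] d compH_Zm[OF Suc.prems] by simp
  finally show ?case by (simp add: funpow_swap1)
qed

section \<open>Inverses, normal forms and leading blocks as coefficient functions\<close>

lemma admissible_mono: "admissible K G \<Longrightarrow> K \<le> L \<Longrightarrow> admissible L G"
  unfolding admissible_def dom_lmon_def by fastforce

text \<open>Uniqueness uses cancellation of \<open>G\<close> on the right, which works for any
  competitor, whatever its leading term.\<close>

lemma tinv_eqI:
  assumes g: "admissible K G" and q: "admissible K Q" "compH K G Q = hmon Zm" "compH K Q G = hmon Zm"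
  shows "tinv (to_lts G) = to_lts Q"
  unfolding tinv_def
proof (rule the_equality)
  have d: "hsupp G \<subseteq> dom_lmon K" "hsupp Q \<subseteq> dom_lmon K" using g q unfolding admissible_def by blast+
  have "\<forall>x\<in>hsupp Q. 0 \<le> zexp x"
    using q(1) zexp_mono[of Zm] unfolding admissible_def by force
  then have "inL K (to_lts Q)" using d by (intro inL_to_lts) auto
  then show "(\<exists>k. inL k (to_lts Q)) \<and> comp (to_lts G) (to_lts Q) = zid \<and> comp (to_lts Q) (to_lts G) = zid"
    using to_lts_comp[OF g d(2)] to_lts_comp[OF q(1) d(1)] q by (auto simp: to_lts_Zm)
  fix t assume t: "(\<exists>k. inL k t) \<and> comp (to_lts G) t = zid \<and> comp t (to_lts G) = zid"
  then obtain k where "inL k t" by blast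
  then obtain P where P: "t = to_lts P" "hsupp P \<subseteq> dom_lmon k" by (rule inL_to_ltsE)
  \<comment> \<open>A competitor may involve more logarithms than \<open>K\<close>, so both
    candidates are compared in a common larger class; passing through \<open>comp\<close> shows that
    the enlargement does not change the composite of \<open>Q\<close> with \<open>G\<close>.\<close>
  let ?L = "max K k"
  have dm: "dom_lmon K \<subseteq> dom_lmon ?L" "dom_lmon k \<subseteq> dom_lmon ?L" unfolding dom_lmon_def by auto
  have gL: "admissible ?L G" by (rule admissible_mono[OF g]) simp
  have "to_lts (compH ?L G P) = zid"
    using to_lts_comp[OF gL, of P] P dm t by auto
  moreover have "to_lts (compH ?L G Q) = zid"
    using to_lts_comp[OF gL, of Q] to_lts_comp[OF g d(2)] d dm q by (auto simp: to_lts_Zm)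
  ultimately have "compH ?L G P = compH ?L G Q" by (simp flip: to_lts_inject)
  then have "P = Q" using compH_inj[OF gL, of P Q] P(2) d dm by blast
  then show "t = to_lts Q" using P by simp
qed

lemma admissible_to_ltsE:
  assumes "inL k f" "f (1, zv) = c" "0 < c" "\<forall>x\<in>supp f. x \<noteq> (1, zv) \<longrightarrow> mless (1, zv) x" "k \<le> K"
  obtains F where "f = to_lts F" "admissible K F" "leadc F = c"
proof -
  obtain F where F: "f = to_lts F" "hsupp F \<subseteq> dom_lmon k" using inL_to_ltsE[OF assms(1)] .
  have l: "leadc F = c" using F(1) to_lts_leadc assms(2) by simp
  have "Zm \<le> x" if "x \<in> hsupp F" for x
  proof (cases "x = Zm")
    case False
    then have "(zexp x, lexp x) \<noteq> (1, zv)" unfolding Zm_def by (metis lmon.collapse prod.inject)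
    moreover have "(zexp x, lexp x) \<in> supp f" using that unfolding F(1) supp_to_lts by simp
    ultimately have "mless (1, zv) (zexp x, lexp x)" using assms(4) by blast
    then show ?thesis unfolding mless_iff Zm_def by simp
  qed simp
  moreover have "hsupp F \<subseteq> dom_lmon K" using F(2) assms(5) unfolding dom_lmon_def by force
  ultimately have "admissible K F" unfolding admissible_def using l assms(3) by simp
  then show ?thesis using that F(1) l by blast
qed

lemma inL_supp_subset:
  assumes "inL k f" "supp g \<subseteq> supp f"
  shows "inL k g"
proof -
  have "wf {(x, y). x \<in> supp g \<and> y \<in> supp g \<and> mless x y}"
    by (rule wf_subset[of "{(x, y). x \<in> supp f \<and> y \<in> supp f \<and> mless x y}"])
       (use assms in \<open>auto simp: inL_def wo_set_def\<close>)
  then show ?thesis using assms unfolding inL_def wo_set_def by blast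
qed

text \<open>Ensures that the leading exponent is kept by \<open>nf\<close>; for \<open>k = 0\<close>
  the two vectors coincide.\<close>

lemma vle_zv_onek: "vle zv (onek k)"
proof (cases k)
  case 0
  then show ?thesis unfolding vle_def onek_def zv_def by auto
next
  case (Suc j)
  then have "vless zv (onek k)"
    unfolding vless_def onek_def zv_def by (intro exI[of _ 1]) auto
  then show ?thesis unfolding vle_def by blast
qed

lemma nf_lead: "nf k f (1, zv) = f (1, zv)"
  unfolding nf_def using vle_zv_onek by (simp add: vle_def)

lemma supp_nf: "supp (nf k f) \<subseteq> supp f"
  unfolding supp_def nf_def by auto

lemma lb_to_lts:
  assumes "admissible K F"
  shows "lb (to_lts F) = (\<lambda>x. if fst x = 1 then to_lts F x else 0)"
proof -
  have "(LEAST a. \<exists>n. to_lts F (a, n) \<noteq> 0) = 1"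
  proof (rule Least_equality)
    have "to_lts F (1, zv) \<noteq> 0" using assms unfolding to_lts_leadc admissible_def by simp
    then show "\<exists>n. to_lts F (1, n) \<noteq> 0" by (rule exI[where x = zv])
    fix a assume "\<exists>n. to_lts F (a, n) \<noteq> 0"
    then obtain n where "Mono a n \<in> hsupp F" unfolding hsupp_def by auto
    then have "Zm \<le> Mono a n" using assms unfolding admissible_def by blast
    then show "1 \<le> a" using zexp_mono by fastforce
  qed
  then show ?thesis unfolding lb_def by simp
qed

theorem mainTheorem3:
  fixes k m :: nat and f \<phi> h :: lts and lam :: real
  assumes f_in: "inL k f"
    and lam: "0 < lam" "lam < 1"
    and f_lead: "f (1, zv) = lam" "\<forall>x\<in>supp f. x \<noteq> (1, zv) \<longrightarrow> mless (1, zv) x"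
    and phi_in: "inL k \<phi>" "parabolic \<phi>"
    and phi_conj: "comp (comp \<phi> f) (tinv \<phi>) = nf k f"
    and h_in: "inL m h" "parabolic h"
  shows "(\<forall>a n. 0 \<le> a \<longrightarrow> (\<forall>j. (j = 0 \<or> max k m < j) \<longrightarrow> n j = 0) \<longrightarrow>
            (\<lambda>i. comp (comp (titer (tinv (nf k f)) i) h) (titer f i) (a, n))
              \<longlonglongrightarrow> \<phi> (a, n))
         \<longleftrightarrow> lb h = lb \<phi>"
proof -
  let ?K = "max k m"
  have phi: "\<phi> (1, zv) = 1" "\<forall>x\<in>supp \<phi>. x \<noteq> (1, zv) \<longrightarrow> mless (1, zv) x"
    and h: "h (1, zv) = 1" "\<forall>x\<in>supp h. x \<noteq> (1, zv) \<longrightarrow> mless (1, zv) x"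
    using phi_in(2) h_in(2) unfolding parabolic_def by blast+
  have nf: "nf k f (1, zv) = lam" "\<forall>x\<in>supp (nf k f). x \<noteq> (1, zv) \<longrightarrow> mless (1, zv) x"
    using f_lead supp_nf[of k f] by (auto simp: nf_lead)
  obtain F where F: "f = to_lts F" "admissible ?K F" "leadc F = lam"
    by (rule admissible_to_ltsE[OF f_in f_lead(1) lam(1) f_lead(2) max.cobounded1[of k m]])
  obtain P where P: "\<phi> = to_lts P" "admissible ?K P" "leadc P = 1"
    by (rule admissible_to_ltsE[OF phi_in(1) phi(1) zero_less_one phi(2) max.cobounded1[of k m]])
  obtain H where H: "h = to_lts H" "admissible ?K H" "leadc H = 1"
    by (rule admissible_to_ltsE[OF h_in(1) h(1) zero_less_one h(2) max.cobounded2[of m k]])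
  obtain F0 where F0: "nf k f = to_lts F0" "admissible ?K F0" "leadc F0 = lam"
    by (rule admissible_to_ltsE[OF inL_supp_subset[OF f_in supp_nf] nf(1) lam(1) nf(2) max.cobounded1[of k m]])
  obtain Q where Q: "admissible ?K Q" "leadc Q = 1 / lam" "compH ?K F0 Q = hmon Zm" "compH ?K Q F0 = hmon Zm"
    using inverse_exists[OF F0(2)] unfolding F0(3) .
  obtain R where R: "admissible ?K R" "compH ?K P R = hmon Zm" "compH ?K R P = hmon Zm"
    by (rule inverse_exists[OF P(2)])
  have D: "hsupp F \<subseteq> dom_lmon ?K" "hsupp P \<subseteq> dom_lmon ?K" "hsupp H \<subseteq> dom_lmon ?K"
      "hsupp F0 \<subseteq> dom_lmon ?K" "hsupp Q \<subseteq> dom_lmon ?K"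
    using F P H F0 Q unfolding admissible_def by blast+
  have tQ: "tinv (nf k f) = to_lts Q" unfolding F0(1) by (rule tinv_eqI[OF F0(2) Q(1,3,4)])
  have tR: "tinv \<phi> = to_lts R" unfolding P(1) by (rule tinv_eqI[OF P(2) R])
  let ?C = "compH ?K"
  \<comment> \<open>The hypothesis \<open>phi_conj\<close> in operator form; innermost series come
    first, so the inverse \<open>R\<close> of \<open>P\<close> is outermost here.\<close>
  have "to_lts (?C R (?C F P)) = comp (comp \<phi> f) (tinv \<phi>)"
    unfolding tR unfolding P(1) F(1) to_lts_comp[OF F(2) D(2)]
    by (rule to_lts_comp[OF R(1) hsupp_compH_dom[OF F(2) D(2)], symmetric])
  then have "?C R (?C F P) = F0" unfolding phi_conj F0(1) to_lts_inject .
  \<comment> \<open>Composing with \<open>P\<close> on the right cancels its inverse and leaves the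
    conjugacy as phi o f = f_0 o phi.\<close>
  then have "?C P F0 = ?C (?C P R) (?C F P)"
    using compH_assoc[OF R(1) P(2) hsupp_compH_dom[OF F(2) D(2)]] by simp
  then have conj: "?C F P = ?C P F0" unfolding R(2) compH_id by simp
  \<comment> \<open>Intertwining of operators: composing with phi and then with f equals composing
    with f_0 and then with phi. Together with \<open>canc\<close> it removes one \<open>?C F\<close>
    against one \<open>?C Q\<close>.\<close>
  have swap: "?C F (?C P X) = ?C P (?C F0 X)" if "hsupp X \<subseteq> dom_lmon ?K" for X
    using compH_assoc[OF P(2) F(2) that] compH_assoc[OF F0(2) P(2) that] conj by simp
  have canc: "?C F0 (?C Q X) = X" if "hsupp X \<subseteq> dom_lmon ?K" for X
    using compH_assoc[OF Q(1) F0(2) that] Q(3) compH_id by simp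
  let ?q = "\<lambda>n. (?C Q ^^ n) (hmon Zm)"
  have qd: "hsupp (?q n) \<subseteq> dom_lmon ?K" for n by (rule hsupp_iter_dom[OF Q(1) dom_lmon_simps(1)])
  \<comment> \<open>For h = phi the Koenigs sequence is constant. Subtracting this constant turns
    the general sequence into the limit candidate plus an error linear in
    \<open>?C H - ?C P\<close>.\<close>
  have fixed: "(?C F ^^ n) (?C P (?q n)) = P" for n
  proof (induction n)
    case 0
    then show ?case by (simp add: compH_Zm[OF P(2)])
  next
    case (Suc n)
    have "(?C F ^^ Suc n) (?C P (?q (Suc n))) = (?C F ^^ n) (?C F (?C P (?C Q (?q n))))"
      by (simp add: funpow_swap1)
    also have "\<dots> = (?C F ^^ n) (?C P (?q n))"
      using swap[OF hsupp_compH_dom[OF Q(1) qd[of n]]] canc[OF qd[of n]] by simp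
    finally show ?case using Suc by simp
  qed
  have seq: "comp (comp (titer (tinv (nf k f)) n) h) (titer f n) = to_lts ((?C F ^^ n) (?C H (?q n)))" for n
  proof -
    have "comp (titer (tinv (nf k f)) n) h = to_lts (?C H (?q n))"
      unfolding tQ to_lts_titer[OF Q(1)] H(1) by (rule to_lts_comp[OF H(2) qd])
    moreover have "comp (to_lts (?C H (?q n))) (titer f n) = to_lts (?C ((?C F ^^ n) (hmon Zm)) (?C H (?q n)))"
      unfolding F(1) to_lts_titer[OF F(2)]
      using compH_funpow[OF F(2), of n] by (intro to_lts_comp hsupp_compH_dom[OF H(2) qd]) blast
    ultimately show ?thesis
      using compH_funpow[OF F(2), of n] hsupp_compH_dom[OF H(2) qd[of n]] by simp
  qed
  have lb: "lb h = lb \<phi> \<longleftrightarrow> (\<forall>x. zexp x = 1 \<longrightarrow> hcoeff H x = hcoeff P x)"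
  proof
    assume "lb h = lb \<phi>"
    then have "hcoeff H x = hcoeff P x" if "zexp x = 1" for x
      using that fun_cong[of "lb h" "lb \<phi>" "(zexp x, lexp x)"]
      unfolding H(1) P(1) lb_to_lts[OF H(2)] lb_to_lts[OF P(2)] by (cases x) simp
    then show "\<forall>x. zexp x = 1 \<longrightarrow> hcoeff H x = hcoeff P x" by blast
  next
    assume "\<forall>x. zexp x = 1 \<longrightarrow> hcoeff H x = hcoeff P x"
    then show "lb h = lb \<phi>"
      unfolding H(1) P(1) lb_to_lts[OF H(2)] lb_to_lts[OF P(2)] by (auto simp: to_lts_def)
  qed
  show ?thesis
  proof (cases "H = P")
    case True
    then show ?thesis
      unfolding seq using fixed by (simp add: H(1) P(1))
  next
    case False
    then have "hsupp (H - P) \<noteq> {}" unfolding hsupp_def by (auto intro: hahn_eqI)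
    then obtain M where Mm: "M \<in> hsupp (H - P)" "\<forall>x\<in>hsupp (H - P). M \<le> x"
      using wos_min[OF wos_hsupp] by blast
    interpret koenigs ?K F Q H P lam M
      by standard (use F Q H P lam Mm in \<open>auto simp: hsupp_def not_le[symmetric]\<close>)
    have dn: "hcoeff ((?C F ^^ n) (?C H (?q n))) y = hcoeff P y + hcoeff (dn n) y" for n y
      unfolding dn_def Nq_def qn_def
      using iter_compH_diff[OF F(2) hsupp_compH_dom[OF H(2) qd[of n]] hsupp_compH_dom[OF P(2) qd[of n]], of n]
        fixed[of n] by simp
    have Mz: "1 \<le> zexp M" using zexp_mono[OF M_ge] by simp
    show ?thesis
    proof (cases "zexp M = 1")
      case True
      \<comment> \<open>\<open>M\<close> belongs to the monomials of L_r, so its coefficient is one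
        of those tested by the weak topology and its constant nonzero error prevents
        convergence.\<close>
      have Md: "M \<in> dom_lmon ?K" using Mm(1) hsupp_diff[of H P] D by blast
      have ne: "hcoeff H M - hcoeff P M \<noteq> 0" using Mm(1) unfolding hsupp_def by simp
      have "\<not> (\<lambda>i. comp (comp (titer (tinv (nf k f)) i) h) (titer f i) (zexp M, lexp M))
          \<longlonglongrightarrow> \<phi> (zexp M, lexp M)"
        unfolding seq P(1) using dn_constant[OF True] ne by (simp add: dn LIMSEQ_const_iff)
      moreover have "lb h \<noteq> lb \<phi>" unfolding lb using True ne by force
      moreover have "0 \<le> zexp M" "\<forall>j. (j = 0 \<or> max k m < j) \<longrightarrow> lexp M j = 0"
        using Mz Md unfolding dom_lmon_def by auto
      ultimately show ?thesis by blast
    next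
      case False
      then have M1: "1 < zexp M" using Mz by simp
      have "(\<lambda>i. comp (comp (titer (tinv (nf k f)) i) h) (titer f i) (a, n)) \<longlonglongrightarrow> \<phi> (a, n)" for a n
        unfolding seq P(1) to_lts_apply dn
        using tendsto_add[OF tendsto_const dn_tendsto_0[OF M1, of "Mono a n"]] by simp
      moreover have "hcoeff H x = hcoeff P x" if "zexp x = 1" for x
      proof (rule ccontr)
        assume "hcoeff H x \<noteq> hcoeff P x"
        then have "x \<in> hsupp (H - P)" unfolding hsupp_def by simp
        then show False using Mm(2) zexp_mono[of M x] M1 that by auto
      qed
      ultimately show ?thesis unfolding lb by blast
    qed
  qed
qed

end
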